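(* Let $E_1=\mathbb{C}/\Gamma_1$ and $E_2=\mathbb{C}/\Gamma_2$ be elliptic curves and $X=E_1\times E_2$, equipped with the Hermitian form $\omega$ induced by the Euclidean form $\frac{\sqrt{-1}}{2}(dz_1\wedge d\bar z_1+dz_2\wedge d\bar z_2)$ on $\mathbb{C}^2$. There exists an entire curve $g:\mathbb{C}\to X$ such that for every $e_1\in E_1$ there is an increasing sequence of radii $r_\ell\nearrow\infty$ for which the concentric discs $g\restriction_{\mathbb{D}_{r_\ell}}$ produce Nevanlinna currents and Ahlfors currents (along subsequences), and every such current is a positive multiple of the current of integration $[\{e_1\}\times E_2]$; and likewise for every $e_2\in E_2$ there is an increasing sequence of radii $r'_\ell\nearrow\infty$ for which the discs $g\restriction_{\mathbb{D}_{r'_\ell}}$ produce Nevanlinna and Ahlfors currents, each a positive multiple of $[E_1\times\{e_2\}]$.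
   Context: $\mathbb{D}_r$ denotes the open disc of radius $r$ centered at $0$ in $\mathbb{C}$. For a nonconstant holomorphic disc $f:\mathbb{D}_R\to X$ that is the restriction of a holomorphic map on a neighborhood of $\overline{\mathbb{D}}_R$, set $T_f(\eta)=\int_0^R\frac{dt}{t}\int_{\mathbb{D}_t}f^*\eta$ for smooth $(1,1)$-forms $\eta$ and $L_f(\omega)=\int_0^R\mathrm{Length}_\omega(f(\partial\mathbb{D}_t))\frac{dt}{t}$. A sequence of such discs $f_i:\mathbb{D}_{r_i}\to X$ produces Nevanlinna currents if $L_{f_i}(\omega)/T_{f_i}(\omega)\to0$; the Nevanlinna currents are the weak limits of subsequences of $T_{f_i}/T_{f_i}(\omega)$. It produces Ahlfors currents if $\mathrm{Length}_\omega(f_i(\partial\mathbb{D}_{r_i}))/\mathrm{Area}_\omega(f_i(\mathbb{D}_{r_i}))\to0$; the Ahlfors currents are the weak limits of subsequences of $[f_i(\mathbb{D}_{r_i})]/\mathrm{Area}_\omega(f_i(\mathbb{D}_{r_i}))$, where $[f_i(\mathbb{D}_{r_i})](\eta)=\int_{\mathbb{D}_{r_i}}f_i^*\eta$. *)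

theory Defs
  imports "HOL-Complex_Analysis.Complex_Analysis"
begin

text \<open>Points of X = E1 x E2 are represented by points of C^2 = complex \<times> complex
 (lifts). A lattice Gamma = Z a + Z b in C is given by an R-basis (a,b).
 A smooth (1,1)-form eta = sum_{j,k in {1,2}} eta j k (i/2) dz_j wedge dzbar_k on X
 is a family of smooth Gamma1 x Gamma2 - periodic coefficient functions on C^2.\<close>

type_synonym form11 = "nat \<Rightarrow> nat \<Rightarrow> complex \<times> complex \<Rightarrow> complex"

definition lattice_basis :: "complex \<Rightarrow> complex \<Rightarrow> bool" where
  "lattice_basis a b \<longleftrightarrow> Im (cnj a * b) \<noteq> 0"

fun Cn :: "nat \<Rightarrow> ('a::euclidean_space \<Rightarrow> 'b::real_normed_vector) \<Rightarrow> bool" where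
  "Cn 0 f = continuous_on UNIV f"
| "Cn (Suc n) f = (f differentiable_on UNIV \<and>
      (\<forall>v. Cn n (\<lambda>x. frechet_derivative f (at x) v)))"

definition smooth_fun :: "('a::euclidean_space \<Rightarrow> 'b::real_normed_vector) \<Rightarrow> bool" where
  "smooth_fun f \<longleftrightarrow> (\<forall>n. Cn n f)"

definition test_form :: "complex \<Rightarrow> complex \<Rightarrow> complex \<Rightarrow> complex \<Rightarrow> form11 \<Rightarrow> bool" where
  "test_form a1 b1 a2 b2 \<eta> \<longleftrightarrow>
     (\<forall>j\<in>{1,2}. \<forall>k\<in>{1,2}. smooth_fun (\<eta> j k) \<and>
        (\<forall>z w. \<eta> j k (z + a1, w) = \<eta> j k (z, w) \<and> \<eta> j k (z + b1, w) = \<eta> j k (z, w) \<and>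
               \<eta> j k (z, w + a2) = \<eta> j k (z, w) \<and> \<eta> j k (z, w + b2) = \<eta> j k (z, w)))"

definition omega11 :: form11 where
  "omega11 = (\<lambda>j k _. if j = k then 1 else 0)"

definition dcomp :: "(complex \<Rightarrow> complex) \<Rightarrow> (complex \<Rightarrow> complex) \<Rightarrow> nat \<Rightarrow> complex \<Rightarrow> complex" where
  "dcomp g1 g2 j z = (if j = 1 then deriv g1 z else deriv g2 z)"

text \<open>Coefficient of f^* eta with respect to (i/2) dz wedge dzbar = dx wedge dy, f = (g1,g2).\<close>
definition pb :: "form11 \<Rightarrow> (complex \<Rightarrow> complex) \<Rightarrow> (complex \<Rightarrow> complex) \<Rightarrow> complex \<Rightarrow> complex" where
  "pb \<eta> g1 g2 z = (\<Sum>j\<in>{1::nat,2}. \<Sum>k\<in>{1::nat,2}.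
       \<eta> j k (g1 z, g2 z) * dcomp g1 g2 j z * cnj (dcomp g1 g2 k z))"

definition disc_int :: "form11 \<Rightarrow> (complex \<Rightarrow> complex) \<Rightarrow> (complex \<Rightarrow> complex) \<Rightarrow> real \<Rightarrow> complex" where
  "disc_int \<eta> g1 g2 t = integral (ball 0 t) (pb \<eta> g1 g2)"

definition nev_T :: "form11 \<Rightarrow> (complex \<Rightarrow> complex) \<Rightarrow> (complex \<Rightarrow> complex) \<Rightarrow> real \<Rightarrow> complex" where
  "nev_T \<eta> g1 g2 R = integral {0..R} (\<lambda>t. disc_int \<eta> g1 g2 t / complex_of_real t)"

definition bdry_len :: "(complex \<Rightarrow> complex) \<Rightarrow> (complex \<Rightarrow> complex) \<Rightarrow> real \<Rightarrow> real" where
  "bdry_len g1 g2 t = integral {0..2*pi} (\<lambda>\<theta>.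
      sqrt ((cmod (deriv g1 (of_real t * cis \<theta>)))\<^sup>2 + (cmod (deriv g2 (of_real t * cis \<theta>)))\<^sup>2) * t)"

definition nev_L :: "(complex \<Rightarrow> complex) \<Rightarrow> (complex \<Rightarrow> complex) \<Rightarrow> real \<Rightarrow> real" where
  "nev_L g1 g2 R = integral {0..R} (\<lambda>t. bdry_len g1 g2 t / t)"

definition area :: "(complex \<Rightarrow> complex) \<Rightarrow> (complex \<Rightarrow> complex) \<Rightarrow> real \<Rightarrow> real" where
  "area g1 g2 R = Re (disc_int omega11 g1 g2 R)"

definition produces_nev :: "(complex \<Rightarrow> complex) \<Rightarrow> (complex \<Rightarrow> complex) \<Rightarrow> (nat \<Rightarrow> real) \<Rightarrow> bool" where
  "produces_nev g1 g2 r \<longleftrightarrow>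
     (\<lambda>l. nev_L g1 g2 (r l) / Re (nev_T omega11 g1 g2 (r l))) \<longlonglongrightarrow> 0"

definition produces_ahl :: "(complex \<Rightarrow> complex) \<Rightarrow> (complex \<Rightarrow> complex) \<Rightarrow> (nat \<Rightarrow> real) \<Rightarrow> bool" where
  "produces_ahl g1 g2 r \<longleftrightarrow>
     (\<lambda>l. bdry_len g1 g2 (r l) / area g1 g2 (r l)) \<longlonglongrightarrow> 0"

definition nev_current :: "(form11 \<Rightarrow> bool) \<Rightarrow> (complex \<Rightarrow> complex) \<Rightarrow> (complex \<Rightarrow> complex)
    \<Rightarrow> (nat \<Rightarrow> real) \<Rightarrow> (form11 \<Rightarrow> complex) \<Rightarrow> bool" where
  "nev_current TF g1 g2 r \<Phi> \<longleftrightarrow> (\<exists>\<phi>::nat\<Rightarrow>nat. strict_mono \<phi> \<and>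
     (\<forall>\<eta>. TF \<eta> \<longrightarrow>
        (\<lambda>n. nev_T \<eta> g1 g2 (r (\<phi> n)) / nev_T omega11 g1 g2 (r (\<phi> n))) \<longlonglongrightarrow> \<Phi> \<eta>))"

definition ahl_current :: "(form11 \<Rightarrow> bool) \<Rightarrow> (complex \<Rightarrow> complex) \<Rightarrow> (complex \<Rightarrow> complex)
    \<Rightarrow> (nat \<Rightarrow> real) \<Rightarrow> (form11 \<Rightarrow> complex) \<Rightarrow> bool" where
  "ahl_current TF g1 g2 r \<Phi> \<longleftrightarrow> (\<exists>\<phi>::nat\<Rightarrow>nat. strict_mono \<phi> \<and>
     (\<forall>\<eta>. TF \<eta> \<longrightarrow>
        (\<lambda>n. disc_int \<eta> g1 g2 (r (\<phi> n)) / complex_of_real (area g1 g2 (r (\<phi> n)))) \<longlonglongrightarrow> \<Phi> \<eta>))"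

definition parallelogram :: "complex \<Rightarrow> complex \<Rightarrow> complex set" where
  "parallelogram a b = {of_real s * a + of_real t * b | s t. s \<in> {0..<1} \<and> t \<in> {0..<1}}"

definition vert_current :: "complex \<Rightarrow> complex \<Rightarrow> complex \<Rightarrow> form11 \<Rightarrow> complex" where
  "vert_current a2 b2 p1 \<eta> = integral (parallelogram a2 b2) (\<lambda>w. \<eta> 2 2 (p1, w))"

definition horiz_current :: "complex \<Rightarrow> complex \<Rightarrow> complex \<Rightarrow> form11 \<Rightarrow> complex" where
  "horiz_current a1 b1 p2 \<eta> = integral (parallelogram a1 b1) (\<lambda>w. \<eta> 1 1 (w, p2))"

definition radii :: "(nat \<Rightarrow> real) \<Rightarrow> bool" where
  "radii r \<longleftrightarrow> r 0 > 0 \<and> strict_mono r \<and> filterlim r at_top sequentially"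

end

theory Submission
  imports Defs "HOL-Real_Asymp.Real_Asymp"
begin

text \<open>Call a disc of radius \<open>R\<close> concentrated over \<open>p\<close> when the boundary length of its image is small compared
  with the area and most of the area is carried by points where \<open>g\<^sub>1\<close> is close to \<open>p\<close> and \<open>g\<^sub>1'\<close> is
  negligible (together with the logarithmically averaged versions). Such discs converge to multiples of the vertical
  fibre over \<open>p\<close>: for a nontrivial character \<open>\<chi> = exp (i Re (\<kappa> w))\<close> of the second torus,
  \<open>\<chi>(g\<^sub>2) |g\<^sub>2'|\<^sup>2\<close> is, up to a constant, the \<open>\<partial>/\<partial>z\<close>-derivative of
  \<open>\<chi>(g\<^sub>2)\<close> times the conjugate of \<open>g\<^sub>2'\<close>, so its integral is bounded by the boundary length, and
  trigonometric polynomials are dense.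

  Concentration is stable under small perturbations on a slightly larger disc. On the other hand any pair of entire
  functions can be perturbed arbitrarily little on a given disc so as to become concentrated over a given point at some
  larger radius: first make \<open>g\<^sub>1\<close> take the prescribed value at \<open>r\<close>, then add to \<open>g\<^sub>2\<close> a tall
  narrow peak at \<open>r\<close>. Iterating over a dense sequence of points, for both factors alternately, gives the curve.\<close>

section \<open>Integrals over discs and circles\<close>

text \<open>Two features make the scheme work. First, the comparison constants depend on the form,
  the point and the tolerance, never on the curve or the radius; so the estimates can be integrated
  against dt/t and one curve serves every form. Second, concentration is a system of strict
  inequalities between integrals of continuous functions of g1, g1' and g2', hence an open condition
  that survives the passage to the limit curve. In the construction the order of choices is
  decisive: the first function is fixed before the parameter N of the peak, so the bounds on it do
  not involve N. The height N^4 leaves ample room: the energy is at least of order N^8, averaging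
  over a window of width 1/N still leaves order N^7, while the boundary length is at most of order
  N^5. The peak must also be invisible on the previous disc; the unit gap between the radii gives
  this, since N^4 exp(-N) tends to 0. Only countably many points can be treated one by one. The
  defect grows at most linearly with the displacement of the point, so an approximating point is as
  good as the point itself.\<close>

definition disc_integral :: "(complex \<Rightarrow> 'a::euclidean_space) \<Rightarrow> real \<Rightarrow> 'a" where
  "disc_integral \<phi> t = integral (ball 0 t) \<phi>"

definition circ_integral :: "(complex \<Rightarrow> real) \<Rightarrow> real \<Rightarrow> real" where
  "circ_integral \<phi> t = integral {0..2*pi} (\<lambda>\<theta>. \<phi> (of_real t * cis \<theta>) * t)"

text \<open>The integral against dt/t of Nevanlinna theory, for real and complex functions alike.
  The inverse of 0 is 0, so the integrand has a value at t = 0, and a single point does not affect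
  the integral.\<close>

definition log_average :: "(real \<Rightarrow> 'a::euclidean_space) \<Rightarrow> real \<Rightarrow> 'a" where
  "log_average F R = integral {0..R} (\<lambda>t. F t /\<^sub>R t)"

lemma continuous_absolutely_integrable_bounded:
  fixes \<phi> :: "complex \<Rightarrow> 'a::euclidean_space"
  assumes "continuous_on UNIV \<phi>" "bounded S" "S \<in> sets lebesgue"
  shows "\<phi> absolutely_integrable_on S"
proof -
  obtain c where "S \<subseteq> cbox (-c) c"
    using bounded_subset_cbox_symmetric[OF \<open>bounded S\<close>] by blast
  moreover have "\<phi> absolutely_integrable_on cbox (-c) c"
    by (rule absolutely_integrable_continuous) (use assms continuous_on_subset in blast)
  ultimately show ?thesis
    using set_integrable_subset assms(3) by blast
qed

lemma continuous_integrable_on_ball: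
  fixes \<phi> :: "complex \<Rightarrow> 'a::euclidean_space"
  assumes "continuous_on UNIV \<phi>"
  shows "\<phi> integrable_on ball 0 t"
  by (rule set_lebesgue_integral_eq_integral(1))
    (rule continuous_absolutely_integrable_bounded[OF assms], auto)

lemma disc_integral_const: "t \<ge> 0 \<Longrightarrow> disc_integral (\<lambda>_. c) t = (c::real) * (pi * t\<^sup>2)"
proof -
  assume t: "t \<ge> 0"
  have "integral (ball (0::complex) t) (\<lambda>_. 1::real) = measure lebesgue (ball (0::complex) t)"
    by (rule lmeasure_integral[symmetric]) simp
  also have "\<dots> = pi * t\<^sup>2"
    using t content_ball[of t "0::complex"] by (simp add: unit_ball_vol_2)
  finally have "integral (ball (0::complex) t) (\<lambda>_. c * 1) = c * (pi * t\<^sup>2)"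
    by (simp only: integral_mult_right)
  then show ?thesis
    by (simp add: disc_integral_def)
qed

lemma disc_integral_norm_le:
  fixes \<phi> :: "complex \<Rightarrow> 'a::euclidean_space"
  assumes "continuous_on UNIV \<phi>" "continuous_on UNIV \<psi>"
    and "\<And>z. z \<in> ball 0 t \<Longrightarrow> norm (\<phi> z) \<le> \<psi> z"
  shows "norm (disc_integral \<phi> t) \<le> disc_integral \<psi> t"
  unfolding disc_integral_def
  by (rule integral_norm_bound_integral) (use assms continuous_integrable_on_ball in blast)+

lemma disc_integral_le:
  assumes "continuous_on UNIV \<phi>" "continuous_on UNIV \<psi>"
    and "\<And>z. z \<in> ball 0 t \<Longrightarrow> \<phi> z \<le> \<psi> z"
  shows "disc_integral \<phi> t \<le> (disc_integral \<psi> t :: real)"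
  unfolding disc_integral_def
  by (rule integral_le) (use assms continuous_integrable_on_ball in blast)+

lemma disc_integral_nonneg:
  assumes "continuous_on UNIV \<phi>" "\<And>z. \<phi> z \<ge> 0"
  shows "disc_integral \<phi> t \<ge> (0::real)"
  unfolding disc_integral_def
  by (rule integral_nonneg) (use assms continuous_integrable_on_ball in blast)+

lemma disc_integral_add:
  fixes \<phi> :: "complex \<Rightarrow> 'a::euclidean_space"
  assumes "continuous_on UNIV \<phi>" "continuous_on UNIV \<psi>"
  shows "disc_integral (\<lambda>z. \<phi> z + \<psi> z) t = disc_integral \<phi> t + disc_integral \<psi> t"
  unfolding disc_integral_def
  by (rule integral_add) (use assms continuous_integrable_on_ball in blast)+

lemma disc_integral_diff:
  fixes \<phi> :: "complex \<Rightarrow> 'a::euclidean_space"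
  assumes "continuous_on UNIV \<phi>" "continuous_on UNIV \<psi>"
  shows "disc_integral (\<lambda>z. \<phi> z - \<psi> z) t = disc_integral \<phi> t - disc_integral \<psi> t"
  unfolding disc_integral_def
  by (rule integral_diff) (use assms continuous_integrable_on_ball in blast)+

lemma disc_integral_cmul: "disc_integral (\<lambda>z. (c::real) * \<phi> z) t = c * disc_integral \<phi> t"
  unfolding disc_integral_def by simp

lemma disc_integral_cmul_complex:
  "disc_integral (\<lambda>z. (c::complex) * \<phi> z) t = c * disc_integral \<phi> t"
  unfolding disc_integral_def by simp

lemma disc_integral_of_real:
  assumes "continuous_on UNIV \<phi>"
  shows "disc_integral (\<lambda>z. complex_of_real (\<phi> z)) t = of_real (disc_integral \<phi> t)"
  unfolding disc_integral_def
  using has_integral_of_real[OF integrable_integral[OF continuous_integrable_on_ball[OF assms]]]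
  by (rule integral_unique)

text \<open>The annulus between the radii s and t has area pi (t^2 - s^2). With s = 0 this also
  shows that disc integrals vanish to second order at the centre, which tames the weight
  1/t.\<close>

lemma disc_integral_lipschitz:
  fixes \<phi> :: "complex \<Rightarrow> 'a::euclidean_space"
  assumes \<phi>: "continuous_on UNIV \<phi>" and M: "\<And>z. z \<in> cball 0 R \<Longrightarrow> norm (\<phi> z) \<le> M"
    and "0 \<le> s" "s \<le> t" "t \<le> R"
  shows "norm (disc_integral \<phi> t - disc_integral \<phi> s) \<le> M * pi * (t\<^sup>2 - s\<^sup>2)"
proof -
  have sd: "integral (ball 0 t - ball 0 s) \<psi> = integral (ball 0 t) \<psi> - integral (ball 0 s) \<psi>"
    if "continuous_on UNIV \<psi>" for \<psi> :: "complex \<Rightarrow> 'b::euclidean_space"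
    by (rule integral_setdiff)
      (use that continuous_integrable_on_ball assms ball_subset_ball_iff[of 0 s "0::complex" t] in auto)
  have "norm (integral (ball 0 t - ball 0 s) \<phi>) \<le> integral (ball 0 t - ball 0 s) (\<lambda>_::complex. M)"
  proof (rule integral_norm_bound_integral)
    show "\<phi> integrable_on ball 0 t - ball 0 s" "(\<lambda>_::complex. M) integrable_on ball 0 t - ball 0 s"
      using \<phi> by (auto intro!: set_lebesgue_integral_eq_integral(1) continuous_absolutely_integrable_bounded
          bounded_diff)
  qed (use M assms in auto)
  also have "\<dots> = M * pi * (t\<^sup>2 - s\<^sup>2)"
    using disc_integral_const[of t M] disc_integral_const[of s M] assms
    by (simp add: sd disc_integral_def algebra_simps)
  finally show ?thesis
    by (simp add: sd[OF \<phi>] disc_integral_def)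
qed

lemma continuous_norm_bound_cball:
  fixes \<phi> :: "complex \<Rightarrow> 'a::real_normed_vector"
  assumes "continuous_on UNIV \<phi>"
  obtains M where "M > 0" "\<And>z. z \<in> cball 0 R \<Longrightarrow> norm (\<phi> z) \<le> M"
proof -
  have "compact (\<phi> ` cball 0 R)"
    using assms by (meson compact_cball compact_continuous_image continuous_on_subset subset_UNIV)
  then have "bounded (\<phi> ` cball 0 R)" by (rule compact_imp_bounded)
  then show ?thesis
    using that by (auto simp: bounded_pos)
qed

text \<open>After division by t the disc integral is still O(t), so the integrand extends
  continuously by 0 to t = 0; the convention that the inverse of 0 is 0 gives exactly this
  value.\<close>

lemma log_average_disc_integrable:
  fixes \<phi> :: "complex \<Rightarrow> 'a::euclidean_space"
  assumes \<phi>: "continuous_on UNIV \<phi>"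
  shows "(\<lambda>t. disc_integral \<phi> t /\<^sub>R t) integrable_on {0..R}"
proof (rule integrable_continuous_interval)
  obtain M where M: "M > 0" "\<And>z. z \<in> cball 0 R \<Longrightarrow> norm (\<phi> z) \<le> M"
    using continuous_norm_bound_cball[OF \<phi>] by blast
  have D0: "disc_integral \<phi> 0 = 0" by (simp add: disc_integral_def)
  have lip: "norm (disc_integral \<phi> t - disc_integral \<phi> s) \<le> M * pi * \<bar>t\<^sup>2 - s\<^sup>2\<bar>"
    if "t \<in> {0..R}" "s \<in> {0..R}" for s t
  proof (cases "s \<le> t")
    case True
    then have "s\<^sup>2 \<le> t\<^sup>2" using that by (simp add: power_mono)
    then show ?thesis using disc_integral_lipschitz[OF \<phi> M(2), of R s t] that True by auto
  next
    case False
    then have "t\<^sup>2 \<le> s\<^sup>2" using that by (simp add: power_mono)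
    then show ?thesis using disc_integral_lipschitz[OF \<phi> M(2), of R t s] that False
      by (auto simp: norm_minus_commute)
  qed
  have cont: "continuous_on {0..R} (disc_integral \<phi>)"
    unfolding continuous_on_def
  proof
    fix s assume s: "s \<in> {0..R}"
    have "((\<lambda>t. M * pi * \<bar>t\<^sup>2 - s\<^sup>2\<bar>) \<longlongrightarrow> M * pi * \<bar>s\<^sup>2 - s\<^sup>2\<bar>) (at s within {0..R})"
      by (intro tendsto_intros)
    then have "((\<lambda>t. M * pi * \<bar>t\<^sup>2 - s\<^sup>2\<bar>) \<longlongrightarrow> 0) (at s within {0..R})" by simp
    then have "((\<lambda>t. disc_integral \<phi> t - disc_integral \<phi> s) \<longlongrightarrow> 0) (at s within {0..R})"
      by (rule Lim_null_comparison[rotated]) (use lip s in \<open>auto simp: eventually_at_filter\<close>)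
    then show "(disc_integral \<phi> \<longlongrightarrow> disc_integral \<phi> s) (at s within {0..R})"
      by (simp add: LIM_zero_iff)
  qed
  show "continuous_on {0..R} (\<lambda>t. disc_integral \<phi> t /\<^sub>R t)"
    unfolding continuous_on_def
  proof
    fix s assume s: "s \<in> {0..R}"
    show "((\<lambda>t. disc_integral \<phi> t /\<^sub>R t) \<longlongrightarrow> disc_integral \<phi> s /\<^sub>R s) (at s within {0..R})"
    proof (cases "s = 0")
      case False
      then show ?thesis using cont s by (intro tendsto_intros) (auto simp: continuous_on_def)
    next
      case True
      have "((\<lambda>t. M * pi * t) \<longlongrightarrow> M * pi * 0) (at 0 within {0..R})"
        by (intro tendsto_intros)
      then have "((\<lambda>t. M * pi * t) \<longlongrightarrow> 0) (at 0 within {0..R})" by simp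
      then have "((\<lambda>t. disc_integral \<phi> t /\<^sub>R t) \<longlongrightarrow> 0) (at 0 within {0..R})"
      proof (rule Lim_null_comparison[rotated])
        have "norm (disc_integral \<phi> t /\<^sub>R t) \<le> M * pi * t" if "t \<in> {0..R}" "t \<noteq> 0" for t
          using lip[of t 0] that s True D0 by (simp add: field_simps power2_eq_square)
        then show "\<forall>\<^sub>F t in at 0 within {0..R}. norm (disc_integral \<phi> t /\<^sub>R t) \<le> M * pi * t"
          by (auto simp: eventually_at_filter)
      qed
      then show ?thesis using True by simp
    qed
  qed
qed

lemma circ_integrand_integrable:
  assumes "continuous_on UNIV \<phi>"
  shows "(\<lambda>\<theta>. \<phi> (of_real t * cis \<theta>) * t) integrable_on {0..2*pi::real}"
  by (intro integrable_continuous_interval continuous_intros continuous_on_compose2[OF assms]) auto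

text \<open>The arc length factor t cancels the weight 1/t off the origin, leaving the integral over
  the angle of a jointly continuous function.\<close>

lemma log_average_circ_integrable:
  assumes \<phi>: "continuous_on UNIV \<phi>"
  shows "(\<lambda>t. circ_integral \<phi> t /\<^sub>R t) integrable_on {0..R}"
proof -
  have "continuous_on {0..R} (\<lambda>t. integral (cbox 0 (2*pi)) (\<lambda>\<theta>. \<phi> (of_real t * cis \<theta>)))"
  proof (rule integral_continuous_on_param)
    show "continuous_on ({0..R} \<times> cbox 0 (2 * pi)) (\<lambda>(t, \<theta>). \<phi> (of_real t * cis \<theta>))"
      unfolding case_prod_unfold
      by (intro continuous_intros continuous_on_compose2[OF \<phi>]) auto
  qed
  then have "(\<lambda>t. integral {0..2*pi} (\<lambda>\<theta>. \<phi> (of_real t * cis \<theta>))) integrable_on {0..R}"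
    by (simp add: integrable_continuous_interval)
  then show ?thesis
  proof (rule integrable_spike)
    show "negligible {0::real}" by simp
    show "circ_integral \<phi> t /\<^sub>R t = integral {0..2*pi} (\<lambda>\<theta>. \<phi> (of_real t * cis \<theta>))"
      if "t \<in> {0..R} - {0}" for t
      using that by (simp add: circ_integral_def field_simps)
  qed
qed

lemma circ_integral_le:
  assumes "continuous_on UNIV \<phi>" "continuous_on UNIV \<psi>" "0 \<le> t"
    and "\<And>z. norm z = t \<Longrightarrow> \<phi> z \<le> \<psi> z"
  shows "circ_integral \<phi> t \<le> circ_integral \<psi> t"
  unfolding circ_integral_def
  by (rule integral_le) (use assms circ_integrand_integrable in \<open>auto intro!: mult_right_mono simp: norm_mult\<close>)

lemma circ_integral_nonneg:
  assumes "continuous_on UNIV \<phi>" "\<And>z. \<phi> z \<ge> 0" "0 \<le> t"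
  shows "circ_integral \<phi> t \<ge> 0"
  unfolding circ_integral_def
  by (rule integral_nonneg) (use assms circ_integrand_integrable in auto)

lemma circ_integral_const: "circ_integral (\<lambda>_. c) t = 2 * pi * t * c"
  by (simp add: circ_integral_def)

lemma circ_integral_diff:
  assumes "continuous_on UNIV \<phi>" "continuous_on UNIV \<psi>"
  shows "circ_integral (\<lambda>z. \<phi> z - \<psi> z) t = circ_integral \<phi> t - circ_integral \<psi> t"
  unfolding circ_integral_def left_diff_distrib
  by (rule integral_diff) (use assms circ_integrand_integrable in blast)+

lemma log_average_norm_le:
  fixes F :: "real \<Rightarrow> 'a::euclidean_space"
  assumes "(\<lambda>t. F t /\<^sub>R t) integrable_on {0..R}" "(\<lambda>t. G t /\<^sub>R t) integrable_on {0..R}"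
    and "\<And>t. 0 \<le> t \<Longrightarrow> t \<le> R \<Longrightarrow> norm (F t) \<le> G t"
  shows "norm (log_average F R) \<le> log_average G R"
  unfolding log_average_def
  by (rule integral_norm_bound_integral) (use assms in \<open>auto intro!: mult_left_mono\<close>)

lemma log_average_le:
  assumes "(\<lambda>t. F t /\<^sub>R t) integrable_on {0..R}" "(\<lambda>t. G t /\<^sub>R t) integrable_on {0..R}"
    and "\<And>t. 0 \<le> t \<Longrightarrow> t \<le> R \<Longrightarrow> F t \<le> (G t :: real)"
  shows "log_average F R \<le> log_average G R"
  unfolding log_average_def
  by (rule integral_le) (use assms in \<open>auto intro!: mult_left_mono\<close>)

lemma log_average_nonneg:
  assumes "(\<lambda>t. F t /\<^sub>R t) integrable_on {0..R}" "\<And>t. 0 \<le> t \<Longrightarrow> F t \<ge> (0::real)"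
  shows "log_average F R \<ge> 0"
  unfolding log_average_def
  by (rule integral_nonneg) (use assms in auto)

lemma log_average_add:
  fixes F :: "real \<Rightarrow> 'a::euclidean_space"
  assumes "(\<lambda>t. F t /\<^sub>R t) integrable_on {0..R}" "(\<lambda>t. G t /\<^sub>R t) integrable_on {0..R}"
  shows "log_average (\<lambda>t. F t + G t) R = log_average F R + log_average G R"
  unfolding log_average_def scaleR_add_right
  by (rule integral_add) (use assms in auto)

lemma log_average_diff:
  fixes F :: "real \<Rightarrow> 'a::euclidean_space"
  assumes "(\<lambda>t. F t /\<^sub>R t) integrable_on {0..R}" "(\<lambda>t. G t /\<^sub>R t) integrable_on {0..R}"
  shows "log_average (\<lambda>t. F t - G t) R = log_average F R - log_average G R"
  unfolding log_average_def scaleR_diff_right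
  by (rule integral_diff) (use assms in auto)

lemma log_average_cmul: "log_average (\<lambda>t. (c::real) * F t) R = c * log_average F R"
proof -
  have "(\<lambda>t. (c * F t) /\<^sub>R t) = (\<lambda>t. c * (F t /\<^sub>R t))" by auto
  then show ?thesis unfolding log_average_def by (simp only: integral_mult_right)
qed

lemma log_average_cmul_complex: "log_average (\<lambda>t. (c::complex) * F t) R = c * log_average F R"
proof -
  have "(\<lambda>t. (c * F t) /\<^sub>R t) = (\<lambda>t. c * (F t /\<^sub>R t))" by auto
  then show ?thesis unfolding log_average_def by (simp only: integral_mult_right)
qed

lemma log_average_of_real:
  assumes "(\<lambda>t. F t /\<^sub>R t) integrable_on {0..R}"
  shows "log_average (\<lambda>t. complex_of_real (F t)) R = of_real (log_average F R)"
proof -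
  have *: "(\<lambda>t. complex_of_real (F t) /\<^sub>R t) = (\<lambda>t. of_real (F t /\<^sub>R t))"
    by (auto simp: scaleR_conv_of_real)
  show ?thesis
    unfolding log_average_def *
    by (rule integral_unique[OF has_integral_of_real[OF integrable_integral[OF assms]]])
qed

lemma log_average_linear: "0 \<le> R \<Longrightarrow> log_average (\<lambda>t. c * t) R = (c::real) * R"
proof -
  assume "0 \<le> R"
  have "integral {0..R} (\<lambda>t. (c * t) /\<^sub>R t) = integral {0..R} (\<lambda>t. c)"
    by (rule integral_spike[of "{0}"]) auto
  then show ?thesis using \<open>0 \<le> R\<close> unfolding log_average_def by simp
qed

lemma linear_log_integrable: "(\<lambda>t. (c * t) /\<^sub>R t) integrable_on {0..R::real}"
  for c :: real
  by (rule integrable_spike[of "\<lambda>_. c" _ "{0}"]) auto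

section \<open>Boundary estimate for directional derivatives\<close>

text \<open>Both orders of the real coordinates occur because Fubini is applied with the inner
  integral along the direction of differentiation, which is once the real and once the imaginary
  axis.\<close>

lemma lborel_complex_coordinates:
  "distr (lborel \<Otimes>\<^sub>M lborel) borel (\<lambda>(x, y). Complex x y) = lborel"
  "distr (lborel \<Otimes>\<^sub>M lborel) borel (\<lambda>(y, x). Complex x y) = lborel"
proof -
  have C [measurable]: "(\<lambda>(x, y). Complex x y) \<in> borel_measurable (lborel \<Otimes>\<^sub>M lborel)"
     "(\<lambda>(y, x). Complex x y) \<in> borel_measurable (lborel \<Otimes>\<^sub>M lborel)"
    by (auto simp: lborel_prod case_prod_unfold Complex_eq
        intro!: borel_measurable_continuous_onI continuous_intros)
  show "distr (lborel \<Otimes>\<^sub>M lborel) borel (\<lambda>(x, y). Complex x y) = lborel"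
  proof (rule lborel_eqI[symmetric])
    fix l u :: complex
    assume le: "\<And>b. b \<in> Basis \<Longrightarrow> l \<bullet> b \<le> u \<bullet> b"
    have le': "Re l \<le> Re u" "Im l \<le> Im u"
      using le[of 1] le[of \<i>] by (auto simp: Basis_complex_def)
    have "(\<lambda>(x, y). Complex x y) -` box l u \<inter> space (lborel \<Otimes>\<^sub>M lborel)
        = {Re l<..<Re u} \<times> {Im l<..<Im u}"
      by (auto simp: in_box_complex_iff space_pair_measure)
    then show "emeasure (distr (lborel \<Otimes>\<^sub>M lborel) borel (\<lambda>(x, y). Complex x y)) (box l u)
        = (\<Prod>b\<in>Basis. (u - l) \<bullet> b)"
      using le' by (simp add: emeasure_distr lborel.emeasure_pair_measure_Times Basis_complex_def ennreal_mult)
  qed simp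
  show "distr (lborel \<Otimes>\<^sub>M lborel) borel (\<lambda>(y, x). Complex x y) = lborel"
  proof (rule lborel_eqI[symmetric])
    fix l u :: complex
    assume le: "\<And>b. b \<in> Basis \<Longrightarrow> l \<bullet> b \<le> u \<bullet> b"
    have le': "Re l \<le> Re u" "Im l \<le> Im u"
      using le[of 1] le[of \<i>] by (auto simp: Basis_complex_def)
    have "(\<lambda>(y, x). Complex x y) -` box l u \<inter> space (lborel \<Otimes>\<^sub>M lborel)
        = {Im l<..<Im u} \<times> {Re l<..<Re u}"
      by (auto simp: in_box_complex_iff space_pair_measure)
    then show "emeasure (distr (lborel \<Otimes>\<^sub>M lborel) borel (\<lambda>(y, x). Complex x y)) (box l u)
        = (\<Prod>b\<in>Basis. (u - l) \<bullet> b)"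
      using le' by (simp add: emeasure_distr lborel.emeasure_pair_measure_Times Basis_complex_def ennreal_mult mult.commute)
  qed simp
qed

text \<open>The part of the interval to the left of 0 is moved one period to the right, where it
  fills the gap up to 2 pi. The range of c makes one such move sufficient.\<close>

lemma integral_periodic_shift:
  fixes H :: "real \<Rightarrow> real"
  assumes H: "continuous_on UNIV H" and per: "\<And>\<theta>. H (\<theta> + 2 * pi) = H \<theta>"
    and c: "-2 * pi \<le> c" "c \<le> 0"
  shows "integral {c..c + 2 * pi} H = integral {0..2 * pi} H"
proof -
  have int: "H integrable_on {a..b}" for a b
    by (rule integrable_continuous_interval) (use H continuous_on_subset in blast)
  have "integral {c..c + 2 * pi} H = integral {c..0} H + integral {0..c + 2 * pi} H"
    using c by (intro Henstock_Kurzweil_Integration.integral_combine[symmetric] int) auto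
  also have "integral {c..0} H = integral {c..0} (H \<circ> (\<lambda>x. x + 2 * pi))"
    by (simp add: o_def per)
  also have "\<dots> = integral {c + 2 * pi..0 + 2 * pi} H"
    by (rule integral_shift) (use H continuous_on_subset in blast)
  also have "\<dots> + integral {0..c + 2 * pi} H = integral {0..c + 2 * pi} H + integral {c + 2 * pi..2 * pi} H"
    by simp
  also have "\<dots> = integral {0..2 * pi} H"
    using c by (intro Henstock_Kurzweil_Integration.integral_combine int) auto
  finally show ?thesis .
qed

lemma integral_reflect_about:
  fixes H :: "real \<Rightarrow> real"
  assumes H: "continuous_on UNIV H"
  shows "integral {a..b} (\<lambda>\<theta>. H (c - \<theta>)) = integral {c - b..c - a} H"
proof -
  have "integral {a..b} (\<lambda>\<theta>. H (c - \<theta>)) = integral {-b..-a} (\<lambda>\<theta>. H (c + \<theta>))"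
    using Henstock_Kurzweil_Integration.integral_reflect_real[of b a "\<lambda>\<theta>. H (c - \<theta>)"] by simp
  also have "\<dots> = integral {-b..-a} (H \<circ> (\<lambda>\<theta>. \<theta> + c))"
    by (simp add: o_def add.commute)
  also have "\<dots> = integral {-b + c..-a + c} H"
    by (rule integral_shift) (use H continuous_on_subset in blast)
  finally show ?thesis by simp
qed

text \<open>One half of Green's formula, with norms on the boundary. Fubini slices the disc into
  chords parallel to \<open>\<beta>\<close>; on each chord the fundamental theorem of calculus
  leaves the values of F at the two ends. The substitution u = R sin \<theta> turns the integral
  over the chords into one over the circle, since du = R cos \<theta> d\<theta> is at most the arc
  length element. The hypotheses on \<open>\<alpha>\<close> and \<open>\<beta>\<close> say that (u,
  v) are Euclidean coordinates, so that both axes are covered at once.\<close>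

lemma disc_integral_directional_derivative_aux:
  fixes F :: "complex \<Rightarrow> complex" and F' :: "complex \<Rightarrow> complex \<Rightarrow> complex"
  assumes F': "\<And>z. (F has_derivative F' z) (at z)"
    and cont: "continuous_on UNIV (\<lambda>z. F' z \<beta>)"
    and distr: "distr (lborel \<Otimes>\<^sub>M lborel) borel (\<lambda>(u, v). of_real u * \<alpha> + of_real v * \<beta>) = lborel"
    and nrm: "\<And>u v. (norm (of_real u * \<alpha> + of_real v * \<beta>))\<^sup>2 = u\<^sup>2 + v\<^sup>2"
    and R: "0 \<le> R"
  shows "norm (disc_integral (\<lambda>z. F' z \<beta>) R) \<le>
    integral {-pi/2..-pi/2 + 2 * pi} (\<lambda>\<theta>. norm (F (of_real (R * sin \<theta>) * \<alpha> + of_real (R * cos \<theta>) * \<beta>)) * R)"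
proof -
  define T where "T = (\<lambda>(u, v). of_real u * \<alpha> + of_real v * \<beta>)"
  define \<phi> where "\<phi> = (\<lambda>z. F' z \<beta>)"
  define S where "S = (\<lambda>u. sqrt (R\<^sup>2 - u\<^sup>2))"
  have cF: "continuous_on UNIV F"
    by (rule continuous_at_imp_continuous_on) (use F' has_derivative_continuous in blast)
  have cT: "continuous_on A T" for A
    unfolding T_def case_prod_unfold by (intro continuous_intros)
  have cphi: "continuous_on A \<phi>" for A
    using cont continuous_on_subset unfolding \<phi>_def by blast
  have T_cball: "T (u, v) \<in> cball 0 R \<longleftrightarrow> u\<^sup>2 + v\<^sup>2 \<le> R\<^sup>2" for u v
    using nrm[of u v] R abs_le_square_iff[of "cmod (of_real u * \<alpha> + of_real v * \<beta>)" R]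
    by (simp add: T_def)
  have T_int: "T (u, v) \<in> cball 0 R \<longleftrightarrow> u \<in> {-R..R} \<and> v \<in> {-S u..S u}" for u v
  proof -
    have "u\<^sup>2 + v\<^sup>2 \<le> R\<^sup>2 \<longleftrightarrow> u\<^sup>2 \<le> R\<^sup>2 \<and> v\<^sup>2 \<le> R\<^sup>2 - u\<^sup>2"
      by (smt (verit) zero_le_power2)
    also have "u\<^sup>2 \<le> R\<^sup>2 \<longleftrightarrow> u \<in> {-R..R}"
      using R abs_le_square_iff[of u R] by auto
    also have "u \<in> {-R..R} \<and> v\<^sup>2 \<le> R\<^sup>2 - u\<^sup>2 \<longleftrightarrow> u \<in> {-R..R} \<and> v \<in> {-S u..S u}"
    proof -
      have "v\<^sup>2 \<le> R\<^sup>2 - u\<^sup>2 \<longleftrightarrow> v \<in> {-S u..S u}"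
        unfolding S_def by (metis abs_le_iff atLeastAtMost_iff minus_le_iff real_sqrt_abs real_sqrt_le_iff)
      then show ?thesis by blast
    qed
    finally show ?thesis using T_cball by simp
  qed
  \<comment> \<open>The closed disc differs by a null set and is compact, which gives integrability
    of the cut-off function.\<close>
  have "disc_integral \<phi> R = integral (cball 0 R) \<phi>"
    unfolding disc_integral_def
    by (rule integral_spike_set) (auto intro!: negligible_subset[OF negligible_sphere[of 0 R]])
  also have "\<dots> = (LINT z|lborel. indicator (cball 0 R) z *\<^sub>R \<phi> z)"
    using set_borel_integral_eq_integral(2)[of "cball 0 R" \<phi>] borel_integrable_compact[OF compact_cball cphi, of 0 R]
    by (simp add: set_integrable_def set_lebesgue_integral_def)
  also have "\<dots> = (LINT p|(lborel \<Otimes>\<^sub>M lborel). indicator (cball 0 R) (T p) *\<^sub>R \<phi> (T p))"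
  proof (subst distr[symmetric], subst integral_distr)
    show "(\<lambda>(u, v). of_real u * \<alpha> + of_real v * \<beta>) \<in> lborel \<Otimes>\<^sub>M lborel \<rightarrow>\<^sub>M borel"
      by (auto simp: lborel_prod case_prod_unfold
          intro!: borel_measurable_continuous_onI continuous_intros)
    have "\<phi> \<in> borel_measurable borel"
      using cphi borel_measurable_continuous_onI by blast
    then show "(\<lambda>z. indicat_real (cball 0 R) z *\<^sub>R \<phi> z) \<in> borel_measurable borel"
      by (intro borel_measurable_scaleR borel_measurable_indicator) auto
  qed (simp add: T_def)
  also have "\<dots> = (LINT u|lborel. LINT v|lborel. indicator (cball 0 R) (T (u, v)) *\<^sub>R \<phi> (T (u, v)))"
  proof (rule lborel_pair.integral_fst'[symmetric])
    define K where "K = T -` cball 0 R"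
    have "closed K"
      unfolding K_def by (rule continuous_closed_vimage) (use cT[of UNIV] in \<open>auto simp: continuous_on_eq_continuous_at\<close>)
    moreover have "bounded K"
    proof -
      have "K \<subseteq> {-R..R} \<times> {-R..R}"
      proof
        fix p assume "p \<in> K"
        then obtain u v where p: "p = (u, v)" "u\<^sup>2 + v\<^sup>2 \<le> R\<^sup>2"
          by (cases p) (use T_cball in \<open>auto simp: K_def\<close>)
        then have "u\<^sup>2 \<le> R\<^sup>2" "v\<^sup>2 \<le> R\<^sup>2"
          by (smt (verit) zero_le_power2)+
        then show "p \<in> {-R..R} \<times> {-R..R}"
          using p R abs_le_square_iff[of u R] abs_le_square_iff[of v R] by auto
      qed
      then show ?thesis
        by (rule bounded_subset[rotated]) (intro bounded_Times bounded_closed_interval)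
    qed
    ultimately have "compact K" by (simp add: compact_eq_bounded_closed)
    then have "integrable lborel (\<lambda>p. indicator K p *\<^sub>R \<phi> (T p))"
      by (rule borel_integrable_compact) (intro continuous_on_compose2[OF cphi cT subset_UNIV])
    then show "integrable (lborel \<Otimes>\<^sub>M lborel) (\<lambda>p. indicat_real (cball 0 R) (T p) *\<^sub>R \<phi> (T p))"
      by (simp add: K_def lborel_prod indicator_vimage)
  qed
  also have "\<dots> = (LINT u|lborel. indicator {-R..R} u *\<^sub>R (F (T (u, S u)) - F (T (u, - S u))))"
  proof (rule Bochner_Integration.integral_cong[OF refl])
    fix u :: real
    show "(LINT v|lborel. indicator (cball 0 R) (T (u, v)) *\<^sub>R \<phi> (T (u, v)))
       = indicator {-R..R} u *\<^sub>R (F (T (u, S u)) - F (T (u, - S u)))"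
    proof (cases "u \<in> {-R..R}")
      case False
      then have "indicat_real (cball 0 R) (T (u, v)) = 0" for v
        using T_int[of u v] by (auto simp: indicator_def)
      then show ?thesis using False by simp
    next
      case True
      then have "u\<^sup>2 \<le> R\<^sup>2" using R abs_le_square_iff[of u R] by auto
      then have "- S u \<le> S u" by (simp add: S_def)
      have "(LINT v|lborel. indicator (cball 0 R) (T (u, v)) *\<^sub>R \<phi> (T (u, v)))
          = (LINT v|lborel. indicator {-S u..S u} v *\<^sub>R \<phi> (T (u, v)))"
        using True T_int by (intro Bochner_Integration.integral_cong) (auto simp: indicator_def)
      also have "\<dots> = F (T (u, S u)) - F (T (u, - S u))"
      proof (rule integral_FTC_atLeastAtMost[OF \<open>- S u \<le> S u\<close>])
        show "continuous_on {- S u..S u} (\<lambda>v. \<phi> (T (u, v)))"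
          by (intro continuous_on_compose2[OF cphi] continuous_on_compose2[OF cT[of UNIV]] continuous_intros) auto
        fix v
        have "((\<lambda>v. T (u, v)) has_derivative (\<lambda>h. of_real h * \<beta>)) (at v within {- S u..S u})"
          unfolding T_def by (auto intro!: derivative_eq_intros)
        then have "((\<lambda>v. F (T (u, v))) has_derivative (\<lambda>h. F' (T (u, v)) (of_real h * \<beta>))) (at v within {- S u..S u})"
          by (rule has_derivative_compose[OF _ F'])
        moreover have "F' (T (u, v)) (of_real h * \<beta>) = h *\<^sub>R \<phi> (T (u, v))" for h
          unfolding \<phi>_def using linear_scale[OF has_derivative_linear[OF F'], of "T (u, v)" h \<beta>]
          by (simp add: scaleR_conv_of_real)
        ultimately show "((\<lambda>v. F (T (u, v))) has_vector_derivative \<phi> (T (u, v))) (at v within {- S u..S u})"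
          by (simp add: has_vector_derivative_def)
      qed
      finally show ?thesis using True by simp
    qed
  qed
  finally have eq: "disc_integral \<phi> R = (LINT u|lborel. indicator {-R..R} u *\<^sub>R (F (T (u, S u)) - F (T (u, - S u))))" .
  have cS: "continuous_on A S" for A unfolding S_def by (intro continuous_intros)
  have cFS: "continuous_on A (\<lambda>u. F (T (u, S u)))" "continuous_on A (\<lambda>u. F (T (u, - S u)))" for A
    by (intro continuous_on_compose2[OF cF] continuous_on_compose2[OF cT[of UNIV]] continuous_intros cS; simp)+
  define k where "k = (\<lambda>u. norm (F (T (u, S u))) + norm (F (T (u, - S u))))"
  have ck: "continuous_on A k" for A
    unfolding k_def by (intro continuous_intros cFS)
  have "integral {-R..R} (\<lambda>u. F (T (u, S u)) - F (T (u, - S u))) = disc_integral \<phi> R"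
    unfolding eq
    using set_borel_integral_eq_integral(2)[OF borel_integrable_atLeastAtMost'[of "-R" R "\<lambda>u. F (T (u, S u)) - F (T (u, - S u))"]]
    by (simp add: set_lebesgue_integral_def continuous_on_diff cFS)
  moreover have "norm (integral {-R..R} (\<lambda>u. F (T (u, S u)) - F (T (u, - S u)))) \<le> integral {-R..R} k"
    by (intro integral_norm_bound_integral integrable_continuous_interval continuous_on_diff cFS ck)
      (simp add: k_def norm_triangle_ineq4)
  ultimately have "norm (disc_integral \<phi> R) \<le> integral {-R..R} k" by simp
  also have "\<dots> = integral {-pi/2..pi/2} (\<lambda>\<theta>. (R * cos \<theta>) *\<^sub>R k (R * sin \<theta>))"
  proof -
    have "((\<lambda>\<theta>. (R * cos \<theta>) *\<^sub>R k (R * sin \<theta>)) has_integral (integral {R * sin (-pi/2)..R * sin (pi/2)} k)) {-pi/2..pi/2}"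
    proof (rule has_integral_substitution[where c="-R" and d=R])
      show "(\<lambda>\<theta>. R * sin \<theta>) ` {- pi / 2..pi / 2} \<subseteq> {- R..R}"
      proof (clarsimp)
        fix \<theta> :: real
        show "- R \<le> R * sin \<theta> \<and> R * sin \<theta> \<le> R"
          using R mult_left_mono[OF sin_le_one R, of \<theta>] mult_left_mono[OF sin_ge_minus_one R, of \<theta>] by simp
      qed
    qed (use R ck in \<open>auto intro!: derivative_eq_intros\<close>)
    then show ?thesis by (simp add: integral_unique)
  qed
  \<comment> \<open>The lower end of a chord has the angle pi - \<theta>, which keeps the sine and
    changes the sign of the cosine. The factor cos \<theta> is dropped, as it lies between 0 and 1
    here.\<close>
  also have "\<dots> \<le> integral {-pi/2..pi/2} (\<lambda>\<theta>. norm (F (T (R * sin \<theta>, R * cos \<theta>))) * R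
       + norm (F (T (R * sin (pi - \<theta>), R * cos (pi - \<theta>)))) * R)"
  proof (rule integral_le)
    show "(\<lambda>\<theta>. (R * cos \<theta>) *\<^sub>R k (R * sin \<theta>)) integrable_on {- pi / 2..pi / 2}"
      by (intro integrable_continuous_interval continuous_intros continuous_on_compose2[OF ck[of UNIV]]) auto
    show "(\<lambda>\<theta>. norm (F (T (R * sin \<theta>, R * cos \<theta>))) * R
       + norm (F (T (R * sin (pi - \<theta>), R * cos (pi - \<theta>)))) * R) integrable_on {- pi / 2..pi / 2}"
      by (intro integrable_continuous_interval continuous_intros continuous_on_compose2[OF cF]
          continuous_on_compose2[OF cT[of UNIV]]) auto
    fix \<theta> assume \<theta>: "\<theta> \<in> {- pi / 2..pi / 2}"
    then have c0: "cos \<theta> \<ge> 0" by (intro cos_ge_zero) auto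
    have "R\<^sup>2 - (R * sin \<theta>)\<^sup>2 = (R * cos \<theta>)\<^sup>2"
      by (simp add: power_mult_distrib cos_squared_eq algebra_simps)
    then have S: "S (R * sin \<theta>) = R * cos \<theta>"
      unfolding S_def using c0 R by simp
    have "(R * cos \<theta>) * k (R * sin \<theta>) \<le> R * k (R * sin \<theta>)"
      by (intro mult_right_mono) (use R in \<open>auto simp: k_def mult_left_le\<close>)
    then show "(R * cos \<theta>) *\<^sub>R k (R * sin \<theta>) \<le> norm (F (T (R * sin \<theta>, R * cos \<theta>))) * R
       + norm (F (T (R * sin (pi - \<theta>), R * cos (pi - \<theta>)))) * R"
      by (simp add: k_def S algebra_simps)
  qed
  also have "\<dots> = integral {-pi/2..pi/2} (\<lambda>\<theta>. norm (F (T (R * sin \<theta>, R * cos \<theta>))) * R)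
    + integral {-pi/2..pi/2} (\<lambda>\<theta>. norm (F (T (R * sin (pi - \<theta>), R * cos (pi - \<theta>)))) * R)"
    by (rule integral_add; intro integrable_continuous_interval continuous_intros continuous_on_compose2[OF cF]
          continuous_on_compose2[OF cT[of UNIV]]) auto
  \<comment> \<open>The reflection sends the second half circle to [pi/2, 3 pi/2], so that the two
    arcs join to a full period.\<close>
  also have "integral {-pi/2..pi/2} (\<lambda>\<theta>. norm (F (T (R * sin (pi - \<theta>), R * cos (pi - \<theta>)))) * R)
     = integral {pi - pi/2..pi - (-pi/2)} (\<lambda>\<theta>. norm (F (T (R * sin \<theta>, R * cos \<theta>))) * R)"
    by (rule integral_reflect_about) (intro continuous_intros continuous_on_compose2[OF cF]
          continuous_on_compose2[OF cT[of UNIV]], auto)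
  also have "integral {-pi/2..pi/2} (\<lambda>\<theta>. norm (F (T (R * sin \<theta>, R * cos \<theta>))) * R) + \<dots>
    = integral {-pi/2..-pi/2 + 2 * pi} (\<lambda>\<theta>. norm (F (T (R * sin \<theta>, R * cos \<theta>))) * R)"
  proof -
    have "pi - pi/2 = pi/2" "pi - (-pi/2) = -pi/2 + 2 * pi" by simp_all
    then show ?thesis
      by (simp only:, intro Henstock_Kurzweil_Integration.integral_combine integrable_continuous_interval
          continuous_intros continuous_on_compose2[OF cF] continuous_on_compose2[OF cT[of UNIV]]) auto
  qed
  finally show ?thesis by (simp add: T_def \<phi>_def)
qed

text \<open>The angle in the chord estimate is measured from \<open>\<beta>\<close>. For
  \<open>\<beta>\<close> = 1 this is the usual polar angle; for \<open>\<beta>\<close> = i it runs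
  backwards from pi/2. Periodicity restores the standard parametrisation in both cases.\<close>

lemma disc_integral_derivative_bound:
  fixes F :: "complex \<Rightarrow> complex" and F' :: "complex \<Rightarrow> complex \<Rightarrow> complex"
  assumes F': "\<And>z. (F has_derivative F' z) (at z)" and R: "0 \<le> R"
  shows "continuous_on UNIV (\<lambda>z. F' z 1) \<Longrightarrow>
      norm (disc_integral (\<lambda>z. F' z 1) R) \<le> circ_integral (\<lambda>z. norm (F z)) R"
    and "continuous_on UNIV (\<lambda>z. F' z \<i>) \<Longrightarrow>
      norm (disc_integral (\<lambda>z. F' z \<i>) R) \<le> circ_integral (\<lambda>z. norm (F z)) R"
proof -
  have cF: "continuous_on UNIV F"
    by (rule continuous_at_imp_continuous_on) (use F' has_derivative_continuous in blast)
  define H where "H = (\<lambda>\<theta>. norm (F (of_real R * cis \<theta>)) * R)"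
  have cH: "continuous_on UNIV H"
    unfolding H_def by (intro continuous_intros continuous_on_compose2[OF cF]) auto
  have per: "H (\<theta> + 2 * pi) = H \<theta>" for \<theta>
    by (simp add: H_def cis.ctr)
  have circ: "circ_integral (\<lambda>z. norm (F z)) R = integral {0..2*pi} H"
    by (simp add: circ_integral_def H_def)
  {
    assume c: "continuous_on UNIV (\<lambda>z. F' z 1)"
    have "norm (disc_integral (\<lambda>z. F' z 1) R) \<le>
      integral {-pi/2..-pi/2 + 2 * pi} (\<lambda>\<theta>. norm (F (of_real (R * sin \<theta>) * \<i> + of_real (R * cos \<theta>) * 1)) * R)"
    proof (rule disc_integral_directional_derivative_aux[OF F' c _ _ R])
      show "distr (lborel \<Otimes>\<^sub>M lborel) borel (\<lambda>(u, v). of_real u * \<i> + of_real v * 1) = lborel"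
        using lborel_complex_coordinates(2) by (simp add: Complex_eq algebra_simps)
    qed (simp add: cmod_power2)
    also have "(\<lambda>\<theta>. norm (F (of_real (R * sin \<theta>) * \<i> + of_real (R * cos \<theta>) * 1)) * R) = H"
      by (simp add: H_def fun_eq_iff cis_conv_exp exp_Euler algebra_simps flip: cos_of_real sin_of_real)
    also have "integral {-pi/2..-pi/2 + 2 * pi} H = integral {0..2*pi} H"
      by (rule integral_periodic_shift[OF cH per]) auto
    finally show "norm (disc_integral (\<lambda>z. F' z 1) R) \<le> circ_integral (\<lambda>z. norm (F z)) R"
      by (simp add: circ)
  }
  {
    assume c: "continuous_on UNIV (\<lambda>z. F' z \<i>)"
    have "norm (disc_integral (\<lambda>z. F' z \<i>) R) \<le>
      integral {-pi/2..-pi/2 + 2 * pi} (\<lambda>\<theta>. norm (F (of_real (R * sin \<theta>) * 1 + of_real (R * cos \<theta>) * \<i>)) * R)"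
    proof (rule disc_integral_directional_derivative_aux[OF F' c _ _ R])
      show "distr (lborel \<Otimes>\<^sub>M lborel) borel (\<lambda>(u, v). of_real u * 1 + of_real v * \<i>) = lborel"
        using lborel_complex_coordinates(1) by (simp add: Complex_eq algebra_simps)
    qed (simp add: cmod_power2)
    also have "(\<lambda>\<theta>. norm (F (of_real (R * sin \<theta>) * 1 + of_real (R * cos \<theta>) * \<i>)) * R) = (\<lambda>\<theta>. H (pi/2 - \<theta>))"
    proof -
      have "cis (pi/2 - \<theta>) = of_real (sin \<theta>) + of_real (cos \<theta>) * \<i>" for \<theta>
        by (simp add: complex_eq_iff cos_diff sin_diff)
      then show ?thesis by (simp add: H_def fun_eq_iff algebra_simps)
    qed
    also have "integral {-pi/2..-pi/2 + 2 * pi} (\<lambda>\<theta>. H (pi/2 - \<theta>)) = integral {pi/2 - (-pi/2 + 2 * pi)..pi/2 - (-pi/2)} H"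
      by (rule integral_reflect_about[OF cH])
    also have "\<dots> = integral {-pi..-pi + 2 * pi} H"
      by simp
    also have "\<dots> = integral {0..2*pi} H"
      by (rule integral_periodic_shift[OF cH per]) auto
    finally show "norm (disc_integral (\<lambda>z. F' z \<i>) R) \<le> circ_integral (\<lambda>z. norm (F z)) R"
      by (simp add: circ)
  }
qed

section \<open>Equidistribution on a torus\<close>

lemma integral_translate_set:
  fixes h :: "complex \<Rightarrow> complex"
  assumes h: "continuous_on UNIV h" and S: "S \<in> sets borel" "bounded S"
    and S': "S' = (\<lambda>w. w + c) ` S"
  shows "integral S (\<lambda>w. h (w + c)) = integral S' h"
proof -
  have mem: "w + c \<in> S' \<longleftrightarrow> w \<in> S" for w
    using S' by auto
  have S'eq: "S' = (\<lambda>w. w - c) -` S"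
    using S' by (auto simp: image_iff) (metis diff_add_cancel)
  have S'b: "S' \<in> sets borel"
    unfolding S'eq by (rule measurable_sets_borel[OF _ S(1)]) (intro borel_measurable_diff, auto)
  have hb: "h \<in> borel_measurable borel"
    using h by (rule borel_measurable_continuous_onI)
  have int: "(LINT w:A|lborel. k w) = integral A k"
    if k: "continuous_on UNIV k" and A: "A \<in> sets borel" "bounded A"
    for k :: "complex \<Rightarrow> complex" and A
  proof (rule set_borel_integral_eq_integral(2))
    obtain d where d: "A \<subseteq> cbox (-d) d"
      using bounded_subset_cbox_symmetric[OF A(2)] by blast
    have "set_integrable lborel (cbox (-d) d) k"
      unfolding set_integrable_def
      by (rule borel_integrable_compact) (use k continuous_on_subset in auto)
    then show "set_integrable lborel A k"
      by (rule set_integrable_subset) (use d A in auto)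
  qed
  have "integral S' h = (LINT w|lborel. indicator S' w *\<^sub>R h w)"
    using int[OF h S'b] S(2) bounded_translation[of S c] S'
    by (simp add: set_lebesgue_integral_def add.commute)
  also have "\<dots> = (LINT w|lborel. indicator S' (c + w) *\<^sub>R h (c + w))"
    by (subst lborel_distr_plus[of c, symmetric], subst integral_distr)
      (use hb S'b in \<open>auto intro!: borel_measurable_scaleR borel_measurable_indicator\<close>)
  also have "\<dots> = (LINT w|lborel. indicator S w *\<^sub>R h (w + c))"
    by (rule Bochner_Integration.integral_cong[OF refl]) (use mem in \<open>simp add: add.commute indicator_def\<close>)
  also have "\<dots> = integral S (\<lambda>w. h (w + c))"
    using int[of "\<lambda>w. h (w + c)" S] S
    by (simp add: set_lebesgue_integral_def continuous_on_compose2[OF h] continuous_on_add)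
  finally show ?thesis ..
qed

lemma disc_integral_character_bound:
  fixes g :: "complex \<Rightarrow> complex" and \<kappa> :: complex
  assumes g: "g holomorphic_on UNIV" and \<kappa>: "\<kappa> \<noteq> 0" and R: "0 \<le> R"
  shows "norm (disc_integral (\<lambda>z. cis (Re (\<kappa> * g z)) * of_real ((cmod (deriv g z))\<^sup>2)) R)
    \<le> 2 / cmod \<kappa> * circ_integral (\<lambda>z. cmod (deriv g z)) R"
proof -
  define F where "F = (\<lambda>z. cis (Re (\<kappa> * g z)) * cnj (deriv g z))"
  define F' where "F' = (\<lambda>z h. cis (Re (\<kappa> * g z)) * (\<i> * of_real (Re (\<kappa> * (deriv g z * h)))) * cnj (deriv g z)
     + cis (Re (\<kappa> * g z)) * cnj (deriv (deriv g) z * h))"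
  have dg: "(g has_derivative (\<lambda>h. deriv g z * h)) (at z)" for z
    using holomorphic_derivI[OF g] by (auto simp: has_field_derivative_def)
  have g': "deriv g holomorphic_on UNIV"
    using holomorphic_deriv[OF g] by simp
  have ddg: "(deriv g has_derivative (\<lambda>h. deriv (deriv g) z * h)) (at z)" for z
    using holomorphic_derivI[OF g'] by (auto simp: has_field_derivative_def)
  have g'': "deriv (deriv g) holomorphic_on UNIV"
    using holomorphic_deriv[OF g'] by simp
  note cg = holomorphic_on_imp_continuous_on[OF g] holomorphic_on_imp_continuous_on[OF g']
     holomorphic_on_imp_continuous_on[OF g'']
  have dF: "(F has_derivative F' z) (at z)" for z
  proof -
    have "((\<lambda>z. \<i> * of_real (Re (\<kappa> * g z))) has_derivative (\<lambda>h. \<i> * of_real (Re (\<kappa> * (deriv g z * h))))) (at z)"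
      by (intro has_derivative_mult_right has_derivative_of_real has_derivative_Re dg)
    then have "((\<lambda>z. exp (\<i> * of_real (Re (\<kappa> * g z)))) has_derivative
        (\<lambda>h. exp (\<i> * of_real (Re (\<kappa> * g z))) * (\<i> * of_real (Re (\<kappa> * (deriv g z * h)))))) (at z)"
      by (rule has_derivative_compose[OF _ DERIV_exp[unfolded has_field_derivative_def]])
    from has_derivative_mult[OF this bounded_linear.has_derivative[OF bounded_linear_cnj ddg]]
    show ?thesis
      unfolding F_def F'_def cis_conv_exp
      by (rule has_derivative_eq_rhs) (simp add: fun_eq_iff algebra_simps)
  qed
  have cF': "continuous_on UNIV (\<lambda>z. F' z h)" for h
    unfolding F'_def by (intro continuous_intros cg)
  \<comment> \<open>The left side is twice the Wirtinger derivative of F in z. It annihilates the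
    antiholomorphic factor \<open>cnj (deriv g z)\<close>, so the second derivative of g cancels and
    only the derivative of the character remains.\<close>
  have key: "F' z 1 - \<i> * F' z \<i> = (\<i> * \<kappa>) * (cis (Re (\<kappa> * g z)) * of_real ((cmod (deriv g z))\<^sup>2))" for z
  proof -
    have 1: "of_real (Re x) - \<i> * of_real (Re (x * \<i>)) = x" for x
      by (simp add: complex_eq_iff)
    have "F' z 1 - \<i> * F' z \<i> = cis (Re (\<kappa> * g z)) * \<i> * cnj (deriv g z) *
      (of_real (Re (\<kappa> * deriv g z)) - \<i> * of_real (Re ((\<kappa> * deriv g z) * \<i>)))"
      by (simp add: F'_def algebra_simps)
    also have "\<dots> = \<i> * \<kappa> * (cis (Re (\<kappa> * g z)) * (deriv g z * cnj (deriv g z)))"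
      unfolding 1 by (simp add: algebra_simps)
    also have "deriv g z * cnj (deriv g z) = of_real ((cmod (deriv g z))\<^sup>2)"
      by (rule complex_norm_square[symmetric])
    finally show ?thesis .
  qed
  have nF: "norm (F z) = cmod (deriv g z)" for z
    by (simp add: F_def norm_mult)
  define E where "E = disc_integral (\<lambda>z. cis (Re (\<kappa> * g z)) * of_real ((cmod (deriv g z))\<^sup>2)) R"
  have "(\<i> * \<kappa>) * E = disc_integral (\<lambda>z. F' z 1 - \<i> * F' z \<i>) R"
    unfolding E_def key by (simp only: disc_integral_cmul_complex)
  also have "\<dots> = disc_integral (\<lambda>z. F' z 1) R - \<i> * disc_integral (\<lambda>z. F' z \<i>) R"
    by (subst disc_integral_diff) (auto intro!: continuous_intros cF' simp: disc_integral_cmul_complex)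
  finally have "cmod \<kappa> * cmod E \<le> norm (disc_integral (\<lambda>z. F' z 1) R) + norm (disc_integral (\<lambda>z. F' z \<i>) R)"
    by (metis norm_triangle_ineq4 norm_mult norm_ii mult_1)
  also have "\<dots> \<le> 2 * circ_integral (\<lambda>z. cmod (deriv g z)) R"
    using disc_integral_derivative_bound[OF dF R cF' ] disc_integral_derivative_bound(2)[OF dF R cF'] by (simp add: nF)
  finally show ?thesis
    using \<kappa> by (simp add: E_def field_simps)
qed

section \<open>Coordinates, period cell and means for a planar lattice\<close>

locale planar_lattice =
  fixes a b :: complex
  assumes basis: "lattice_basis a b"
begin

text \<open>Cramer's rule: \<open>Im (cnj x * y)\<close> is the determinant of x and y as vectors of
  the real plane.\<close>

definition "coord1 w = Im (cnj w * b) / Im (cnj a * b)"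
definition "coord2 w = Im (cnj a * w) / Im (cnj a * b)"

lemma det_nonzero: "Im (cnj a * b) \<noteq> 0"
  using basis by (simp add: lattice_basis_def)

lemma coord_decompose: "w = of_real (coord1 w) * a + of_real (coord2 w) * b"
proof -
  define D where "D = Im (cnj a * b)"
  have "of_real D * w = of_real (Im (cnj w * b)) * a + of_real (Im (cnj a * w)) * b"
    by (simp add: complex_eq_iff D_def algebra_simps)
  then have "w = (of_real (Im (cnj w * b)) * a + of_real (Im (cnj a * w)) * b) / of_real D"
    using det_nonzero unfolding D_def[symmetric] by (simp add: nonzero_eq_divide_eq mult.commute)
  then show ?thesis
    by (simp add: coord1_def coord2_def D_def add_divide_distrib)
qed

lemma coord1_add: "coord1 (v + w) = coord1 v + coord1 w"
  and coord2_add: "coord2 (v + w) = coord2 v + coord2 w"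
  and coord1_scale: "coord1 (of_real x * w) = x * coord1 w"
  and coord2_scale: "coord2 (of_real x * w) = x * coord2 w"
  by (simp_all add: coord1_def coord2_def diff_divide_distrib add_divide_distrib algebra_simps)

lemma coord_basis: "coord1 a = 1" "coord1 b = 0" "coord2 a = 0" "coord2 b = 1"
  using det_nonzero by (simp_all add: coord1_def coord2_def)

lemmas coord_simps = coord1_add coord2_add coord1_scale coord2_scale coord_basis

lemma continuous_coord: "continuous_on A coord1" "continuous_on A coord2"
  unfolding coord1_def[abs_def] coord2_def[abs_def] using det_nonzero by (auto intro!: continuous_intros)

lemma parallelogram_coord: "parallelogram a b = {w. coord1 w \<in> {0..<1} \<and> coord2 w \<in> {0..<1}}"
  unfolding parallelogram_def
proof (intro set_eqI iffI; clarify)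
  fix s t :: real assume "s \<in> {0..<1}" "t \<in> {0..<1}"
  then show "coord1 (of_real s * a + of_real t * b) \<in> {0..<1} \<and> coord2 (of_real s * a + of_real t * b) \<in> {0..<1}"
    by (simp add: coord_simps)
next
  fix w assume "coord1 w \<in> {0..<1}" "coord2 w \<in> {0..<1}"
  then show "\<exists>s t. w = of_real s * a + of_real t * b \<and> s \<in> {0..<1} \<and> t \<in> {0..<1}"
    using coord_decompose by blast
qed

lemma bounded_parallelogram: "bounded (parallelogram a b)"
proof -
  have "cmod w \<le> cmod a + cmod b" if wP: "w \<in> parallelogram a b" for w
  proof -
    obtain s t :: real where w: "w = of_real s * a + of_real t * b" "s \<in> {0..<1}" "t \<in> {0..<1}"
      using wP unfolding parallelogram_def by blast
    have "cmod w \<le> \<bar>s\<bar> * cmod a + \<bar>t\<bar> * cmod b"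
      unfolding w by (rule order_trans[OF norm_triangle_ineq]) (simp add: norm_mult)
    also have "\<dots> \<le> 1 * cmod a + 1 * cmod b"
      using w by (intro add_mono mult_right_mono) auto
    finally show ?thesis by simp
  qed
  then show ?thesis by (auto simp: bounded_iff)
qed

lemma borel_coord_strip:
  "{w. coord1 w \<in> {p..<q} \<and> coord2 w \<in> {r..<s}} \<in> sets borel"
proof -
  have m: "coord1 \<in> borel_measurable borel" "coord2 \<in> borel_measurable borel"
    using continuous_coord by (auto intro: borel_measurable_continuous_onI)
  have "coord1 -` {p..<q} \<inter> coord2 -` {r..<s} \<in> sets borel"
    by (intro sets.Int measurable_sets_borel[OF m(1)] measurable_sets_borel[OF m(2)]) auto
  moreover have "coord1 -` {p..<q} \<inter> coord2 -` {r..<s} = {w. coord1 w \<in> {p..<q} \<and> coord2 w \<in> {r..<s}}"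
    by auto
  ultimately show ?thesis by simp
qed

lemma borel_parallelogram: "parallelogram a b \<in> sets borel"
  unfolding parallelogram_coord by (rule borel_coord_strip)

lemma integrable_parallelogram:
  fixes h :: "complex \<Rightarrow> 'a::euclidean_space"
  shows "continuous_on UNIV h \<Longrightarrow> h integrable_on parallelogram a b"
  by (rule set_lebesgue_integral_eq_integral(1), rule continuous_absolutely_integrable_bounded)
    (use bounded_parallelogram borel_parallelogram in auto)

definition cell_area :: real where
  "cell_area = integral (parallelogram a b) (\<lambda>_. 1)"

text \<open>The open cell is open and nonempty, hence not a null set. This positivity makes the mean
  meaningful and yields the positive factor in front of the limit current.\<close>

lemma cell_area_pos: "cell_area > 0"
proof -
  have lm: "parallelogram a b \<in> lmeasurable"
    using bounded_parallelogram borel_parallelogram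
    by (intro bounded_set_imp_lmeasurable) auto
  define U where "U = coord1 -` {0<..<1} \<inter> coord2 -` {0<..<1}"
  have "open U"
    unfolding U_def using continuous_coord[of UNIV]
    by (intro open_Int continuous_open_vimage) (auto simp: continuous_on_eq_continuous_at)
  moreover have "of_real (1/2) * a + of_real (1/2) * b \<in> U"
    unfolding U_def by (simp only: coord_simps vimage_def Int_iff mem_Collect_eq) simp
  ultimately have "\<not> negligible U"
    using open_not_negligible by blast
  moreover have "U \<subseteq> parallelogram a b"
    by (auto simp: U_def parallelogram_coord)
  ultimately have "measure lebesgue (parallelogram a b) \<noteq> 0"
    using lm negligible_iff_measure0 negligible_subset by blast
  then show ?thesis
    unfolding cell_area_def using lmeasure_integral[OF lm] measure_nonneg[of lebesgue "parallelogram a b"] by simp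
qed

definition cell_mean :: "(complex \<Rightarrow> complex) \<Rightarrow> complex" where
  "cell_mean h = integral (parallelogram a b) h / of_real cell_area"

lemma cell_mean_const: "cell_mean (\<lambda>_. c) = c"
proof -
  have "integral (parallelogram a b) (\<lambda>_. complex_of_real 1) = of_real cell_area"
    unfolding cell_area_def
    by (rule integral_unique[OF has_integral_of_real[OF integrable_integral]]) (rule integrable_parallelogram, simp)
  then have "integral (parallelogram a b) (\<lambda>_. c * 1) = c * of_real cell_area"
    by (simp only: integral_mult_right of_real_1)
  then show ?thesis using cell_area_pos by (simp add: cell_mean_def)
qed

lemma cell_mean_add:
  "continuous_on UNIV h \<Longrightarrow> continuous_on UNIV k \<Longrightarrow> cell_mean (\<lambda>w. h w + k w) = cell_mean h + cell_mean k"
  by (simp add: cell_mean_def integral_add integrable_parallelogram add_divide_distrib)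

lemma cell_mean_diff:
  "continuous_on UNIV h \<Longrightarrow> continuous_on UNIV k \<Longrightarrow> cell_mean (\<lambda>w. h w - k w) = cell_mean h - cell_mean k"
  by (simp add: cell_mean_def integral_diff integrable_parallelogram diff_divide_distrib)

lemma cell_mean_cmul: "cell_mean (\<lambda>w. c * h w) = c * cell_mean h"
  by (simp add: cell_mean_def)

lemma cell_mean_norm_le:
  assumes "continuous_on UNIV h" "\<And>w. norm (h w) \<le> e"
  shows "norm (cell_mean h) \<le> e"
proof -
  have "norm (integral (parallelogram a b) h) \<le> integral (parallelogram a b) (\<lambda>_. e * 1)"
    by (rule integral_norm_bound_integral) (use assms in \<open>auto intro!: integrable_parallelogram\<close>)
  also have "\<dots> = e * cell_area"
    by (simp only: integral_mult_right cell_area_def)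
  finally show ?thesis
    using cell_area_pos by (simp add: cell_mean_def norm_divide field_simps)
qed

text \<open>The cell is cut where the first coordinate is 1 - \<sigma>, and both pieces are
  translated back into it; half-open strips make cutting and reassembling exact.\<close>

lemma integral_parallelogram_shift:
  fixes h :: "complex \<Rightarrow> complex"
  assumes h: "continuous_on UNIV h" and per: "\<And>w. h (w + a) = h w" and \<sigma>: "0 \<le> \<sigma>" "\<sigma> \<le> 1"
  shows "integral (parallelogram a b) (\<lambda>w. h (w + of_real \<sigma> * a)) = integral (parallelogram a b) h"
proof -
  define S where "S = (\<lambda>p q. {w. coord1 w \<in> {p..<q} \<and> coord2 w \<in> {0..<1::real}})"
  have bS: "S p q \<in> sets borel" for p q
    unfolding S_def by (rule borel_coord_strip)
  have sub: "S p q \<subseteq> parallelogram a b" if "0 \<le> p" "q \<le> 1" for p q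
    using that by (auto simp: S_def parallelogram_coord)
  have bdd: "bounded (S p q)" if "0 \<le> p" "q \<le> 1" for p q
    using sub[OF that] bounded_parallelogram bounded_subset by blast
  have split: "integral (parallelogram a b) k = integral (S 0 x) k + integral (S x 1) k"
    if "0 \<le> x" "x \<le> 1" "continuous_on UNIV k" for x and k :: "complex \<Rightarrow> complex"
  proof -
    have "parallelogram a b = S 0 x \<union> S x 1"
      using that by (auto simp: S_def parallelogram_coord)
    moreover have "S 0 x \<inter> S x 1 = {}" by (auto simp: S_def)
    moreover have "k integrable_on S 0 x" "k integrable_on S x 1"
      by (rule set_lebesgue_integral_eq_integral(1), rule continuous_absolutely_integrable_bounded;
          use that bdd bS in auto)+
    ultimately show ?thesis by simp
  qed
  have shift: "(\<lambda>w. w + of_real x * a) ` S p q = S (p + x) (q + x)" for p q x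
  proof (intro set_eqI iffI)
    fix w assume "w \<in> S (p + x) (q + x)"
    moreover have "w = (w + of_real (-x) * a) + of_real x * a" by simp
    moreover have "coord1 (w + of_real (-x) * a) = coord1 w - x" "coord2 (w + of_real (-x) * a) = coord2 w"
      by (simp_all only: coord_simps)
    ultimately have "w + of_real (-x) * a \<in> S p q" by (simp add: S_def)
    then show "w \<in> (\<lambda>w. w + of_real x * a) ` S p q"
      by (rule image_eqI[rotated]) simp
  qed (auto simp: S_def coord_simps)
  have c: "continuous_on UNIV (\<lambda>w. h (w + of_real x * a))" for x
    by (intro continuous_on_compose2[OF h] continuous_intros) auto
  have "integral (parallelogram a b) (\<lambda>w. h (w + of_real \<sigma> * a)) =
    integral (S 0 (1 - \<sigma>)) (\<lambda>w. h (w + of_real \<sigma> * a)) + integral (S (1 - \<sigma>) 1) (\<lambda>w. h (w + of_real \<sigma> * a))"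
    by (rule split[OF _ _ c]) (use \<sigma> in auto)
  also have "integral (S 0 (1 - \<sigma>)) (\<lambda>w. h (w + of_real \<sigma> * a)) = integral (S \<sigma> 1) h"
    by (rule integral_translate_set[OF h bS bdd]) (use \<sigma> shift[of \<sigma> 0 "1 - \<sigma>"] in auto)
  \<comment> \<open>A shift by \<sigma> would carry this strip out of the cell; periodicity replaces
    it by the shift by \<sigma> - 1.\<close>
  also have "integral (S (1 - \<sigma>) 1) (\<lambda>w. h (w + of_real \<sigma> * a)) = integral (S 0 \<sigma>) h"
  proof -
    have "h (w + of_real \<sigma> * a) = h (w + of_real (\<sigma> - 1) * a)" for w
      using per[of "w + of_real (\<sigma> - 1) * a"] by (simp add: algebra_simps)
    moreover have "integral (S (1 - \<sigma>) 1) (\<lambda>w. h (w + of_real (\<sigma> - 1) * a)) = integral (S 0 \<sigma>) h"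
      by (rule integral_translate_set[OF h bS bdd]) (use \<sigma> shift[of "\<sigma> - 1" "1 - \<sigma>" 1] in auto)
    ultimately show ?thesis by simp
  qed
  also have "integral (S \<sigma> 1) h + integral (S 0 \<sigma>) h = integral (parallelogram a b) h"
    using split[OF \<sigma> h] by simp
  finally show ?thesis .
qed

section \<open>Characters of the torus\<close>

definition char :: "int \<Rightarrow> int \<Rightarrow> complex \<Rightarrow> complex" where
  "char m n w = cis (2 * pi * (of_int m * coord1 w + of_int n * coord2 w))"

lemma continuous_char: "continuous_on A (char m n)"
  unfolding char_def[abs_def] by (intro continuous_intros continuous_coord)

lemma char_add: "char m n (v + w) = char m n v * char m n w"
  by (simp add: char_def coord_simps cis_mult algebra_simps)

lemma char_basis: "char m n a = 1" "char m n b = 1"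
  using cis_multiple_2pi[of "of_int m"] cis_multiple_2pi[of "of_int n"] by (simp_all add: char_def coord_simps)

text \<open>A shift by half a wavelength in the direction of a changes the sign of the character but
  not its integral over the cell.\<close>

lemma integral_char_zero_aux:
  assumes "m \<noteq> 0"
  shows "integral (parallelogram a b) (char m n) = 0"
proof -
  define \<sigma> where "\<sigma> = 1 / (2 * \<bar>real_of_int m\<bar>)"
  have \<sigma>: "0 \<le> \<sigma>" "\<sigma> \<le> 1" using assms by (auto simp: \<sigma>_def field_simps)
  have "char m n (of_real \<sigma> * a) = cis (pi * (of_int m / \<bar>of_int m\<bar>))"
    unfolding char_def coord_simps by (simp add: \<sigma>_def)
  also have "\<dots> = -1"
    using assms by (cases "m > 0") (auto simp: cis.ctr complex_eq_iff)
  finally have "char m n (w + of_real \<sigma> * a) = -1 * char m n w" for w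
    by (simp add: char_add)
  then have "integral (parallelogram a b) (\<lambda>w. -1 * char m n w) = integral (parallelogram a b) (char m n)"
    using integral_parallelogram_shift[OF continuous_char _ \<sigma>, of m n] by (simp add: char_add char_basis)
  then show ?thesis by simp
qed

end

lemma parallelogram_swap: "parallelogram a b = parallelogram b a"
  unfolding parallelogram_def by (auto simp: add.commute) (metis add.commute atLeastLessThan_iff)+

lemma lattice_basis_swap: "lattice_basis a b \<longleftrightarrow> lattice_basis b a"
  by (auto simp: lattice_basis_def algebra_simps)

context planar_lattice
begin

text \<open>If m = 0, then n is nonzero, and exchanging the two basis vectors reduces to the
  preceding case: the determinant changes sign and the coordinates change places.\<close>

lemma integral_char_zero:
  assumes "m \<noteq> 0 \<or> n \<noteq> 0"
  shows "integral (parallelogram a b) (char m n) = 0"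
proof (cases "m = 0")
  case False then show ?thesis by (rule integral_char_zero_aux)
next
  case True
  interpret sw: planar_lattice b a
    by unfold_locales (use basis lattice_basis_swap in blast)
  have D: "Im (cnj b * a) = - Im (cnj a * b)"
    by simp
  have "sw.coord1 w = coord2 w" "sw.coord2 w = coord1 w" for w
    unfolding coord1_def coord2_def sw.coord1_def sw.coord2_def D divide_minus_right
      minus_divide_left by (simp_all add: algebra_simps)
  then have "sw.char n m = char m n"
    by (simp add: fun_eq_iff char_def sw.char_def add.commute)
  then show ?thesis
    using sw.integral_char_zero_aux[of n m] assms True parallelogram_swap[of a b] by simp
qed

text \<open>Brings a character to the form treated by the boundary estimate. The phase is a real
  linear form in w, hence equal to Re (\<kappa> w) for some \<kappa>. Its values on the basis
  vectors are 2 pi m and 2 pi n, so \<kappa> is nonzero.\<close>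

lemma char_frequency:
  assumes "m \<noteq> 0 \<or> n \<noteq> 0"
  obtains \<kappa> where "\<kappa> \<noteq> 0" "\<And>w. char m n w = cis (Re (\<kappa> * w))"
proof -
  define D where "D = Im (cnj a * b)"
  define \<kappa> where "\<kappa> = of_real (2 * pi / D) * \<i> * (of_int m * cnj b - of_int n * cnj a)"
  have D: "D \<noteq> 0" using det_nonzero by (simp add: D_def)
  have re: "Re (of_real c * \<i> * x) = - c * Im x" for c x by simp
  have eq: "2 * pi * (of_int m * coord1 w + of_int n * coord2 w) = Re (\<kappa> * w)" for w
  proof -
    have "\<kappa> * w = of_real (2 * pi / D) * \<i> * (of_int m * cnj b * w - of_int n * cnj a * w)"
      unfolding \<kappa>_def by (simp only: mult.assoc left_diff_distrib)
    then have "Re (\<kappa> * w) = - (2 * pi / D) * Im (of_int m * cnj b * w - of_int n * cnj a * w)"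
      by (simp only: re)
    also have "\<dots> = 2 * pi * (of_int m * (Im (cnj w * b) / D) + of_int n * (Im (cnj a * w) / D))"
      using D by (simp add: field_simps)
    finally show ?thesis by (simp add: coord1_def coord2_def D_def)
  qed
  have "\<kappa> \<noteq> 0"
    using eq[of a] eq[of b] assms by (auto simp: coord_basis)
  then show ?thesis
    using that[of \<kappa>] by (simp add: char_def eq)
qed

section \<open>Trigonometric polynomials and their density\<close>

inductive trig_poly :: "(complex \<Rightarrow> complex) \<Rightarrow> bool" where
  char: "trig_poly (char m n)"
| add: "trig_poly f \<Longrightarrow> trig_poly h \<Longrightarrow> trig_poly (\<lambda>w. f w + h w)"
| cmul: "trig_poly f \<Longrightarrow> trig_poly (\<lambda>w. c * f w)"

lemma trig_poly_mult:
  assumes "trig_poly f" "trig_poly h"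
  shows "trig_poly (\<lambda>w. f w * h w)"
  using assms
proof (induction f)
  case (char m n)
  then show ?case
  proof (induction h)
    case (char m' n')
    have "(\<lambda>w. char m n w * char m' n' w) = char (m + m') (n + n')"
      by (simp add: fun_eq_iff char_def cis_mult algebra_simps)
    then show ?case by (simp add: trig_poly.char)
  next
    case (add f h)
    then show ?case by (simp add: distrib_left trig_poly.add)
  next
    case (cmul f c)
    then show ?case using trig_poly.cmul[OF cmul.IH, of c] by (simp add: mult.left_commute)
  qed
next
  case (add f h)
  then show ?case by (simp add: distrib_right trig_poly.add)
next
  case (cmul f c)
  then show ?case using trig_poly.cmul[OF cmul.IH, of c] by (simp add: mult.assoc)
qed

lemma trig_poly_const: "trig_poly (\<lambda>_. c)"
proof -
  have "char 0 0 = (\<lambda>_. 1)" by (simp add: fun_eq_iff char_def)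
  then show ?thesis using trig_poly.cmul[OF trig_poly.char, of c 0 0] by simp
qed

lemma trig_poly_continuous: "trig_poly f \<Longrightarrow> continuous_on UNIV f"
  by (induction rule: trig_poly.induct) (auto intro!: continuous_intros continuous_char)

text \<open>Embeds the torus in C^2 as a product of two unit circles, so that Stone-Weierstrass on a
  compact Euclidean set becomes applicable.\<close>

definition torus_point :: "complex \<Rightarrow> complex \<times> complex" where
  "torus_point w = (char 1 0 w, char 0 1 w)"

text \<open>Products being available, it suffices to treat the four real coordinates. The real part
  of a character is half the sum of the character and its inverse; the imaginary part is then -i
  times the character plus i times the real part.\<close>

lemma trig_poly_real_polynomial:
  assumes "real_polynomial_function p"
  shows "trig_poly (\<lambda>w. of_real (p (torus_point w)))"
  using assms
proof (induction p)
  case (linear f)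
  interpret bounded_linear f by fact
  have f: "f (u, v) = Re u * f (1, 0) + Im u * f (\<i>, 0) + Re v * f (0, 1) + Im v * f (0, \<i>)" for u v
  proof -
    have "(u, v) = Re u *\<^sub>R (1, 0) + Im u *\<^sub>R (\<i>, 0) + Re v *\<^sub>R (0, 1) + Im v *\<^sub>R (0, \<i>)"
      by (simp add: complex_eq_iff)
    then have "f (u, v) = f (Re u *\<^sub>R (1, 0) + Im u *\<^sub>R (\<i>, 0) + Re v *\<^sub>R (0, 1) + Im v *\<^sub>R (0, \<i>))"
      by simp
    then show ?thesis by (simp only: add scaleR real_scaleR_def)
  qed
  have re: "trig_poly (\<lambda>w. of_real (Re (char m n w)))" for m n
  proof -
    have "(\<lambda>w. of_real (Re (char m n w))) = (\<lambda>w. (1/2) * char m n w + (1/2) * char (-m) (-n) w)"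
    proof
      fix w
      have "char (-m) (-n) w = cnj (char m n w)"
        unfolding char_def cis_cnj by (rule arg_cong[of _ _ cis]) (simp add: algebra_simps)
      then show "of_real (Re (char m n w)) = (1/2) * char m n w + (1/2) * char (-m) (-n) w"
        by (simp add: complex_eq_iff)
    qed
    then show ?thesis by (simp only:) (intro trig_poly.intros)
  qed
  have im: "trig_poly (\<lambda>w. of_real (Im (char m n w)))" for m n
  proof -
    have "of_real (Im x) = (- \<i>) * x + \<i> * of_real (Re x)" for x
      by (simp add: complex_eq_iff)
    then have "(\<lambda>w. of_real (Im (char m n w))) = (\<lambda>w. (- \<i>) * char m n w + \<i> * of_real (Re (char m n w)))"
      by (simp add: fun_eq_iff)
    then show ?thesis by (simp only:) (intro trig_poly.intros re)
  qed
  have "(\<lambda>w. of_real (f (torus_point w))) = (\<lambda>w. of_real (f (1, 0)) * of_real (Re (char 1 0 w)) +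
      of_real (f (\<i>, 0)) * of_real (Im (char 1 0 w)) + of_real (f (0, 1)) * of_real (Re (char 0 1 w))
      + of_real (f (0, \<i>)) * complex_of_real (Im (char 0 1 w)))"
    unfolding torus_point_def by (subst f) (simp add: fun_eq_iff mult.commute)
  then show ?case by (simp only:) (intro trig_poly.intros re im)
next
  case (const c)
  then show ?case by (rule trig_poly_const)
next
  case (add f g)
  then show ?case by (simp add: trig_poly.add)
next
  case (mult f g)
  then show ?case by (simp add: trig_poly_mult)
qed

definition lattice_periodic :: "(complex \<Rightarrow> 'c) \<Rightarrow> bool" where
  "lattice_periodic h \<longleftrightarrow> (\<forall>w. h (w + a) = h w \<and> h (w + b) = h w)"

lemma lattice_periodic_int:
  assumes "lattice_periodic h"
  shows "h (w + of_int m * a + of_int n * b) = h w"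
proof -
  have step: "h (w + of_int m * c) = h w" if c: "\<And>w. h (w + c) = h w" for c w m
  proof (induction m arbitrary: w rule: int_induct[of _ 0])
    case base then show ?case by simp
  next
    case (step1 i)
    have "h (w + of_int (i + 1) * c) = h ((w + of_int i * c) + c)" by (simp add: algebra_simps)
    then show ?case using c step1 by simp
  next
    case (step2 i)
    have "h (w + of_int i * c) = h ((w + of_int (i - 1) * c) + c)" by (simp add: algebra_simps)
    then show ?case using c step2 by simp
  qed
  show ?thesis
    using step[of a] step[of b] assms by (simp add: lattice_periodic_def)
qed

definition closed_cell :: "complex set" where
  "closed_cell = (\<lambda>p. of_real (fst p) * a + of_real (snd p) * b) ` ({0..1} \<times> {0..1})"

lemma compact_closed_cell: "compact closed_cell"
  unfolding closed_cell_def
  by (intro compact_continuous_image continuous_intros compact_Times) auto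

lemma reduce_to_cell:
  obtains m n :: int where "w + of_int m * a + of_int n * b \<in> closed_cell"
proof -
  define m where "m = - \<lfloor>coord1 w\<rfloor>"
  define n where "n = - \<lfloor>coord2 w\<rfloor>"
  have "w + of_int m * a + of_int n * b =
     of_real (coord1 w + of_int m) * a + of_real (coord2 w + of_int n) * b"
    by (subst coord_decompose[of w]) (simp add: algebra_simps)
  moreover have "coord1 w + of_int m \<in> {0..1}" "coord2 w + of_int n \<in> {0..1}"
    unfolding m_def n_def by (auto; linarith)+
  ultimately have "w + of_int m * a + of_int n * b \<in> closed_cell"
    unfolding closed_cell_def by (intro image_eqI[of _ _ "(coord1 w + of_int m, coord2 w + of_int n)"]) auto
  then show ?thesis using that by blast
qed

text \<open>Equal values of the two basic characters force both coordinates to differ by integers,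
  so periodic functions factor through \<open>torus_point\<close>.\<close>

lemma torus_point_eqD:
  assumes h: "lattice_periodic h" and eq: "torus_point v = torus_point w"
  shows "h v = h w"
proof -
  have int: "\<exists>k::int. x - y = of_int k" if "cis (2 * pi * x) = cis (2 * pi * y)" for x y
  proof -
    have "cis (2 * pi * x - 2 * pi * y) = 1"
      using that by (simp flip: cis_divide)
    then have "cos (2 * pi * (x - y)) = 1"
      by (simp add: complex_eq_iff right_diff_distrib)
    then obtain k :: int where "2 * pi * (x - y) = of_int k * 2 * pi"
      using cos_one_2pi_int by blast
    then have "x - y = of_int k" by simp
    then show ?thesis ..
  qed
  obtain k l :: int where "coord1 v - coord1 w = of_int k" "coord2 v - coord2 w = of_int l"
    using eq int[of "coord1 v" "coord1 w"] int[of "coord2 v" "coord2 w"]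
    by (auto simp: torus_point_def char_def)
  then have "coord1 v = coord1 w + of_int k" "coord2 v = coord2 w + of_int l" by simp_all
  then have "v = w + of_int k * a + of_int l * b"
    by (subst coord_decompose[of v], subst coord_decompose[of w]) (simp add: algebra_simps)
  then show ?thesis using lattice_periodic_int[OF h, of w k l] by simp
qed

lemma lattice_periodic_torus_point: "lattice_periodic torus_point"
  by (simp add: lattice_periodic_def torus_point_def char_add char_basis)

lemma trig_approx_real:
  fixes h :: "complex \<Rightarrow> real"
  assumes h: "continuous_on UNIV h" "lattice_periodic h" and e: "e > 0"
  obtains \<tau> where "trig_poly \<tau>" "\<And>w. norm (of_real (h w) - \<tau> w) < e"
proof -
  define S where "S = torus_point ` closed_cell"
  have cT: "continuous_on A torus_point" for A
    unfolding torus_point_def[abs_def] by (intro continuous_intros continuous_char)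
  have S: "compact S"
    unfolding S_def by (rule compact_continuous_image[OF cT compact_closed_cell])
  \<comment> \<open>The function induced by h on the image; any preimage will do, because h is
    constant on the fibres of \<open>torus_point\<close>.\<close>
  define H where "H = (\<lambda>y. h (SOME w. torus_point w = y))"
  have H: "H (torus_point w) = h w" for w
    unfolding H_def by (rule torus_point_eqD[OF h(2)]) (rule someI[of "\<lambda>v. torus_point v = torus_point w" w], simp)
  have inS: "torus_point w \<in> S" for w
  proof -
    obtain m n :: int where "w + of_int m * a + of_int n * b \<in> closed_cell"
      using reduce_to_cell by blast
    then show ?thesis
      unfolding S_def using lattice_periodic_int[OF lattice_periodic_torus_point, of w m n] by (metis image_eqI)
  qed
  \<comment> \<open>The cell is compact, so \<open>torus_point\<close> is a closed map on it: the
    preimage of a closed set under H is the image of a compact set.\<close>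
  have "continuous_on S H"
    unfolding continuous_on_closed_invariant
  proof (intro allI impI)
    fix B :: "real set" assume "closed B"
    define A where "A = torus_point ` (closed_cell \<inter> h -` B)"
    have "closed (h -` B)"
      using h(1) \<open>closed B\<close> by (intro continuous_closed_vimage) (auto simp: continuous_on_eq_continuous_at)
    then have "compact A"
      unfolding A_def by (intro compact_continuous_image[OF cT] compact_Int_closed compact_closed_cell)
    moreover have "A \<inter> S = H -` B \<inter> S"
      by (auto simp: A_def S_def H)
    ultimately show "\<exists>A. closed A \<and> A \<inter> S = H -` B \<inter> S"
      using compact_imp_closed by blast
  qed
  then obtain p where p: "real_polynomial_function p" "\<And>x. x \<in> S \<Longrightarrow> \<bar>H x - p x\<bar> < e"
    using Stone_Weierstrass_real_polynomial_function[OF S _ e] by blast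
  show ?thesis
  proof (rule that)
    show "trig_poly (\<lambda>w. of_real (p (torus_point w)))"
      by (rule trig_poly_real_polynomial[OF p(1)])
    show "norm (of_real (h w) - complex_of_real (p (torus_point w))) < e" for w
      using p(2)[OF inS[of w]] unfolding H of_real_diff[symmetric] norm_of_real .
  qed
qed

lemma trig_approx:
  fixes h :: "complex \<Rightarrow> complex"
  assumes h: "continuous_on UNIV h" "lattice_periodic h" and e: "e > 0"
  obtains \<tau> where "trig_poly \<tau>" "\<And>w. norm (h w - \<tau> w) \<le> e"
proof -
  have "continuous_on UNIV (\<lambda>w. Re (h w))" "continuous_on UNIV (\<lambda>w. Im (h w))"
    using h by (auto intro!: continuous_intros)
  moreover have "lattice_periodic (\<lambda>w. Re (h w))" "lattice_periodic (\<lambda>w. Im (h w))"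
    using h by (auto simp: lattice_periodic_def)
  ultimately obtain \<tau>1 \<tau>2 where \<tau>: "trig_poly \<tau>1" "trig_poly \<tau>2"
      "\<And>w. norm (of_real (Re (h w)) - \<tau>1 w) < e/2" "\<And>w. norm (of_real (Im (h w)) - \<tau>2 w) < e/2"
    using e by (metis trig_approx_real half_gt_zero)
  show ?thesis
  proof (rule that)
    show "trig_poly (\<lambda>w. \<tau>1 w + \<i> * \<tau>2 w)" by (intro trig_poly.intros \<tau>)
    fix w
    have "h w - (\<tau>1 w + \<i> * \<tau>2 w) = (of_real (Re (h w)) - \<tau>1 w) + \<i> * (of_real (Im (h w)) - \<tau>2 w)"
      by (subst complex_eq[of "h w"]) (simp add: algebra_simps)
    also have "norm \<dots> \<le> norm (of_real (Re (h w)) - \<tau>1 w) + norm (of_real (Im (h w)) - \<tau>2 w)"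
      by (rule order_trans[OF norm_triangle_ineq]) (simp add: norm_mult)
    also have "\<dots> \<le> e" using \<tau>(3,4)[of w] by simp
    finally show "norm (h w - (\<tau>1 w + \<i> * \<tau>2 w)) \<le> e" .
  qed
qed

text \<open>The constant is uniform in g and R, which later permits integration over the radius.
  Subtracting the mean removes the trivial character; every other character has mean 0 and obeys the
  boundary estimate; and the bound passes to linear combinations.\<close>

lemma trig_poly_equidistribution:
  assumes "trig_poly \<tau>"
  shows "\<exists>K\<ge>0. \<forall>g R. g holomorphic_on UNIV \<longrightarrow> 0 \<le> R \<longrightarrow>
    norm (disc_integral (\<lambda>z. (\<tau> (g z) - cell_mean \<tau>) * of_real ((cmod (deriv g z))\<^sup>2)) R)
      \<le> K * circ_integral (\<lambda>z. cmod (deriv g z)) R"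
  using assms
proof (induction \<tau>)
  case (char m n)
  show ?case
  proof (cases "m = 0 \<and> n = 0")
    case True
    then have "char m n = (\<lambda>_. 1)" by (simp add: fun_eq_iff char_def)
    then show ?thesis by (intro exI[of _ 0]) (simp add: cell_mean_const disc_integral_def)
  next
    case False
    then obtain \<kappa> where \<kappa>: "\<kappa> \<noteq> 0" "\<And>w. char m n w = cis (Re (\<kappa> * w))"
      using char_frequency by metis
    have m0: "cell_mean (char m n) = 0"
      using False by (simp add: cell_mean_def integral_char_zero)
    then show ?thesis
      using disc_integral_character_bound[OF _ \<kappa>(1), folded \<kappa>(2)]
      by (intro exI[of _ "2 / cmod \<kappa>"]) simp
  qed
next
  case (add f h)
  then obtain K L where K: "K \<ge> 0" "\<And>g R. g holomorphic_on UNIV \<Longrightarrow> 0 \<le> R \<Longrightarrow>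
    norm (disc_integral (\<lambda>z. (f (g z) - cell_mean f) * of_real ((cmod (deriv g z))\<^sup>2)) R)
      \<le> K * circ_integral (\<lambda>z. cmod (deriv g z)) R"
    and L: "L \<ge> 0" "\<And>g R. g holomorphic_on UNIV \<Longrightarrow> 0 \<le> R \<Longrightarrow>
    norm (disc_integral (\<lambda>z. (h (g z) - cell_mean h) * of_real ((cmod (deriv g z))\<^sup>2)) R)
      \<le> L * circ_integral (\<lambda>z. cmod (deriv g z)) R"
    by blast
  have cf: "continuous_on UNIV f" "continuous_on UNIV h"
    using add trig_poly_continuous by auto
  show ?case
  proof (intro exI[of _ "K + L"] conjI allI impI)
    fix g :: "complex \<Rightarrow> complex" and R :: real
    assume g: "g holomorphic_on UNIV" and R: "0 \<le> R"
    have cg: "continuous_on UNIV g" "continuous_on UNIV (deriv g)"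
      using g holomorphic_deriv[OF g] by (auto intro: holomorphic_on_imp_continuous_on)
    note cc = cg continuous_on_compose2[OF cf(1) cg(1)] continuous_on_compose2[OF cf(2) cg(1)]
    have eq: "disc_integral (\<lambda>z. (f (g z) + h (g z) - cell_mean (\<lambda>w. f w + h w)) * of_real ((cmod (deriv g z))\<^sup>2)) R
      = disc_integral (\<lambda>z. (f (g z) - cell_mean f) * of_real ((cmod (deriv g z))\<^sup>2)) R
       + disc_integral (\<lambda>z. (h (g z) - cell_mean h) * of_real ((cmod (deriv g z))\<^sup>2)) R"
      by (subst disc_integral_add[symmetric])
        (auto intro!: continuous_intros cc simp: cell_mean_add[OF cf] algebra_simps)
    show "norm (disc_integral (\<lambda>z. (f (g z) + h (g z) - cell_mean (\<lambda>w. f w + h w))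
      * of_real ((cmod (deriv g z))\<^sup>2)) R) \<le> (K + L) * circ_integral (\<lambda>z. cmod (deriv g z)) R"
      unfolding eq distrib_right
      by (rule order_trans[OF norm_triangle_ineq]) (intro add_mono K(2)[OF g R] L(2)[OF g R])
  qed (use K L in auto)
next
  case (cmul f c)
  then obtain K where K: "K \<ge> 0" "\<And>g R. g holomorphic_on UNIV \<Longrightarrow> 0 \<le> R \<Longrightarrow>
    norm (disc_integral (\<lambda>z. (f (g z) - cell_mean f) * of_real ((cmod (deriv g z))\<^sup>2)) R)
      \<le> K * circ_integral (\<lambda>z. cmod (deriv g z)) R" by blast
  have "disc_integral (\<lambda>z. (c * f (g z) - cell_mean (\<lambda>w. c * f w)) * of_real ((cmod (deriv g z))\<^sup>2)) R
      = c * disc_integral (\<lambda>z. (f (g z) - cell_mean f) * of_real ((cmod (deriv g z))\<^sup>2)) R" for g R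
    unfolding disc_integral_cmul_complex[symmetric] cell_mean_cmul by (simp add: algebra_simps)
  then show ?case
    using K by (intro exI[of _ "cmod c * K"]) (auto simp: norm_mult mult.assoc intro!: mult_left_mono)
qed

text \<open>A trigonometric polynomial within e/2 of h has its mean within e/2 of that of h, so
  replacing h by it costs at most e times the energy of g.\<close>

lemma equidistribution:
  assumes h: "continuous_on UNIV h" "lattice_periodic h" and e: "e > 0"
  obtains K where "K \<ge> 0" "\<And>g R. g holomorphic_on UNIV \<Longrightarrow> 0 \<le> R \<Longrightarrow>
    norm (disc_integral (\<lambda>z. (h (g z) - cell_mean h) * of_real ((cmod (deriv g z))\<^sup>2)) R)
      \<le> K * circ_integral (\<lambda>z. cmod (deriv g z)) R + e * disc_integral (\<lambda>z. (cmod (deriv g z))\<^sup>2) R"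
proof -
  obtain \<tau> where \<tau>: "trig_poly \<tau>" "\<And>w. norm (h w - \<tau> w) \<le> e/2"
    using trig_approx[OF h, of "e/2"] e by auto
  obtain K where K: "K \<ge> 0" "\<And>g R. g holomorphic_on UNIV \<Longrightarrow> 0 \<le> R \<Longrightarrow>
    norm (disc_integral (\<lambda>z. (\<tau> (g z) - cell_mean \<tau>) * of_real ((cmod (deriv g z))\<^sup>2)) R)
      \<le> K * circ_integral (\<lambda>z. cmod (deriv g z)) R"
    using trig_poly_equidistribution[OF \<tau>(1)] by blast
  have c\<tau>: "continuous_on UNIV \<tau>" by (rule trig_poly_continuous[OF \<tau>(1)])
  have m: "norm (cell_mean h - cell_mean \<tau>) \<le> e/2"
    unfolding cell_mean_diff[OF h(1) c\<tau>, symmetric]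
    by (rule cell_mean_norm_le) (use h c\<tau> \<tau> in \<open>auto intro!: continuous_intros\<close>)
  define k where "k = (\<lambda>w. (h w - cell_mean h) - (\<tau> w - cell_mean \<tau>))"
  have ck: "continuous_on UNIV k"
    unfolding k_def by (intro continuous_intros h c\<tau>)
  have k: "norm (k w) \<le> e" for w
  proof -
    have "k w = (h w - \<tau> w) - (cell_mean h - cell_mean \<tau>)" by (simp add: k_def)
    then show ?thesis using norm_triangle_ineq4[of "h w - \<tau> w" "cell_mean h - cell_mean \<tau>"] m \<tau>(2)[of w] by simp
  qed
  show ?thesis
  proof (rule that[OF K(1)])
    fix g :: "complex \<Rightarrow> complex" and R :: real
    assume g: "g holomorphic_on UNIV" and R: "0 \<le> R"
    have cg: "continuous_on UNIV g" "continuous_on UNIV (deriv g)"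
      using g holomorphic_deriv[OF g] by (auto intro: holomorphic_on_imp_continuous_on)
    note cc = cg continuous_on_compose2[OF c\<tau> cg(1)] continuous_on_compose2[OF h(1) cg(1)]
      continuous_on_compose2[OF ck cg(1)]
    have eq: "disc_integral (\<lambda>z. (h (g z) - cell_mean h) * of_real ((cmod (deriv g z))\<^sup>2)) R
      = disc_integral (\<lambda>z. (\<tau> (g z) - cell_mean \<tau>) * of_real ((cmod (deriv g z))\<^sup>2)) R
       + disc_integral (\<lambda>z. k (g z) * of_real ((cmod (deriv g z))\<^sup>2)) R"
      by (subst disc_integral_add[symmetric])
        (auto intro!: continuous_intros cc simp: k_def algebra_simps)
    show "norm (disc_integral (\<lambda>z. (h (g z) - cell_mean h) * of_real ((cmod (deriv g z))\<^sup>2)) R)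
      \<le> K * circ_integral (\<lambda>z. cmod (deriv g z)) R + e * disc_integral (\<lambda>z. (cmod (deriv g z))\<^sup>2) R"
      unfolding eq
    proof (rule order_trans[OF norm_triangle_ineq], rule add_mono[OF K(2)[OF g R]])
      show "norm (disc_integral (\<lambda>z. k (g z) * of_real ((cmod (deriv g z))\<^sup>2)) R) \<le> e * disc_integral (\<lambda>z. (cmod (deriv g z))\<^sup>2) R"
        unfolding disc_integral_cmul[symmetric]
        by (rule disc_integral_norm_le)
          (auto intro!: continuous_intros cc mult_right_mono k simp: norm_mult norm_power)
    qed
  qed
qed

end

section \<open>Concentrated discs\<close>

definition energy :: "(complex \<Rightarrow> complex) \<Rightarrow> (complex \<Rightarrow> complex) \<Rightarrow> complex \<Rightarrow> real" where
  "energy g1 g2 z = (cmod (deriv g1 z))\<^sup>2 + (cmod (deriv g2 z))\<^sup>2"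

abbreviation speed :: "(complex \<Rightarrow> complex) \<Rightarrow> (complex \<Rightarrow> complex) \<Rightarrow> complex \<Rightarrow> real" where
  "speed g1 g2 \<equiv> \<lambda>z. sqrt (energy g1 g2 z)"

text \<open>Up to constants, the pointwise error of restricting a pulled back form to the fibre over
  p: every coefficient with an index 1 carries |g1'| and one more derivative, and moving g1 to p in
  the remaining coefficient costs a multiple of |g1 - p| |g2'|^2.\<close>

definition defect :: "complex \<Rightarrow> (complex \<Rightarrow> complex) \<Rightarrow> (complex \<Rightarrow> complex) \<Rightarrow> complex \<Rightarrow> real" where
  "defect p g1 g2 z = cmod (deriv g1 z) * sqrt (energy g1 g2 z) + cmod (g1 z - p) * (cmod (deriv g2 z))\<^sup>2"

text \<open>Strictness serves twice: it makes the property open, and for positive \<epsilon> it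
  forces the energy to be positive, the left sides being nonnegative.\<close>

definition concentrated :: "(complex \<Rightarrow> complex) \<Rightarrow> (complex \<Rightarrow> complex) \<Rightarrow> complex \<Rightarrow> real \<Rightarrow> real \<Rightarrow> bool" where
  "concentrated g1 g2 p \<epsilon> R \<longleftrightarrow>
     circ_integral (speed g1 g2) R < \<epsilon> * disc_integral (energy g1 g2) R \<and>
     disc_integral (defect p g1 g2) R < \<epsilon> * disc_integral (energy g1 g2) R \<and>
     log_average (circ_integral (speed g1 g2)) R
       < \<epsilon> * log_average (disc_integral (energy g1 g2)) R \<and>
     log_average (disc_integral (defect p g1 g2)) R < \<epsilon> * log_average (disc_integral (energy g1 g2)) R"

lemma continuous_energy:
  assumes "g1 holomorphic_on UNIV" "g2 holomorphic_on UNIV"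
  shows "continuous_on UNIV (energy g1 g2)"
    and "continuous_on UNIV (speed g1 g2)"
    and "continuous_on UNIV (defect p g1 g2)"
proof -
  have "continuous_on UNIV g1" "continuous_on UNIV (deriv g1)" "continuous_on UNIV (deriv g2)"
    using assms holomorphic_deriv[of _ UNIV] by (auto intro: holomorphic_on_imp_continuous_on)
  then show "continuous_on UNIV (energy g1 g2)" "continuous_on UNIV (speed g1 g2)"
    "continuous_on UNIV (defect p g1 g2)"
    unfolding energy_def[abs_def] defect_def[abs_def] by (auto intro!: continuous_intros)
qed

lemma energy_nonneg: "energy g1 g2 z \<ge> 0" and defect_nonneg: "defect p g1 g2 z \<ge> 0"
  by (simp_all add: energy_def defect_def)

lemma cmod_deriv_le_sqrt_energy:
  "cmod (deriv g1 z) \<le> sqrt (energy g1 g2 z)" "cmod (deriv g2 z) \<le> sqrt (energy g1 g2 z)"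
  unfolding energy_def by (auto intro: real_le_rsqrt)

lemma pb_omega11: "pb omega11 g1 g2 z = of_real (energy g1 g2 z)"
  unfolding energy_def of_real_add complex_norm_square
  by (simp add: pb_def omega11_def dcomp_def)

lemma disc_int_omega11:
  assumes "g1 holomorphic_on UNIV" "g2 holomorphic_on UNIV"
  shows "disc_int omega11 g1 g2 R = of_real (disc_integral (energy g1 g2) R)"
proof -
  have "disc_int omega11 g1 g2 R = disc_integral (\<lambda>z. complex_of_real (energy g1 g2 z)) R"
    by (simp add: disc_int_def disc_integral_def pb_omega11[abs_def])
  then show ?thesis using disc_integral_of_real[OF continuous_energy(1)[OF assms]] by simp
qed

lemma nev_T_log_average: "nev_T \<eta> g1 g2 R = log_average (disc_int \<eta> g1 g2) R"
proof -
  have "(\<lambda>t. disc_int \<eta> g1 g2 t / complex_of_real t) = (\<lambda>t. disc_int \<eta> g1 g2 t /\<^sub>R t)"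
    by (auto simp: scaleR_conv_of_real divide_inverse)
  then show ?thesis by (simp only: nev_T_def log_average_def)
qed

lemma nev_T_omega11:
  assumes "g1 holomorphic_on UNIV" "g2 holomorphic_on UNIV"
  shows "nev_T omega11 g1 g2 R = of_real (log_average (disc_integral (energy g1 g2)) R)"
proof -
  have "disc_int omega11 g1 g2 = (\<lambda>t. complex_of_real (disc_integral (energy g1 g2) t))"
    using disc_int_omega11[OF assms] by auto
  then show ?thesis
    using log_average_of_real[OF log_average_disc_integrable[OF continuous_energy(1)[OF assms]]]
    by (simp add: nev_T_log_average)
qed

lemma bdry_len_circ_integral: "bdry_len g1 g2 t = circ_integral (speed g1 g2) t"
  by (simp add: bdry_len_def circ_integral_def energy_def)

lemma nev_L_log_average: "nev_L g1 g2 R = log_average (circ_integral (speed g1 g2)) R"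
  unfolding nev_L_def log_average_def bdry_len_circ_integral by (simp add: divide_inverse mult.commute)

lemma energy_swap: "energy g1 g2 = energy g2 g1"
  by (auto simp: energy_def)

text \<open>Continuity and periodicity are what the approximation argument uses. The class contains
  the test forms and is stable under exchange of the two factors.\<close>

definition torus_form :: "complex \<Rightarrow> complex \<Rightarrow> complex \<Rightarrow> complex \<Rightarrow> form11 \<Rightarrow> bool" where
  "torus_form a1 b1 a2 b2 \<eta> \<longleftrightarrow>
     (\<forall>j\<in>{1,2}. \<forall>k\<in>{1,2}. continuous_on UNIV (\<eta> j k) \<and>
        (\<forall>z w. \<eta> j k (z + a1, w) = \<eta> j k (z, w) \<and> \<eta> j k (z + b1, w) = \<eta> j k (z, w) \<and>
               \<eta> j k (z, w + a2) = \<eta> j k (z, w) \<and> \<eta> j k (z, w + b2) = \<eta> j k (z, w)))"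

lemma test_form_imp_torus_form: "test_form a1 b1 a2 b2 \<eta> \<Longrightarrow> torus_form a1 b1 a2 b2 \<eta>"
  unfolding test_form_def torus_form_def smooth_fun_def
  by (metis Cn.simps(1))

lemma continuous_pb:
  assumes g: "g1 holomorphic_on UNIV" "g2 holomorphic_on UNIV" and \<eta>: "torus_form a1 b1 a2 b2 \<eta>"
  shows "continuous_on UNIV (pb \<eta> g1 g2)"
proof -
  have cg: "continuous_on UNIV g1" "continuous_on UNIV g2" "continuous_on UNIV (deriv g1)" "continuous_on UNIV (deriv g2)"
    using g holomorphic_deriv[OF g(1)] holomorphic_deriv[OF g(2)] by (auto intro: holomorphic_on_imp_continuous_on)
  have cont: "continuous_on UNIV (\<eta> j k)" if "j \<in> {1,2}" "k \<in> {1,2}" for j k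
    using \<eta> that unfolding torus_form_def by blast
  have cc: "continuous_on UNIV (\<lambda>z. \<eta> j k (g1 z, g2 z))" if "j \<in> {1,2}" "k \<in> {1,2}" for j k
    by (intro continuous_on_compose2[OF cont[OF that]] continuous_intros cg) auto
  show ?thesis
    unfolding pb_def[abs_def] dcomp_def by (auto intro!: continuous_intros cg cc)
qed

text \<open>Pullback under the exchange of the factors; 3 - j interchanges the indices 1 and 2. It
  reduces horizontal currents to vertical ones.\<close>

definition swap_form :: "form11 \<Rightarrow> form11" where
  "swap_form \<eta> = (\<lambda>j k x. \<eta> (3 - j) (3 - k) (snd x, fst x))"

lemma torus_form_swap: "torus_form a1 b1 a2 b2 \<eta> \<Longrightarrow> torus_form a2 b2 a1 b1 (swap_form \<eta>)"
  unfolding torus_form_def swap_form_def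
  by (auto intro!: continuous_intros elim!: continuous_on_compose2)

lemma pb_swap: "pb (swap_form \<eta>) g2 g1 = pb \<eta> g1 g2"
  by (rule ext) (simp add: pb_def swap_form_def dcomp_def)

lemma vert_current_swap: "vert_current a1 b1 p (swap_form \<eta>) = horiz_current a1 b1 p \<eta>"
  by (simp add: vert_current_def horiz_current_def swap_form_def)

section \<open>Comparison of disc integrals with means over a fibre\<close>

locale two_lattices = L1: planar_lattice a1 b1 + L2: planar_lattice a2 b2 for a1 b1 a2 b2
begin

lemma periodic_pair_shift:
  fixes f :: "complex \<times> complex \<Rightarrow> complex"
  assumes "\<forall>z w. f (z + a1, w) = f (z, w) \<and> f (z + b1, w) = f (z, w) \<and>
               f (z, w + a2) = f (z, w) \<and> f (z, w + b2) = f (z, w)"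
  shows "f (z + of_int m * a1 + of_int n * b1, w + of_int k * a2 + of_int l * b2) = f (z, w)"
proof -
  have "L1.lattice_periodic (\<lambda>z. f (z, w))" for w
    using assms by (simp add: L1.lattice_periodic_def)
  moreover have "L2.lattice_periodic (\<lambda>w. f (z, w))" for z
    using assms by (simp add: L2.lattice_periodic_def)
  ultimately show ?thesis
    using L1.lattice_periodic_int[of "\<lambda>z. f (z, _)"] L2.lattice_periodic_int[of "\<lambda>w. f (_, w)"] by simp
qed

lemma periodic_bounded:
  fixes f :: "complex \<times> complex \<Rightarrow> complex"
  assumes f: "continuous_on UNIV f" and per: "\<forall>z w. f (z + a1, w) = f (z, w) \<and> f (z + b1, w) = f (z, w) \<and>
               f (z, w + a2) = f (z, w) \<and> f (z, w + b2) = f (z, w)"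
  obtains M where "M > 0" "\<And>x. norm (f x) \<le> M"
proof -
  have "compact (f ` (L1.closed_cell \<times> L2.closed_cell))"
    by (intro compact_continuous_image compact_Times L1.compact_closed_cell L2.compact_closed_cell)
      (use f continuous_on_subset in blast)
  then obtain M where M: "M > 0" "\<And>y. y \<in> f ` (L1.closed_cell \<times> L2.closed_cell) \<Longrightarrow> norm y \<le> M"
    using compact_imp_bounded bounded_pos by metis
  show ?thesis
  proof (rule that[OF M(1)])
    fix x :: "complex \<times> complex"
    obtain z w where x: "x = (z, w)" by (cases x)
    obtain m n :: int where "z + of_int m * a1 + of_int n * b1 \<in> L1.closed_cell"
      using L1.reduce_to_cell by blast
    moreover obtain k l :: int where "w + of_int k * a2 + of_int l * b2 \<in> L2.closed_cell"
      using L2.reduce_to_cell by blast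
    ultimately have "norm (f (z + of_int m * a1 + of_int n * b1, w + of_int k * a2 + of_int l * b2)) \<le> M"
      by (intro M(2)) blast
    then show "norm (f x) \<le> M" by (simp add: x periodic_pair_shift[OF per])
  qed
qed

text \<open>Uniform continuity in linear form: at distances below d' the difference is at most e,
  and at larger distances the crude bound 2 M is at most 2 M / d' times the distance. The linear
  term is the one that \<open>defect\<close> measures.\<close>

lemma periodic_modulus:
  fixes f :: "complex \<times> complex \<Rightarrow> complex"
  assumes f: "continuous_on UNIV f" and per: "\<forall>z w. f (z + a1, w) = f (z, w) \<and> f (z + b1, w) = f (z, w) \<and>
               f (z, w + a2) = f (z, w) \<and> f (z, w + b2) = f (z, w)" and e: "e > 0"
  obtains K where "K \<ge> 0" "\<And>z p w. norm (f (z, w) - f (p, w)) \<le> e + K * cmod (z - p)"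
proof -
  obtain M where M: "M > 0" "\<And>x. norm (f x) \<le> M"
    using periodic_bounded[OF f per] by blast
  \<comment> \<open>The cell is enlarged by a unit disc: z and p are moved by the same lattice
    vector, so when z lands in the cell, p may lie outside it, but at distance less than d' \<le>
    1.\<close>
  define C where "C = {x + y |x y. x \<in> L1.closed_cell \<and> y \<in> cball (0::complex) 1} \<times> L2.closed_cell"
  have "compact C"
    unfolding C_def by (intro compact_Times compact_sums L1.compact_closed_cell L2.compact_closed_cell compact_cball)
  then have "uniformly_continuous_on C f"
    using f continuous_on_subset by (intro compact_uniformly_continuous) blast+
  then obtain d where d: "d > 0" "\<And>x y. x \<in> C \<Longrightarrow> y \<in> C \<Longrightarrow> dist y x < d \<Longrightarrow> dist (f y) (f x) < e"
    unfolding uniformly_continuous_on_def using e by meson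
  define d' where "d' = min d 1"
  have d': "d' > 0" "d' \<le> d" "d' \<le> 1" using d by (auto simp: d'_def)
  show ?thesis
  proof (rule that[of "2 * M / d'"])
    show "0 \<le> 2 * M / d'" using M d' by simp
    fix z p w
    show "norm (f (z, w) - f (p, w)) \<le> e + 2 * M / d' * cmod (z - p)"
    proof (cases "cmod (z - p) < d'")
      case True
      obtain m n :: int where mn: "z + of_int m * a1 + of_int n * b1 \<in> L1.closed_cell"
        using L1.reduce_to_cell by blast
      obtain k l :: int where kl: "w + of_int k * a2 + of_int l * b2 \<in> L2.closed_cell"
        using L2.reduce_to_cell by blast
      let ?x = "(z + of_int m * a1 + of_int n * b1, w + of_int k * a2 + of_int l * b2)"
      let ?y = "(p + of_int m * a1 + of_int n * b1, w + of_int k * a2 + of_int l * b2)"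
      have "?x \<in> C"
      proof -
        have "z + of_int m * a1 + of_int n * b1 = (z + of_int m * a1 + of_int n * b1) + 0" by simp
        moreover have "(0::complex) \<in> cball 0 1" by simp
        ultimately show ?thesis unfolding C_def using mn kl by blast
      qed
      moreover have "?y \<in> C"
      proof -
        have "p + of_int m * a1 + of_int n * b1 = (z + of_int m * a1 + of_int n * b1) + (p - z)" by simp
        moreover have "p - z \<in> cball 0 1" using True d' by (simp add: norm_minus_commute)
        ultimately show ?thesis unfolding C_def using mn kl by blast
      qed
      moreover have "dist ?x ?y < d"
        using True d' by (simp add: dist_Pair_Pair dist_norm)
      ultimately have "dist (f ?x) (f ?y) < e" using d(2) by blast
      then have "norm (f (z, w) - f (p, w)) < e"
        by (simp add: periodic_pair_shift[OF per] dist_norm)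
      moreover have "0 \<le> 2 * M / d' * cmod (z - p)" using M d' by simp
      ultimately show ?thesis by linarith
    next
      case False
      have "norm (f (z, w) - f (p, w)) \<le> 2 * M"
        using norm_triangle_ineq4[of "f (z, w)" "f (p, w)"] M(2)[of "(z, w)"] M(2)[of "(p, w)"] by simp
      also have "\<dots> \<le> 2 * M / d' * cmod (z - p)"
        using False d' M by (simp add: field_simps)
      finally show ?thesis using e by simp
    qed
  qed
qed

text \<open>The difference splits into X, bounded pointwise by \<open>defect\<close> and a little
  energy, and Y, the deviation of the fibre coefficient from its mean, which equidistribution of g2
  controls. Each part takes half of e.\<close>

lemma disc_int_near_mean:
  assumes \<eta>: "torus_form a1 b1 a2 b2 \<eta>" and e: "e > 0"
  obtains K where "K \<ge> 0" "\<And>g1 g2 R. g1 holomorphic_on UNIV \<Longrightarrow> g2 holomorphic_on UNIV \<Longrightarrow> 0 \<le> R \<Longrightarrow>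
    norm (disc_int \<eta> g1 g2 R - L2.cell_mean (\<lambda>w. \<eta> 2 2 (p, w)) * of_real (disc_integral (energy g1 g2) R))
     \<le> K * circ_integral (speed g1 g2) R + K * disc_integral (defect p g1 g2) R
        + e * disc_integral (energy g1 g2) R"
proof -
  have cont: "continuous_on UNIV (\<eta> j k)" and per: "\<forall>z w. \<eta> j k (z + a1, w) = \<eta> j k (z, w) \<and> \<eta> j k (z + b1, w) = \<eta> j k (z, w) \<and>
               \<eta> j k (z, w + a2) = \<eta> j k (z, w) \<and> \<eta> j k (z, w + b2) = \<eta> j k (z, w)"
    if "j \<in> {1,2}" "k \<in> {1,2}" for j k
    using \<eta> that unfolding torus_form_def by blast+
  have "\<exists>M>0. \<forall>x. norm (\<eta> j k x) \<le> M" if "j \<in> {1,2}" "k \<in> {1,2}" for j k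
    using periodic_bounded[OF cont[OF that] per[OF that]] by metis
  then obtain m where m: "\<And>j k. j \<in> {1,2} \<Longrightarrow> k \<in> {1,2} \<Longrightarrow> m j k > 0 \<and> (\<forall>x. norm (\<eta> j k x) \<le> m j k)"
    by metis
  define M where "M = m 1 1 + m 1 2 + m 2 1 + m 2 2"
  have pos: "m 1 1 > 0" "m 1 2 > 0" "m 2 1 > 0" "m 2 2 > 0" using m by auto
  have M: "norm (\<eta> 1 1 x) \<le> M" "norm (\<eta> 1 2 x) \<le> M" "norm (\<eta> 2 1 x) \<le> M" "norm (\<eta> 2 2 x) \<le> M" for x
  proof -
    have "norm (\<eta> 1 1 x) \<le> m 1 1" "norm (\<eta> 1 2 x) \<le> m 1 2" "norm (\<eta> 2 1 x) \<le> m 2 1" "norm (\<eta> 2 2 x) \<le> m 2 2"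
      using m by blast+
    then show "norm (\<eta> 1 1 x) \<le> M" "norm (\<eta> 1 2 x) \<le> M" "norm (\<eta> 2 1 x) \<le> M" "norm (\<eta> 2 2 x) \<le> M"
      using pos unfolding M_def by linarith+
  qed
  have M0: "M \<ge> 0" using M(1)[of undefined] norm_ge_zero order_trans by blast
  obtain K1 where K1: "K1 \<ge> 0" "\<And>z p w. norm (\<eta> 2 2 (z, w) - \<eta> 2 2 (p, w)) \<le> e/2 + K1 * cmod (z - p)"
    using periodic_modulus[OF cont[of 2 2] per[of 2 2], of "e/2"] e by auto
  define h where "h = (\<lambda>w. \<eta> 2 2 (p, w))"
  have h: "continuous_on UNIV h" "L2.lattice_periodic h"
    using per[of 2 2] unfolding h_def L2.lattice_periodic_def
    by (auto intro!: continuous_on_compose2[OF cont[of 2 2]] continuous_intros)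
  define \<mu> where "\<mu> = L2.cell_mean h"
  have \<mu>: "norm \<mu> \<le> M"
    unfolding \<mu>_def by (rule L2.cell_mean_norm_le[OF h(1)]) (use M(4) in \<open>simp add: h_def\<close>)
  obtain K2 where K2: "K2 \<ge> 0" "\<And>g R. g holomorphic_on UNIV \<Longrightarrow> 0 \<le> R \<Longrightarrow>
    norm (disc_integral (\<lambda>z. (h (g z) - \<mu>) * of_real ((cmod (deriv g z))\<^sup>2)) R)
      \<le> K2 * circ_integral (\<lambda>z. cmod (deriv g z)) R + e/2 * disc_integral (\<lambda>z. (cmod (deriv g z))\<^sup>2) R"
    unfolding \<mu>_def using L2.equidistribution[OF h, of "e/2"] e half_gt_zero by blast
  \<comment> \<open>4 M collects the three coefficients with an index 1 and the part of the mean
    that multiplies |g1'|^2; K1 is the modulus of continuity in the first variable; K2 comes from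
    equidistribution.\<close>
  define K where "K = (4 * M + K1) + K2"
  show ?thesis
  proof (rule that[of K])
    show "K \<ge> 0" using M0 K1 K2 by (simp add: K_def)
    fix g1 g2 :: "complex \<Rightarrow> complex" and R :: real
    assume g: "g1 holomorphic_on UNIV" "g2 holomorphic_on UNIV" and R: "0 \<le> R"
    have cg: "continuous_on UNIV g1" "continuous_on UNIV g2" "continuous_on UNIV (deriv g1)" "continuous_on UNIV (deriv g2)"
      using g holomorphic_deriv[OF g(1)] holomorphic_deriv[OF g(2)] by (auto intro: holomorphic_on_imp_continuous_on)
    note ce = continuous_energy[OF g]
    note cpb = continuous_pb[OF g \<eta>]
    define Y where "Y = (\<lambda>z. (h (g2 z) - \<mu>) * of_real ((cmod (deriv g2 z))\<^sup>2))"
    define X where "X = (\<lambda>z. pb \<eta> g1 g2 z - \<mu> * of_real (energy g1 g2 z) - Y z)"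
    have cY: "continuous_on UNIV Y"
      unfolding Y_def by (intro continuous_intros continuous_on_compose2[OF h(1) cg(2)] cg) auto
    have cX: "continuous_on UNIV X"
      unfolding X_def by (intro continuous_intros cpb ce cY)
    have X: "norm (X z) \<le> (4 * M + K1) * defect p g1 g2 z + e/2 * energy g1 g2 z" for z
    proof -
      define u where "u = deriv g1 z"
      define v where "v = deriv g2 z"
      define s where "s = sqrt (energy g1 g2 z)"
      define x where "x = (g1 z, g2 z)"
      have us: "cmod u \<le> s" "cmod v \<le> s"
        using cmod_deriv_le_sqrt_energy unfolding u_def v_def s_def by blast+
      have n: "of_real ((cmod y)\<^sup>2) = y * cnj y" for y
        by (rule complex_norm_square)
      have "X z = \<eta> 1 1 x * (u * cnj u) + \<eta> 1 2 x * (u * cnj v) + \<eta> 2 1 x * (v * cnj u)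
         + (\<eta> 2 2 x - h (g2 z)) * of_real ((cmod v)\<^sup>2) - \<mu> * (u * cnj u)"
        unfolding X_def Y_def pb_def dcomp_def energy_def of_real_add n
        by (simp add: u_def v_def x_def algebra_simps)
      also have "norm \<dots> \<le> norm (\<eta> 1 1 x * (u * cnj u)) + norm (\<eta> 1 2 x * (u * cnj v)) + norm (\<eta> 2 1 x * (v * cnj u))
         + norm ((\<eta> 2 2 x - h (g2 z)) * of_real ((cmod v)\<^sup>2)) + norm (\<mu> * (u * cnj u))"
        by (intro order_trans[OF norm_triangle_ineq4] order_trans[OF norm_triangle_ineq] add_mono order_refl)
      also have "\<dots> \<le> M * (cmod u * s) + M * (cmod u * s) + M * (cmod u * s)
         + (e/2 + K1 * cmod (g1 z - p)) * (cmod v)\<^sup>2 + M * (cmod u * s)"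
      proof -
        have 1: "norm (c * (u * cnj u)) \<le> M * (cmod u * s)" if "norm c \<le> M" for c
          unfolding norm_mult complex_mod_cnj by (intro mult_mono that mult_left_mono us) (use M0 us in auto)
        have 2: "norm (c * (u * cnj v)) \<le> M * (cmod u * s)" if "norm c \<le> M" for c
          unfolding norm_mult complex_mod_cnj by (intro mult_mono that mult_left_mono us) (use M0 us in auto)
        have 3: "norm (c * (v * cnj u)) \<le> M * (cmod u * s)" if "norm c \<le> M" for c
          using 2[OF that] unfolding norm_mult complex_mod_cnj by (simp add: mult.commute mult.left_commute)
        have 4: "norm ((\<eta> 2 2 x - h (g2 z)) * of_real ((cmod v)\<^sup>2)) \<le> (e/2 + K1 * cmod (g1 z - p)) * (cmod v)\<^sup>2"
          unfolding norm_mult norm_of_real h_def x_def using K1(2)[of "g1 z" "g2 z" p] K1(1) e by (intro mult_mono) auto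
        show ?thesis by (intro add_mono 1 2 3 4 M \<mu>)
      qed
      also have "\<dots> = 4 * M * (cmod u * s) + K1 * (cmod (g1 z - p) * (cmod v)\<^sup>2) + e/2 * (cmod v)\<^sup>2"
        by (simp add: algebra_simps)
      also have "\<dots> \<le> (4 * M + K1) * defect p g1 g2 z + e/2 * energy g1 g2 z"
      proof -
        have "(cmod v)\<^sup>2 \<le> energy g1 g2 z" by (simp add: energy_def v_def)
        then have 1: "e/2 * (cmod v)\<^sup>2 \<le> e/2 * energy g1 g2 z" using e by (intro mult_left_mono) auto
        have 2: "defect p g1 g2 z = cmod u * s + cmod (g1 z - p) * (cmod v)\<^sup>2"
          by (simp add: defect_def u_def v_def s_def)
        have "4 * M * (cmod (g1 z - p) * (cmod v)\<^sup>2) \<ge> 0" using M0 by simp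
        moreover have "K1 * (cmod u * s) \<ge> 0"
          using K1(1) order_trans[OF norm_ge_zero us(1)] by simp
        ultimately show ?thesis using 1 unfolding 2 distrib_left distrib_right by linarith
      qed
      finally show ?thesis .
    qed
    have "disc_int \<eta> g1 g2 R - \<mu> * of_real (disc_integral (energy g1 g2) R) = disc_integral X R + disc_integral Y R"
    proof -
      have "disc_integral X R = disc_integral (pb \<eta> g1 g2) R - disc_integral (\<lambda>z. \<mu> * of_real (energy g1 g2 z)) R - disc_integral Y R"
        unfolding X_def
        by (subst disc_integral_diff, intro continuous_intros cpb ce, rule cY, subst disc_integral_diff)
          (auto intro!: continuous_intros cpb ce)
      then show ?thesis
        by (simp add: disc_integral_cmul_complex disc_integral_of_real[OF ce(1)])
          (simp add: disc_integral_def disc_int_def)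
    qed
    then have "norm (disc_int \<eta> g1 g2 R - \<mu> * of_real (disc_integral (energy g1 g2) R))
      \<le> norm (disc_integral X R) + norm (disc_integral Y R)"
      using norm_triangle_ineq by simp
    also have "norm (disc_integral X R) \<le> disc_integral (\<lambda>z. (4 * M + K1) * defect p g1 g2 z + e/2 * energy g1 g2 z) R"
      by (rule disc_integral_norm_le[OF cX]) (use X in \<open>auto intro!: continuous_intros ce\<close>)
    also have "\<dots> = (4 * M + K1) * disc_integral (defect p g1 g2) R + e/2 * disc_integral (energy g1 g2) R"
      by (subst disc_integral_add, intro continuous_intros ce, intro continuous_intros ce,
          simp only: disc_integral_cmul)
    also have "norm (disc_integral Y R) \<le> K2 * circ_integral (speed g1 g2) R + e/2 * disc_integral (energy g1 g2) R"
    proof -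
      have 1: "circ_integral (\<lambda>z. cmod (deriv g2 z)) R \<le> circ_integral (speed g1 g2) R"
        by (rule circ_integral_le) (use R in \<open>auto intro!: continuous_intros cg ce cmod_deriv_le_sqrt_energy\<close>)
      have 2: "disc_integral (\<lambda>z. (cmod (deriv g2 z))\<^sup>2) R \<le> disc_integral (energy g1 g2) R"
        by (rule disc_integral_le) (auto intro!: continuous_intros cg ce simp: energy_def)
      show ?thesis
        unfolding Y_def using K2(2)[OF g(2) R] mult_left_mono[OF 1 K2(1)] mult_left_mono[OF 2, of "e/2"] e
        by linarith
    qed
    also have "(4 * M + K1) * disc_integral (defect p g1 g2) R + e/2 * disc_integral (energy g1 g2) R
       + (K2 * circ_integral (speed g1 g2) R + e/2 * disc_integral (energy g1 g2) R)
      \<le> K * circ_integral (speed g1 g2) R + K * disc_integral (defect p g1 g2) R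
        + e * disc_integral (energy g1 g2) R"
    proof -
      have "(4 * M + K1) * circ_integral (speed g1 g2) R \<ge> 0"
        using M0 K1 by (intro mult_nonneg_nonneg circ_integral_nonneg ce) (auto simp: R energy_nonneg)
      moreover have "K2 * disc_integral (defect p g1 g2) R \<ge> 0"
        using K2 by (intro mult_nonneg_nonneg disc_integral_nonneg ce) (auto simp: defect_nonneg)
      ultimately show ?thesis unfolding K_def distrib_right by argo
    qed
    finally show "norm (disc_int \<eta> g1 g2 R - L2.cell_mean (\<lambda>w. \<eta> 2 2 (p, w)) * of_real (disc_integral (energy g1 g2) R))
     \<le> K * circ_integral (speed g1 g2) R + K * disc_integral (defect p g1 g2) R
        + e * disc_integral (energy g1 g2) R"
      by (simp add: \<mu>_def h_def)
  qed
qed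

text \<open>The constants are the same at all radii, so the plain estimate can be integrated against
  dt/t.\<close>

lemma log_disc_int_near_mean:
  assumes \<eta>: "torus_form a1 b1 a2 b2 \<eta>" and g: "g1 holomorphic_on UNIV" "g2 holomorphic_on UNIV"
    and R: "0 \<le> R"
    and K: "\<And>R. 0 \<le> R \<Longrightarrow>
    norm (disc_int \<eta> g1 g2 R - \<mu> * of_real (disc_integral (energy g1 g2) R))
     \<le> K * circ_integral (speed g1 g2) R + K * disc_integral (defect p g1 g2) R
        + e * disc_integral (energy g1 g2) R"
  shows "norm (nev_T \<eta> g1 g2 R - \<mu> * of_real (log_average (disc_integral (energy g1 g2)) R))
     \<le> K * log_average (circ_integral (speed g1 g2)) R + K * log_average (disc_integral (defect p g1 g2)) R
        + e * log_average (disc_integral (energy g1 g2)) R"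
proof -
  note ce = continuous_energy[OF g]
  note cpb = continuous_pb[OF g \<eta>]
  have di: "disc_int \<eta> g1 g2 = disc_integral (pb \<eta> g1 g2)"
    by (auto simp: disc_int_def disc_integral_def)
  have i1: "(\<lambda>t. disc_int \<eta> g1 g2 t /\<^sub>R t) integrable_on {0..R}"
    unfolding di by (rule log_average_disc_integrable[OF cpb])
  have scal: "(\<lambda>t. (c * F t) /\<^sub>R t) integrable_on {0..R}" if "(\<lambda>t. F t /\<^sub>R t) integrable_on {0..R}" for c :: real and F
    using integrable_on_mult_right[OF that, of c] by (simp add: mult.left_commute)
  note iE = log_average_disc_integrable[OF ce(1), of R] and iC = log_average_circ_integrable[OF ce(2), of R]
    and iB = log_average_disc_integrable[OF ce(3)[of p], of R]
  have i2: "(\<lambda>t. (\<mu> * of_real (disc_integral (energy g1 g2) t)) /\<^sub>R t) integrable_on {0..R}"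
  proof -
    have "(\<lambda>t. disc_integral (\<lambda>z. \<mu> * of_real (energy g1 g2 z)) t /\<^sub>R t) integrable_on {0..R}"
      by (rule log_average_disc_integrable) (intro continuous_intros ce)
    then show ?thesis by (simp add: disc_integral_cmul_complex disc_integral_of_real[OF ce(1)])
  qed
  have i3: "(\<lambda>t. (K * circ_integral (speed g1 g2) t + K * disc_integral (defect p g1 g2) t) /\<^sub>R t) integrable_on {0..R}"
    unfolding scaleR_add_right by (intro integrable_add scal iC iB)
  have i4: "(\<lambda>t. (K * circ_integral (speed g1 g2) t + K * disc_integral (defect p g1 g2) t
        + e * disc_integral (energy g1 g2) t) /\<^sub>R t) integrable_on {0..R}"
    unfolding scaleR_add_right by (intro integrable_add scal iC iB iE)
  have "norm (log_average (\<lambda>t. disc_int \<eta> g1 g2 t - \<mu> * of_real (disc_integral (energy g1 g2) t)) R)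
    \<le> log_average (\<lambda>t. K * circ_integral (speed g1 g2) t + K * disc_integral (defect p g1 g2) t
        + e * disc_integral (energy g1 g2) t) R"
    by (rule log_average_norm_le[OF _ i4 K]) (auto simp only: scaleR_diff_right intro!: integrable_diff i1 i2)
  also have "\<dots> = K * log_average (circ_integral (speed g1 g2)) R + K * log_average (disc_integral (defect p g1 g2)) R
        + e * log_average (disc_integral (energy g1 g2)) R"
    by (simp only: log_average_add[OF i3 scal[OF iE]] log_average_add[OF scal[OF iC] scal[OF iB]] log_average_cmul)
  finally show ?thesis
    by (simp only: log_average_diff[OF i1 i2] log_average_cmul_complex log_average_of_real[OF iE] nev_T_log_average)
qed

text \<open>After division by the energy, concentration makes the length and defect terms small, and
  what remains is at most the prescribed tolerance. The local fact \<open>key\<close> treats plain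
  and averaged quantities alike.\<close>

lemma concentrated_limits:
  assumes g: "g1 holomorphic_on UNIV" "g2 holomorphic_on UNIV"
    and r: "\<And>l. 0 \<le> r l" and conc: "\<And>\<epsilon>. \<epsilon> > 0 \<Longrightarrow> \<forall>\<^sub>F l in sequentially. concentrated g1 g2 p \<epsilon> (r l)"
    and \<eta>: "torus_form a1 b1 a2 b2 \<eta>"
  shows "(\<lambda>l. disc_int \<eta> g1 g2 (r l) / of_real (area g1 g2 (r l))) \<longlonglongrightarrow> L2.cell_mean (\<lambda>w. \<eta> 2 2 (p, w))"
    and "(\<lambda>l. nev_T \<eta> g1 g2 (r l) / nev_T omega11 g1 g2 (r l)) \<longlonglongrightarrow> L2.cell_mean (\<lambda>w. \<eta> 2 2 (p, w))"
proof -
  define \<mu> where "\<mu> = L2.cell_mean (\<lambda>w. \<eta> 2 2 (p, w))"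
  note ce = continuous_energy[OF g]
  have key: "(\<lambda>l. X l / of_real (A l)) \<longlonglongrightarrow> \<mu>"
    if XK: "\<And>e. e > 0 \<Longrightarrow> \<exists>K\<ge>0. \<forall>l. norm (X l - \<mu> * of_real (A l)) \<le> K * C l + K * B l + e * A l"
     and CB: "\<And>\<epsilon>. \<epsilon> > 0 \<Longrightarrow> \<forall>\<^sub>F l in sequentially. C l < \<epsilon> * A l \<and> B l < \<epsilon> * A l" and C0: "\<And>l. C l \<ge> 0"
    for X :: "nat \<Rightarrow> complex" and A B C :: "nat \<Rightarrow> real"
  proof (rule tendstoI)
    fix e :: real assume e: "e > 0"
    then obtain K where K: "K \<ge> 0" "\<And>l. norm (X l - \<mu> * of_real (A l)) \<le> K * C l + K * B l + e/2 * A l"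
      using XK[of "e/2"] by auto
    \<comment> \<open>Two terms K \<epsilon> < e/4 and the term e/2 add up to less than e; the
      summand 1 in the denominator covers K = 0.\<close>
    define \<epsilon> where "\<epsilon> = e / (4 * (K + 1))"
    have \<epsilon>: "\<epsilon> > 0" using e K by (simp add: \<epsilon>_def)
    have K\<epsilon>: "K * \<epsilon> < e/4" using e K by (simp add: \<epsilon>_def field_simps)
    show "\<forall>\<^sub>F l in sequentially. dist (X l / of_real (A l)) \<mu> < e"
      using CB[OF \<epsilon>]
    proof eventually_elim
      case (elim l)
      \<comment> \<open>The strict inequality above a nonnegative length is the source of the
        positive denominator.\<close>
      then have "\<epsilon> * A l > 0" using C0[of l] by linarith
      then have A: "A l > 0" using \<epsilon> by (simp add: zero_less_mult_iff)
      have "norm (X l - \<mu> * of_real (A l)) \<le> K * (\<epsilon> * A l) + K * (\<epsilon> * A l) + e/2 * A l"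
        using K(2)[of l] mult_left_mono[OF less_imp_le[OF conjunct1[OF elim]] K(1)]
          mult_left_mono[OF less_imp_le[OF conjunct2[OF elim]] K(1)] by linarith
      also have "\<dots> = (2 * (K * \<epsilon>) + e/2) * A l" by (simp add: algebra_simps)
      also have "\<dots> < e * A l" using A K\<epsilon> by (intro mult_strict_right_mono) auto
      finally have "norm (X l - \<mu> * of_real (A l)) / A l < e" using A by (simp add: field_simps)
      moreover have "X l / of_real (A l) - \<mu> = (X l - \<mu> * of_real (A l)) / of_real (A l)"
        using A by (simp add: field_simps)
      ultimately show ?case using A by (simp add: dist_norm norm_divide)
    qed
  qed
  have near: "\<exists>K\<ge>0. \<forall>R\<ge>0. norm (disc_int \<eta> g1 g2 R - \<mu> * of_real (disc_integral (energy g1 g2) R))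
     \<le> K * circ_integral (speed g1 g2) R + K * disc_integral (defect p g1 g2) R
        + e * disc_integral (energy g1 g2) R" if "e > 0" for e
    using disc_int_near_mean[OF \<eta> that, of p] g unfolding \<mu>_def by metis
  have "(\<lambda>l. disc_int \<eta> g1 g2 (r l) / of_real (disc_integral (energy g1 g2) (r l))) \<longlonglongrightarrow> \<mu>"
  proof (rule key)
    fix e :: real assume "e > 0"
    from near[OF this] show "\<exists>K\<ge>0. \<forall>l. norm (disc_int \<eta> g1 g2 (r l) - \<mu> * of_real (disc_integral (energy g1 g2) (r l)))
     \<le> K * circ_integral (speed g1 g2) (r l) + K * disc_integral (defect p g1 g2) (r l)
        + e * disc_integral (energy g1 g2) (r l)" using r by blast
  next
    fix \<epsilon> :: real assume "\<epsilon> > 0"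
    from conc[OF this] show "\<forall>\<^sub>F l in sequentially. circ_integral (speed g1 g2) (r l) < \<epsilon> * disc_integral (energy g1 g2) (r l)
       \<and> disc_integral (defect p g1 g2) (r l) < \<epsilon> * disc_integral (energy g1 g2) (r l)"
      by eventually_elim (simp add: concentrated_def)
  qed (intro circ_integral_nonneg ce, auto simp: energy_nonneg r)
  then show "(\<lambda>l. disc_int \<eta> g1 g2 (r l) / of_real (area g1 g2 (r l))) \<longlonglongrightarrow> L2.cell_mean (\<lambda>w. \<eta> 2 2 (p, w))"
    by (simp add: area_def disc_int_omega11[OF g] \<mu>_def)
  have "(\<lambda>l. nev_T \<eta> g1 g2 (r l) / of_real (log_average (disc_integral (energy g1 g2)) (r l))) \<longlonglongrightarrow> \<mu>"
  proof (rule key)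
    fix e :: real assume "e > 0"
    from near[OF this] obtain K where K: "K \<ge> 0" "\<And>R. R \<ge> 0 \<Longrightarrow> norm (disc_int \<eta> g1 g2 R - \<mu> * of_real (disc_integral (energy g1 g2) R))
     \<le> K * circ_integral (speed g1 g2) R + K * disc_integral (defect p g1 g2) R
        + e * disc_integral (energy g1 g2) R" by blast
    from log_disc_int_near_mean[OF \<eta> g r K(2)] K(1)
    show "\<exists>K\<ge>0. \<forall>l. norm (nev_T \<eta> g1 g2 (r l) - \<mu> * of_real (log_average (disc_integral (energy g1 g2)) (r l)))
     \<le> K * log_average (circ_integral (speed g1 g2)) (r l) + K * log_average (disc_integral (defect p g1 g2)) (r l)
        + e * log_average (disc_integral (energy g1 g2)) (r l)" by blast
  next
    fix \<epsilon> :: real assume "\<epsilon> > 0"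
    from conc[OF this] show "\<forall>\<^sub>F l in sequentially. log_average (circ_integral (speed g1 g2)) (r l) < \<epsilon> * log_average (disc_integral (energy g1 g2)) (r l)
       \<and> log_average (disc_integral (defect p g1 g2)) (r l) < \<epsilon> * log_average (disc_integral (energy g1 g2)) (r l)"
      by eventually_elim (simp add: concentrated_def)
  next
    fix l show "0 \<le> log_average (circ_integral (speed g1 g2)) (r l)"
      by (intro log_average_nonneg log_average_circ_integrable circ_integral_nonneg ce) (auto simp: energy_nonneg)
  qed
  then show "(\<lambda>l. nev_T \<eta> g1 g2 (r l) / nev_T omega11 g1 g2 (r l)) \<longlonglongrightarrow> L2.cell_mean (\<lambda>w. \<eta> 2 2 (p, w))"
    by (simp add: nev_T_omega11[OF g] \<mu>_def)
qed

text \<open>The factor is the reciprocal of the area of the period cell of the second lattice, the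
  same for all forms: it turns integration over the fibre into the mean.\<close>

lemma concentrated_vertical:
  assumes g: "g1 holomorphic_on UNIV" "g2 holomorphic_on UNIV"
    and r: "\<And>l. 0 \<le> r l" and conc: "\<And>\<epsilon>. \<epsilon> > 0 \<Longrightarrow> \<forall>\<^sub>F l in sequentially. concentrated g1 g2 p \<epsilon> (r l)"
  obtains c where "c > 0" "\<And>\<eta>. torus_form a1 b1 a2 b2 \<eta> \<Longrightarrow>
      (\<lambda>l. disc_int \<eta> g1 g2 (r l) / of_real (area g1 g2 (r l))) \<longlonglongrightarrow> of_real c * vert_current a2 b2 p \<eta>"
    "\<And>\<eta>. torus_form a1 b1 a2 b2 \<eta> \<Longrightarrow>
      (\<lambda>l. nev_T \<eta> g1 g2 (r l) / nev_T omega11 g1 g2 (r l)) \<longlonglongrightarrow> of_real c * vert_current a2 b2 p \<eta>"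
proof (rule that[of "1 / L2.cell_area"])
  show "1 / L2.cell_area > 0" using L2.cell_area_pos by simp
  have "L2.cell_mean (\<lambda>w. \<eta> 2 2 (p, w)) = of_real (1 / L2.cell_area) * vert_current a2 b2 p \<eta>" for \<eta>
    by (simp add: L2.cell_mean_def vert_current_def)
  then show "(\<lambda>l. disc_int \<eta> g1 g2 (r l) / of_real (area g1 g2 (r l))) \<longlonglongrightarrow> of_real (1 / L2.cell_area) * vert_current a2 b2 p \<eta>"
    "(\<lambda>l. nev_T \<eta> g1 g2 (r l) / nev_T omega11 g1 g2 (r l)) \<longlonglongrightarrow> of_real (1 / L2.cell_area) * vert_current a2 b2 p \<eta>"
    if "torus_form a1 b1 a2 b2 \<eta>" for \<eta>
    using concentrated_limits[OF g r conc that] by metis+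
qed

end

lemma concentrated_produces:
  assumes g: "g1 holomorphic_on UNIV" "g2 holomorphic_on UNIV"
    and r: "\<And>l. 0 \<le> r l" and conc: "\<And>\<epsilon>. \<epsilon> > 0 \<Longrightarrow> \<forall>\<^sub>F l in sequentially. concentrated g1 g2 p \<epsilon> (r l)"
  shows "produces_nev g1 g2 r" "produces_ahl g1 g2 r"
proof -
  note ce = continuous_energy[OF g]
  have key: "(\<lambda>l. C l / A l) \<longlonglongrightarrow> 0"
    if CB: "\<And>\<epsilon>. \<epsilon> > 0 \<Longrightarrow> \<forall>\<^sub>F l in sequentially. C l < \<epsilon> * A l" and C0: "\<And>l. C l \<ge> 0"
    for A C :: "nat \<Rightarrow> real"
  proof (rule tendstoI)
    fix e :: real assume e: "e > 0"
    show "\<forall>\<^sub>F l in sequentially. dist (C l / A l) 0 < e"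
      using CB[OF e]
    proof eventually_elim
      case (elim l)
      then have "e * A l > 0" using C0[of l] by linarith
      then have A: "A l > 0" using e by (simp add: zero_less_mult_iff)
      then show ?case using elim C0[of l] by (simp add: field_simps)
    qed
  qed
  show "produces_nev g1 g2 r"
    unfolding produces_nev_def nev_T_omega11[OF g] nev_L_log_average Re_complex_of_real
  proof (rule key)
    fix \<epsilon> :: real assume "\<epsilon> > 0"
    from conc[OF this] show "\<forall>\<^sub>F l in sequentially. log_average (circ_integral (speed g1 g2)) (r l) < \<epsilon> * log_average (disc_integral (energy g1 g2)) (r l)"
      by eventually_elim (simp add: concentrated_def)
  next
    fix l show "0 \<le> log_average (circ_integral (speed g1 g2)) (r l)"
      by (intro log_average_nonneg log_average_circ_integrable circ_integral_nonneg ce) (auto simp: energy_nonneg)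
  qed
  show "produces_ahl g1 g2 r"
    unfolding produces_ahl_def area_def disc_int_omega11[OF g] bdry_len_circ_integral Re_complex_of_real
  proof (rule key)
    fix \<epsilon> :: real assume "\<epsilon> > 0"
    from conc[OF this] show "\<forall>\<^sub>F l in sequentially. circ_integral (speed g1 g2) (r l) < \<epsilon> * disc_integral (energy g1 g2) (r l)"
      by eventually_elim (simp add: concentrated_def)
  qed (intro circ_integral_nonneg ce, auto simp: energy_nonneg r)
qed

section \<open>Stability of concentration\<close>

text \<open>By the triangle inequality the defect at p exceeds the one at q by at most |q - p| times
  the energy. This carries concentration from a countable dense set to every point.\<close>

lemma concentrated_change_point:
  assumes g: "g1 holomorphic_on UNIV" "g2 holomorphic_on UNIV" and R: "0 \<le> R" and \<epsilon>: "\<epsilon> > 0"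
    and conc: "concentrated g1 g2 q \<epsilon> R"
  shows "concentrated g1 g2 p (\<epsilon> + cmod (q - p)) R"
proof -
  note ce = continuous_energy[OF g]
  define d where "d = cmod (q - p)"
  have d: "d \<ge> 0" by (simp add: d_def)
  have E0: "disc_integral (energy g1 g2) t \<ge> 0" for t
    by (intro disc_integral_nonneg ce) (simp add: energy_nonneg)
  have "defect p g1 g2 z \<le> defect q g1 g2 z + d * energy g1 g2 z" for z
  proof -
    have "cmod (g1 z - p) \<le> cmod (g1 z - q) + d"
      unfolding d_def using norm_triangle_ineq[of "g1 z - q" "q - p"] by simp
    then have "cmod (g1 z - p) * (cmod (deriv g2 z))\<^sup>2 \<le> (cmod (g1 z - q) + d) * (cmod (deriv g2 z))\<^sup>2"
      by (rule mult_right_mono) simp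
    moreover have "d * (cmod (deriv g2 z))\<^sup>2 \<le> d * energy g1 g2 z"
      using d by (intro mult_left_mono) (auto simp: energy_def)
    ultimately show ?thesis by (simp add: defect_def distrib_right)
  qed
  then have B: "disc_integral (defect p g1 g2) t \<le> disc_integral (defect q g1 g2) t + d * disc_integral (energy g1 g2) t" for t
    unfolding disc_integral_cmul[symmetric]
    by (subst disc_integral_add[symmetric], intro ce, intro continuous_intros ce, intro disc_integral_le continuous_intros ce)
  have iE: "(\<lambda>t. (d * disc_integral (energy g1 g2) t) /\<^sub>R t) integrable_on {0..R}"
    unfolding disc_integral_cmul[symmetric] by (intro log_average_disc_integrable continuous_intros ce)
  note i = log_average_disc_integrable[OF ce(1)] log_average_disc_integrable[OF ce(3)]
  have "log_average (disc_integral (defect p g1 g2)) R \<le>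
      log_average (\<lambda>t. disc_integral (defect q g1 g2) t + d * disc_integral (energy g1 g2) t) R"
    by (rule log_average_le[OF i(2) _ B]) (simp only: scaleR_add_right, intro integrable_add i iE)
  also have "\<dots> = log_average (disc_integral (defect q g1 g2)) R + d * log_average (disc_integral (energy g1 g2)) R"
    by (simp only: log_average_add[OF i(2) iE] log_average_cmul)
  finally have B': "log_average (disc_integral (defect p g1 g2)) R \<le> \<dots>" .
  have "0 \<le> d * disc_integral (energy g1 g2) R" "0 \<le> d * log_average (disc_integral (energy g1 g2)) R"
    using d by (auto intro!: mult_nonneg_nonneg E0 log_average_nonneg i)
  then show ?thesis
    using conc B[of R] B' unfolding concentrated_def d_def[symmetric] distrib_right by linarith
qed

lemma concentrated_mono:
  assumes g: "g1 holomorphic_on UNIV" "g2 holomorphic_on UNIV" and R: "0 \<le> R" and le: "\<epsilon> \<le> \<epsilon>'"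
    and conc: "concentrated g1 g2 p \<epsilon> R"
  shows "concentrated g1 g2 p \<epsilon>' R"
proof -
  note ce = continuous_energy[OF g]
  have "disc_integral (energy g1 g2) t \<ge> 0" for t
    by (intro disc_integral_nonneg ce) (simp add: energy_nonneg)
  then have "\<epsilon> * disc_integral (energy g1 g2) R \<le> \<epsilon>' * disc_integral (energy g1 g2) R"
    "\<epsilon> * log_average (disc_integral (energy g1 g2)) R \<le> \<epsilon>' * log_average (disc_integral (energy g1 g2)) R"
    using le by (auto intro!: mult_right_mono log_average_nonneg log_average_disc_integrable[OF ce(1)])
  then show ?thesis using conc unfolding concentrated_def by linarith
qed

text \<open>Cauchy's inequality on the unit circle around z; this is the source of the radius R + 1
  in the stability statements.\<close>

lemma deriv_perturbation:
  assumes "f holomorphic_on UNIV" "g holomorphic_on UNIV"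
    and "\<And>z. z \<in> cball 0 (R + 1) \<Longrightarrow> cmod (f z - g z) \<le> \<delta>" and "z \<in> cball 0 R"
  shows "cmod (deriv f z - deriv g z) \<le> \<delta>"
proof -
  define k where "k = (\<lambda>z. f z - g z)"
  have k: "k holomorphic_on UNIV" unfolding k_def by (intro holomorphic_intros assms)
  have "norm ((deriv ^^ 1) k z) \<le> fact 1 * \<delta> / 1 ^ 1"
  proof (rule Cauchy_inequality)
    show "k holomorphic_on ball z 1" "continuous_on (cball z 1) k"
      using k holomorphic_on_subset holomorphic_on_imp_continuous_on by blast+
    fix x assume "norm (z - x) = 1"
    then have "x \<in> cball 0 (R + 1)"
      using assms(4) norm_triangle_ineq4[of z "z - x"] by simp
    then show "norm (k x) \<le> \<delta>" using assms(3) by (simp add: k_def)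
  qed simp
  moreover have "deriv k z = deriv f z - deriv g z"
    unfolding k_def by (rule deriv_diff) (use assms holomorphic_on_imp_differentiable_at in blast)+
  ultimately show ?thesis by simp
qed

text \<open>Energy, speed and defect are continuous functions \<open>\<Psi>\<close> of the triple
  (g1, g1', g2'), so one uniform continuity argument covers all three. On the disc the triple of the
  reference curve stays in a compact product; the margin 1 in Q makes room for the perturbed
  triple.\<close>

lemma jet_function_perturbation:
  fixes \<Psi> :: "complex \<times> complex \<times> complex \<Rightarrow> real"
  assumes g: "g1 holomorphic_on UNIV" "g2 holomorphic_on UNIV" and \<Psi>: "continuous_on UNIV \<Psi>" and d: "d > 0"
  shows "\<exists>\<delta>>0. \<forall>f1 f2. f1 holomorphic_on UNIV \<longrightarrow> f2 holomorphic_on UNIV \<longrightarrow>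
    (\<forall>z\<in>cball 0 (R + 1). cmod (f1 z - g1 z) \<le> \<delta> \<and> cmod (f2 z - g2 z) \<le> \<delta>) \<longrightarrow>
    (\<forall>z\<in>cball 0 R. \<bar>\<Psi> (f1 z, deriv f1 z, deriv f2 z) - \<Psi> (g1 z, deriv g1 z, deriv g2 z)\<bar> \<le> d)"
proof -
  have cg: "continuous_on UNIV g1" "continuous_on UNIV (deriv g1)" "continuous_on UNIV (deriv g2)"
    using g holomorphic_deriv[of _ UNIV] by (auto intro: holomorphic_on_imp_continuous_on)
  obtain B1 where B1: "\<And>z. z \<in> cball 0 R \<Longrightarrow> norm (g1 z) \<le> B1"
    using continuous_norm_bound_cball[OF cg(1)] by blast
  obtain B2 where B2: "\<And>z. z \<in> cball 0 R \<Longrightarrow> norm (deriv g1 z) \<le> B2"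
    using continuous_norm_bound_cball[OF cg(2)] by blast
  obtain B3 where B3: "\<And>z. z \<in> cball 0 R \<Longrightarrow> norm (deriv g2 z) \<le> B3"
    using continuous_norm_bound_cball[OF cg(3)] by blast
  define Q where "Q = cball (0::complex) (B1 + 1) \<times> cball (0::complex) (B2 + 1) \<times> cball (0::complex) (B3 + 1)"
  have "uniformly_continuous_on Q \<Psi>"
    unfolding Q_def
    by (intro compact_uniformly_continuous compact_Times compact_cball) (use \<Psi> continuous_on_subset in blast)
  then obtain e where e: "e > 0" "\<And>x y. x \<in> Q \<Longrightarrow> y \<in> Q \<Longrightarrow> dist y x < e \<Longrightarrow> dist (\<Psi> y) (\<Psi> x) < d"
    unfolding uniformly_continuous_on_def using d by meson
  \<comment> \<open>The distance of the two triples is at most the sum of three differences of size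
    \<delta>, hence below e; \<delta> \<le> 1 keeps the perturbed triple in Q.\<close>
  define \<delta> where "\<delta> = min 1 (e / 4)"
  have \<delta>: "\<delta> > 0" "\<delta> \<le> 1" "3 * \<delta> < e" using e by (auto simp: \<delta>_def min_def)
  show ?thesis
  proof (intro exI[of _ \<delta>] conjI allI impI ballI \<delta>(1))
    fix f1 f2 :: "complex \<Rightarrow> complex" and z :: complex
    assume f: "f1 holomorphic_on UNIV" "f2 holomorphic_on UNIV"
      and close: "\<forall>z\<in>cball 0 (R + 1). cmod (f1 z - g1 z) \<le> \<delta> \<and> cmod (f2 z - g2 z) \<le> \<delta>"
      and z: "z \<in> cball 0 R"
    have 1: "cmod (f1 z - g1 z) \<le> \<delta>" using close z by auto
    have 2: "cmod (deriv f1 z - deriv g1 z) \<le> \<delta>" "cmod (deriv f2 z - deriv g2 z) \<le> \<delta>"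
      using deriv_perturbation[OF f(1) g(1) _ z] deriv_perturbation[OF f(2) g(2) _ z] close by auto
    let ?x = "(g1 z, deriv g1 z, deriv g2 z)" and ?y = "(f1 z, deriv f1 z, deriv f2 z)"
    have "?x \<in> Q" using B1[OF z] B2[OF z] B3[OF z] by (simp add: Q_def)
    moreover have "?y \<in> Q"
      using B1[OF z] B2[OF z] B3[OF z] 1 2 \<delta>(2) norm_triangle_ineq2[of "f1 z" "g1 z"]
        norm_triangle_ineq2[of "deriv f1 z" "deriv g1 z"] norm_triangle_ineq2[of "deriv f2 z" "deriv g2 z"]
      by (auto simp: Q_def)
    moreover have "dist ?y ?x < e"
    proof -
      have "dist ?y ?x \<le> dist (f1 z) (g1 z) + dist (deriv f1 z, deriv f2 z) (deriv g1 z, deriv g2 z)"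
        unfolding dist_Pair_Pair[of "f1 z"] by (rule sqrt_sum_squares_le_sum) auto
      also have "dist (deriv f1 z, deriv f2 z) (deriv g1 z, deriv g2 z) \<le> dist (deriv f1 z) (deriv g1 z) + dist (deriv f2 z) (deriv g2 z)"
        unfolding dist_Pair_Pair by (rule sqrt_sum_squares_le_sum) auto
      finally show ?thesis using 1 2 \<delta>(3) by (simp add: dist_norm)
    qed
    ultimately have "dist (\<Psi> ?y) (\<Psi> ?x) < d" using e(2) by blast
    then show "\<bar>\<Psi> ?y - \<Psi> ?x\<bar> \<le> d" by (simp add: dist_real_def)
  qed
qed

lemma disc_integral_perturbation:
  assumes "continuous_on UNIV \<phi>" "continuous_on UNIV \<psi>" and t: "0 \<le> t"
    and "\<And>z. z \<in> cball 0 t \<Longrightarrow> \<bar>\<phi> z - \<psi> z\<bar> \<le> d"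
  shows "\<bar>disc_integral \<phi> t - disc_integral \<psi> t\<bar> \<le> d * (pi * t\<^sup>2)"
proof -
  have "norm (disc_integral (\<lambda>z. \<phi> z - \<psi> z) t) \<le> disc_integral (\<lambda>_. d) t"
    by (rule disc_integral_norm_le) (use assms in \<open>auto intro!: continuous_intros\<close>)
  then show ?thesis using disc_integral_diff[OF assms(1,2)] disc_integral_const[OF t] by simp
qed

text \<open>An error of order t becomes constant under the weight 1/t; disc and circle integrals
  both have errors of this order.\<close>

lemma log_average_abs_diff_le:
  assumes i: "(\<lambda>t. F t /\<^sub>R t) integrable_on {0..R}" "(\<lambda>t. G t /\<^sub>R t) integrable_on {0..R}"
    and le: "\<And>t. 0 \<le> t \<Longrightarrow> t \<le> R \<Longrightarrow> \<bar>F t - G t\<bar> \<le> c * t" and R: "0 \<le> (R::real)"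
  shows "\<bar>log_average F R - log_average G R\<bar> \<le> c * R"
proof -
  have "norm (log_average (\<lambda>t. F t - G t) R) \<le> log_average (\<lambda>t. c * t) R"
    by (rule log_average_norm_le) (use le in \<open>auto simp: right_diff_distrib intro!: integrable_diff i[simplified] linear_log_integrable[simplified]\<close>)
  then show ?thesis using log_average_diff[OF i] log_average_linear[OF R] by simp
qed

lemma circ_integral_perturbation:
  assumes c: "continuous_on UNIV \<phi>" "continuous_on UNIV \<psi>" and t: "0 \<le> t"
    and le: "\<And>z. z \<in> cball 0 t \<Longrightarrow> \<bar>\<phi> z - \<psi> z\<bar> \<le> d"
  shows "\<bar>circ_integral \<phi> t - circ_integral \<psi> t\<bar> \<le> 2 * pi * d * t"
proof -
  have "circ_integral (\<lambda>z. \<phi> z - \<psi> z) t \<le> circ_integral (\<lambda>_. d) t"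
    by (rule circ_integral_le) (use c t le in \<open>force intro!: continuous_intros\<close>)+
  moreover have "circ_integral (\<lambda>z. \<psi> z - \<phi> z) t \<le> circ_integral (\<lambda>_. d) t"
    by (rule circ_integral_le) (use c t le in \<open>force intro!: continuous_intros\<close>)+
  ultimately show ?thesis
    by (simp add: circ_integral_diff[OF c] circ_integral_diff[OF c(2,1)] circ_integral_const abs_le_iff algebra_simps)
qed

text \<open>Each of the four strict inequalities has a positive slack, and a small perturbation on
  the larger disc moves every quantity by less than the slack permits.\<close>

lemma concentrated_stable:
  assumes g: "g1 holomorphic_on UNIV" "g2 holomorphic_on UNIV" and R: "R > 0" and \<epsilon>: "\<epsilon> > 0"
    and conc: "concentrated g1 g2 p \<epsilon> R"
  obtains \<delta> where "\<delta> > 0" "\<And>f1 f2. \<lbrakk>f1 holomorphic_on UNIV; f2 holomorphic_on UNIV;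
    \<And>z. z \<in> cball 0 (R + 1) \<Longrightarrow> cmod (f1 z - g1 z) \<le> \<delta> \<and> cmod (f2 z - g2 z) \<le> \<delta>\<rbrakk> \<Longrightarrow>
    concentrated f1 f2 p \<epsilon> R"
proof -
  note ce = continuous_energy[OF g]
  \<comment> \<open>A common factor for all errors: pi R^2 for disc integrals and 2 pi R for circle
    integrals, plain or averaged.\<close>
  define W where "W = pi * R\<^sup>2 + 2 * pi * R"
  have W: "W > 0" unfolding W_def using R by (intro add_pos_pos) auto
  define A where "A = disc_integral (energy g1 g2) R"
  define LA where "LA = log_average (disc_integral (energy g1 g2)) R"
  define C where "C = circ_integral (speed g1 g2) R"
  define LC where "LC = log_average (circ_integral (speed g1 g2)) R"
  define B where "B = disc_integral (defect p g1 g2) R"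
  define LB where "LB = log_average (disc_integral (defect p g1 g2)) R"
  define \<gamma> where "\<gamma> = min (min (\<epsilon> * A - C) (\<epsilon> * A - B)) (min (\<epsilon> * LA - LC) (\<epsilon> * LA - LB))"
  have \<gamma>: "\<gamma> > 0"
    using conc unfolding concentrated_def \<gamma>_def A_def LA_def C_def LC_def B_def LB_def by simp
  \<comment> \<open>Left sides move by at most d W and right sides by at most \<epsilon> d W; this d
    makes the total equal to half the slack \<gamma>.\<close>
  define d where "d = \<gamma> / (2 * (1 + \<epsilon>) * W)"
  have d: "d > 0" using \<gamma> \<epsilon> W by (simp add: d_def)
  have "(1 + \<epsilon>) * (d * W) = \<gamma> / 2"
  proof -
    have "d * W = \<gamma> / (2 * (1 + \<epsilon>))" using W by (simp add: d_def)
    moreover have "1 + \<epsilon> \<noteq> 0" using \<epsilon> by simp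
    ultimately show ?thesis by (simp add: field_simps)
  qed
  then have dW: "(1 + \<epsilon>) * (d * W) < \<gamma>" using \<gamma> by simp
  have cont: "continuous_on UNIV (\<lambda>x::complex \<times> complex \<times> complex. (cmod (fst (snd x)))\<^sup>2 + (cmod (snd (snd x)))\<^sup>2)"
    "continuous_on UNIV (\<lambda>x::complex \<times> complex \<times> complex. sqrt ((cmod (fst (snd x)))\<^sup>2 + (cmod (snd (snd x)))\<^sup>2))"
    "continuous_on UNIV (\<lambda>x::complex \<times> complex \<times> complex. cmod (fst (snd x)) * sqrt ((cmod (fst (snd x)))\<^sup>2 + (cmod (snd (snd x)))\<^sup>2)
       + cmod (fst x - p) * (cmod (snd (snd x)))\<^sup>2)"
    by (intro continuous_intros)+
  obtain \<delta>1 where \<delta>1: "\<delta>1 > 0" "\<forall>f1 f2. f1 holomorphic_on UNIV \<longrightarrow> f2 holomorphic_on UNIV \<longrightarrow>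
    (\<forall>z\<in>cball 0 (R + 1). cmod (f1 z - g1 z) \<le> \<delta>1 \<and> cmod (f2 z - g2 z) \<le> \<delta>1) \<longrightarrow>
    (\<forall>z\<in>cball 0 R. \<bar>energy f1 f2 z - energy g1 g2 z\<bar> \<le> d)"
    using jet_function_perturbation[OF g cont(1) d, of R] unfolding fst_conv snd_conv defect_def energy_def by blast
  obtain \<delta>2 where \<delta>2: "\<delta>2 > 0" "\<forall>f1 f2. f1 holomorphic_on UNIV \<longrightarrow> f2 holomorphic_on UNIV \<longrightarrow>
    (\<forall>z\<in>cball 0 (R + 1). cmod (f1 z - g1 z) \<le> \<delta>2 \<and> cmod (f2 z - g2 z) \<le> \<delta>2) \<longrightarrow>
    (\<forall>z\<in>cball 0 R. \<bar>sqrt (energy f1 f2 z) - sqrt (energy g1 g2 z)\<bar> \<le> d)"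
    using jet_function_perturbation[OF g cont(2) d, of R] unfolding fst_conv snd_conv defect_def energy_def by blast
  obtain \<delta>3 where \<delta>3: "\<delta>3 > 0" "\<forall>f1 f2. f1 holomorphic_on UNIV \<longrightarrow> f2 holomorphic_on UNIV \<longrightarrow>
    (\<forall>z\<in>cball 0 (R + 1). cmod (f1 z - g1 z) \<le> \<delta>3 \<and> cmod (f2 z - g2 z) \<le> \<delta>3) \<longrightarrow>
    (\<forall>z\<in>cball 0 R. \<bar>defect p f1 f2 z - defect p g1 g2 z\<bar> \<le> d)"
    using jet_function_perturbation[OF g cont(3) d, of R] unfolding fst_conv snd_conv defect_def energy_def by blast
  define \<delta> where "\<delta> = min \<delta>1 (min \<delta>2 \<delta>3)"
  show ?thesis
  proof (rule that[of \<delta>])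
    show "\<delta> > 0" using \<delta>1 \<delta>2 \<delta>3 by (simp add: \<delta>_def)
    fix f1 f2
    assume f: "f1 holomorphic_on UNIV" "f2 holomorphic_on UNIV"
      and close: "\<And>z. z \<in> cball 0 (R + 1) \<Longrightarrow> cmod (f1 z - g1 z) \<le> \<delta> \<and> cmod (f2 z - g2 z) \<le> \<delta>"
    note cf = continuous_energy[OF f]
    have close': "\<forall>z\<in>cball 0 (R + 1). cmod (f1 z - g1 z) \<le> \<delta>' \<and> cmod (f2 z - g2 z) \<le> \<delta>'" if "\<delta> \<le> \<delta>'" for \<delta>'
      using close that by force
    have e1: "\<bar>energy f1 f2 z - energy g1 g2 z\<bar> \<le> d" if "z \<in> cball 0 R" for z
      using \<delta>1(2) f close'[of \<delta>1] that unfolding \<delta>_def by auto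
    have e2: "\<bar>sqrt (energy f1 f2 z) - sqrt (energy g1 g2 z)\<bar> \<le> d" if "z \<in> cball 0 R" for z
      using \<delta>2(2) f close'[of \<delta>2] that unfolding \<delta>_def by auto
    have e3: "\<bar>defect p f1 f2 z - defect p g1 g2 z\<bar> \<le> d" if "z \<in> cball 0 R" for z
      using \<delta>3(2) f close'[of \<delta>3] that unfolding \<delta>_def by auto
    \<comment> \<open>The quadratic error is weakened to one linear in t, the shape required under
      the weight 1/t.\<close>
    have t2: "d * (pi * t\<^sup>2) \<le> d * pi * R * t" if "0 \<le> t" "t \<le> R" for t
    proof -
      have "t * t \<le> R * t" using that by (intro mult_right_mono)
      then have "(d * pi) * (t * t) \<le> (d * pi) * (R * t)" using d by (intro mult_left_mono) auto
      then show ?thesis by (simp add: power2_eq_square mult.assoc)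
    qed
    have dRR: "d * (pi * R\<^sup>2) \<le> d * W" "2 * pi * d * R \<le> d * W" "d * pi * R * R \<le> d * W"
      using d R by (auto simp: W_def algebra_simps power2_eq_square)
    have A': "\<bar>disc_integral (energy f1 f2) R - A\<bar> \<le> d * W"
      unfolding A_def by (rule order_trans[OF disc_integral_perturbation[OF cf(1) ce(1) _ e1] dRR(1)]) (use R in auto)
    have B': "\<bar>disc_integral (defect p f1 f2) R - B\<bar> \<le> d * W"
      unfolding B_def by (rule order_trans[OF disc_integral_perturbation[OF cf(3) ce(3) _ e3] dRR(1)]) (use R in auto)
    have C': "\<bar>circ_integral (speed f1 f2) R - C\<bar> \<le> d * W"
      unfolding C_def by (rule order_trans[OF circ_integral_perturbation[OF cf(2) ce(2) _ e2] dRR(2)]) (use R in auto)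
    have LA': "\<bar>log_average (disc_integral (energy f1 f2)) R - LA\<bar> \<le> d * W"
      unfolding LA_def
    proof (rule order_trans[OF log_average_abs_diff_le dRR(3)])
      show "\<bar>disc_integral (energy f1 f2) t - disc_integral (energy g1 g2) t\<bar> \<le> d * pi * R * t" if "0 \<le> t" "t \<le> R" for t
        by (rule order_trans[OF disc_integral_perturbation[OF cf(1) ce(1) that(1) e1] t2[OF that]]) (use that in auto)
    qed (use R in \<open>auto simp del: real_scaleR_def intro!: log_average_disc_integrable ce cf\<close>)
    have LB': "\<bar>log_average (disc_integral (defect p f1 f2)) R - LB\<bar> \<le> d * W"
      unfolding LB_def
    proof (rule order_trans[OF log_average_abs_diff_le dRR(3)])
      show "\<bar>disc_integral (defect p f1 f2) t - disc_integral (defect p g1 g2) t\<bar> \<le> d * pi * R * t" if "0 \<le> t" "t \<le> R" for t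
        by (rule order_trans[OF disc_integral_perturbation[OF cf(3) ce(3) that(1) e3] t2[OF that]]) (use that in auto)
    qed (use R in \<open>auto simp del: real_scaleR_def intro!: log_average_disc_integrable ce cf\<close>)
    have LC': "\<bar>log_average (circ_integral (speed f1 f2)) R - LC\<bar> \<le> d * W"
      unfolding LC_def
    proof (rule order_trans[OF log_average_abs_diff_le dRR(2)])
      show "\<bar>circ_integral (speed f1 f2) t - circ_integral (speed g1 g2) t\<bar> \<le> 2 * pi * d * t"
        if "0 \<le> t" "t \<le> R" for t
        by (rule circ_integral_perturbation[OF cf(2) ce(2) that(1) e2]) (use that in auto)
    qed (use R in \<open>auto simp del: real_scaleR_def intro!: log_average_circ_integrable ce cf\<close>)
    have key: "X' < \<epsilon> * Y'" if "\<bar>X' - X\<bar> \<le> d * W" "\<bar>Y' - Y\<bar> \<le> d * W" "\<gamma> \<le> \<epsilon> * Y - X" for X X' Y Y'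
    proof -
      have "\<epsilon> * (Y - d * W) \<le> \<epsilon> * Y'" using that(2) \<epsilon> by (intro mult_left_mono) auto
      then show ?thesis using that(1,3) dW by (simp add: algebra_simps)
    qed
    show "concentrated f1 f2 p \<epsilon> R"
      unfolding concentrated_def
      by (intro conjI key[OF C' A'] key[OF B' A'] key[OF LC' LA'] key[OF LB' LA']) (simp_all add: \<gamma>_def)
  qed
qed

section \<open>Creating concentration\<close>

text \<open>Here u, v and w stand for |g1'|, |g2'| and |g1 - q|. If w is small, Young's inequality
  absorbs the product of u and the speed; otherwise v is bounded, the situation far from the peak.
  Either way a constant plus a small multiple of the energy remains.\<close>

lemma defect_pointwise_bound:
  fixes u v w M \<epsilon> :: real
  assumes "0 \<le> u" "u \<le> M" "0 \<le> v" "0 \<le> w" "w \<le> M" "\<epsilon> > 0" and cases: "w \<le> \<epsilon> \<or> v \<le> M + 1"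
  shows "u * sqrt (u\<^sup>2 + v\<^sup>2) + w * v\<^sup>2 \<le> M\<^sup>2 / (4 * \<epsilon>) + M * (2 * M + 1) + M * (M + 1)\<^sup>2 + 2 * \<epsilon> * (u\<^sup>2 + v\<^sup>2)"
proof -
  define s where "s = sqrt (u\<^sup>2 + v\<^sup>2)"
  have s: "s \<ge> 0" "s\<^sup>2 = u\<^sup>2 + v\<^sup>2" by (auto simp: s_def)
  have su: "s \<le> u + v" unfolding s_def using assms by (intro sqrt_sum_squares_le_sum) auto
  have M: "M \<ge> 0" using assms by linarith
  from cases show ?thesis
  proof
    assume w: "w \<le> \<epsilon>"
    have "u * s \<le> M * s" using assms s by (intro mult_right_mono) auto
    \<comment> \<open>Young's inequality, by completing the square.\<close>
    also have "M * s \<le> M\<^sup>2 / (4 * \<epsilon>) + \<epsilon> * s\<^sup>2"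
    proof -
      have "0 \<le> (M - 2 * \<epsilon> * s)\<^sup>2 / (4 * \<epsilon>)" using assms by simp
      also have "\<dots> = M\<^sup>2 / (4 * \<epsilon>) + \<epsilon> * s\<^sup>2 - M * s"
        using assms(6) by (simp add: power2_eq_square field_simps)
      finally show ?thesis by simp
    qed
    finally have 1: "u * s \<le> M\<^sup>2 / (4 * \<epsilon>) + \<epsilon> * s\<^sup>2" .
    have "w * v\<^sup>2 \<le> \<epsilon> * s\<^sup>2" using w assms s by (intro mult_mono) auto
    moreover have "0 \<le> M * (2 * M + 1) + M * (M + 1)\<^sup>2" using M by simp
    ultimately show ?thesis using 1 unfolding s_def[symmetric] unfolding s(2)[symmetric] by linarith
  next
    assume v: "v \<le> M + 1"
    have 1: "u * s \<le> M * (2 * M + 1)" using assms su v s by (intro mult_mono) auto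
    have 2: "w * v\<^sup>2 \<le> M * (M + 1)\<^sup>2" using assms v M by (intro mult_mono power_mono) auto
    have "0 \<le> M\<^sup>2 / (4 * \<epsilon>)" "0 \<le> 2 * \<epsilon> * s\<^sup>2" using assms by auto
    then show ?thesis using 1 2 unfolding s_def[symmetric] unfolding s(2)[symmetric] by linarith
  qed
qed

text \<open>The disc of radius 1/N inside the disc of radius t, tangent to its circle at the real
  point t, lies to the right of Re z = r - 3/N. There the integrand is at least (A N exp(-3))^2, and
  the area pi/N^2 cancels the powers of N, so that only the height A remains.\<close>

lemma disc_integral_exp_lower_bound:
  fixes r N t A :: real
  assumes N: "N > 0" and t: "r - 1 / N \<le> t" "t \<le> r" "1 / N \<le> t" and A: "A \<ge> 0"
  shows "pi * exp (-6) * A\<^sup>2 \<le> disc_integral (\<lambda>z. (A * N * exp (N * (Re z - r)))\<^sup>2) t"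
proof -
  define c where "c = complex_of_real (t - 1 / N)"
  have cont: "continuous_on UNIV (\<lambda>z. (A * N * exp (N * (Re z - r)))\<^sup>2)"
    by (intro continuous_intros)
  have sub: "ball c (1 / N) \<subseteq> ball 0 t"
  proof
    fix z assume "z \<in> ball c (1 / N)"
    then have "cmod (z - c) < 1 / N" by (simp add: dist_norm norm_minus_commute)
    moreover have "cmod c = t - 1 / N" unfolding c_def norm_of_real using t by simp
    ultimately show "z \<in> ball 0 t" using norm_triangle_ineq[of "z - c" c] by simp
  qed
  have "pi * exp (-6) * A\<^sup>2 = (A * N * exp (-3))\<^sup>2 * (pi * (1 / N)\<^sup>2)"
    using N by (simp add: power_mult_distrib power2_eq_square field_simps flip: exp_add)
  also have "pi * (1 / N)\<^sup>2 = integral (ball c (1 / N)) (\<lambda>_. 1)"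
    using lmeasure_integral[of "ball c (1 / N)"] content_ball[of "1 / N" c] N by (simp add: unit_ball_vol_2)
  also have "(A * N * exp (-3))\<^sup>2 * \<dots> = integral (ball c (1 / N)) (\<lambda>_. (A * N * exp (-3))\<^sup>2 * 1)"
    by (simp only: integral_mult_right)
  also have "\<dots> \<le> integral (ball c (1 / N)) (\<lambda>z. (A * N * exp (N * (Re z - r)))\<^sup>2)"
  proof (rule integral_le)
    show "(\<lambda>_. (A * N * exp (-3))\<^sup>2 * 1) integrable_on ball c (1 / N)"
      "(\<lambda>z. (A * N * exp (N * (Re z - r)))\<^sup>2) integrable_on ball c (1 / N)"
      by (rule set_lebesgue_integral_eq_integral(1), rule continuous_absolutely_integrable_bounded;
          auto intro!: continuous_intros)+
    fix z assume "z \<in> ball c (1 / N)"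
    then have "cmod (c - z) < 1 / N" by (simp add: dist_norm)
    then have "Re c - Re z < 1 / N" using complex_Re_le_cmod[of "c - z"] by simp
    then have "Re z - r \<ge> - (3 / N)" using t by (simp add: c_def field_simps)
    then have "N * (Re z - r) \<ge> N * (- (3 / N))" using N by (intro mult_left_mono) auto
    then have "N * (Re z - r) \<ge> - 3" using N by simp
    then show "(A * N * exp (-3))\<^sup>2 * 1 \<le> (A * N * exp (N * (Re z - r)))\<^sup>2"
      using A N by (simp add: power_mono mult_left_mono)
  qed
  also have "\<dots> \<le> integral (ball 0 t) (\<lambda>z. (A * N * exp (N * (Re z - r)))\<^sup>2)"
    by (rule integral_subset_le[OF sub])
      (auto intro!: continuous_integrable_on_ball cont set_lebesgue_integral_eq_integral(1)
        continuous_absolutely_integrable_bounded)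
  finally show ?thesis by (simp add: disc_integral_def)
qed

text \<open>Only the last window, of length 1/N, is used; there the weight 1/t is at least
  1/r.\<close>

lemma log_average_lower_bound:
  assumes i: "(\<lambda>t. F t /\<^sub>R t) integrable_on {0..r}" and F: "\<And>t. 0 \<le> t \<Longrightarrow> F t \<ge> (0::real)"
    and N: "N > 0" "1 / N < r" and V: "V \<ge> 0" "\<And>t. r - 1 / N \<le> t \<Longrightarrow> t \<le> r \<Longrightarrow> F t \<ge> V"
  shows "V / (r * N) \<le> log_average F r"
proof -
  have r: "r > 0" using N by (meson less_trans zero_less_divide_1_iff)
  have i': "(\<lambda>t. F t /\<^sub>R t) integrable_on {r - 1 / N..r}"
    by (rule integrable_on_subinterval[OF i]) (use N r in \<open>auto simp: field_simps\<close>)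
  have "V / (r * N) = integral {r - 1 / N..r} (\<lambda>_. V / r)"
    using N r by (simp add: field_simps)
  also have "\<dots> \<le> integral {r - 1 / N..r} (\<lambda>t. F t /\<^sub>R t)"
  proof (rule integral_le[OF _ i'])
    fix t assume t: "t \<in> {r - 1 / N..r}"
    then have "t > 0" "t \<le> r" using N by auto
    then have "V / r \<le> F t / t" using V(2)[of t] t V(1) by (intro frac_le) auto
    then show "V / r \<le> F t /\<^sub>R t" by (simp add: divide_inverse mult.commute)
  qed auto
  also have "\<dots> \<le> integral {0..r} (\<lambda>t. F t /\<^sub>R t)"
    by (rule integral_subset_le[OF _ i' i]) (use N F in auto)
  finally show ?thesis by (simp add: log_average_def)
qed

text \<open>The first function is corrected by a monomial so that it takes the value \<open>q\<close> at \<open>r\<close>; the second one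
  is given a peak \<open>N\<^sup>4 exp (N (z - r))\<close>, whose energy on the disc of radius \<open>r\<close> sits near \<open>r\<close>.\<close>

lemma concentrated_approximation:
  assumes g: "g1 holomorphic_on UNIV" "g2 holomorphic_on UNIV" and \<epsilon>: "\<epsilon> > 0" and \<delta>: "\<delta> > 0" and R0: "R0 > 0"
  obtains h1 h2 r where "h1 holomorphic_on UNIV" "h2 holomorphic_on UNIV" "r > R0"
    "\<And>z. z \<in> cball 0 R0 \<Longrightarrow> cmod (h1 z - g1 z) \<le> \<delta> \<and> cmod (h2 z - g2 z) \<le> \<delta>"
    "concentrated h1 h2 q \<epsilon> r"
proof -
  \<comment> \<open>The gap 1 bounds the peak by N^4 exp(-N) on the smaller disc, and r > R0 makes
    high powers of z / r small there.\<close>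
  define r where "r = R0 + 1"
  have r: "r > 1" "r > R0" using R0 by (auto simp: r_def)
  define c where "c = q - g1 (of_real r)"
  have "(\<lambda>n. cmod c * (R0 / r) ^ n) \<longlonglongrightarrow> cmod c * 0"
    using R0 r by (intro tendsto_intros LIMSEQ_realpow_zero) auto
  then have "\<forall>\<^sub>F n in sequentially. cmod c * (R0 / r) ^ n < \<delta>"
    using \<delta> by (auto dest!: order_tendstoD(2))
  then obtain n where n: "cmod c * (R0 / r) ^ n < \<delta>"
    unfolding eventually_sequentially by blast
  define h1 where "h1 = (\<lambda>z. g1 z + c * (z / of_real r) ^ n)"
  have h1: "h1 holomorphic_on UNIV"
    unfolding h1_def using r by (intro holomorphic_intros g) auto
  have h1r: "h1 (of_real r) = q" using r by (simp add: h1_def c_def)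
  have h1_close: "cmod (h1 z - g1 z) \<le> \<delta>" if "z \<in> cball 0 R0" for z
  proof -
    have "cmod (h1 z - g1 z) = cmod c * (cmod z / r) ^ n"
      using r by (simp add: h1_def norm_mult norm_power norm_divide)
    also have "\<dots> \<le> cmod c * (R0 / r) ^ n"
      using that r by (intro mult_left_mono power_mono divide_right_mono) auto
    finally show ?thesis using n by simp
  qed
  have cont: "continuous_on UNIV h1" "continuous_on UNIV (deriv h1)" "continuous_on UNIV (deriv g2)"
    using h1 g holomorphic_deriv[of _ UNIV] by (auto intro: holomorphic_on_imp_continuous_on)
  obtain M1 where M1: "M1 > 0" "\<And>z. z \<in> cball 0 r \<Longrightarrow> norm (deriv h1 z) \<le> M1"
    using continuous_norm_bound_cball[OF cont(2)] by blast
  obtain M2 where M2: "M2 > 0" "\<And>z. z \<in> cball 0 r \<Longrightarrow> norm (deriv g2 z) \<le> M2"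
    using continuous_norm_bound_cball[OF cont(3)] by blast
  have cont_q: "continuous_on UNIV (\<lambda>z. h1 z - q)" by (intro continuous_intros cont)
  obtain M3 where M3: "M3 > 0" "\<And>z. z \<in> cball 0 r \<Longrightarrow> norm (h1 z - q) \<le> M3"
    using continuous_norm_bound_cball[OF cont_q] by blast
  define M where "M = M1 + M2 + M3"
  have M: "M > 0" "\<And>z. z \<in> cball 0 r \<Longrightarrow> norm (deriv h1 z) \<le> M"
    "\<And>z. z \<in> cball 0 r \<Longrightarrow> norm (deriv g2 z) \<le> M" "\<And>z. z \<in> cball 0 r \<Longrightarrow> norm (h1 z - q) \<le> M"
    using M1 M2 M3 unfolding M_def by fastforce+
  \<comment> \<open>The pointwise bound returns 2 \<epsilon>1 = \<epsilon>/2 times the energy, so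
    the other half of \<epsilon> is left to absorb the constant K.\<close>
  define \<epsilon>1 where "\<epsilon>1 = \<epsilon> / 4"
  have \<epsilon>1: "\<epsilon>1 > 0" using \<epsilon> by (simp add: \<epsilon>1_def)
  have "isCont h1 (of_real r)"
    using cont(1) by (simp add: continuous_on_eq_continuous_at)
  then obtain \<rho> where \<rho>: "\<rho> > 0" "\<And>z. cmod (z - of_real r) < \<rho> \<Longrightarrow> cmod (h1 z - q) < \<epsilon>1"
    unfolding continuous_at_eps_delta dist_norm h1r using \<epsilon>1 by blast
  \<comment> \<open>Expanding |z - r|^2 shows that points of the disc at distance at least \<rho>
    from r have real part at most r - \<kappa>. There the derivative of the peak is at most N^5
    exp(-\<kappa> N).\<close>
  define \<kappa> where "\<kappa> = \<rho>\<^sup>2 / (2 * r)"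
  have \<kappa>: "\<kappa> > 0" using \<rho> r by (simp add: \<kappa>_def)
  have away: "Re z - r \<le> - \<kappa>" if "z \<in> cball 0 r" "\<not> cmod (z - of_real r) < \<rho>" for z
  proof -
    have "\<rho>\<^sup>2 \<le> (cmod (z - of_real r))\<^sup>2" using that \<rho> by (intro power_mono) auto
    also have "\<dots> = (cmod z)\<^sup>2 - 2 * r * Re z + r\<^sup>2"
      unfolding cmod_power2 by (simp add: power2_eq_square algebra_simps)
    also have "\<dots> \<le> r\<^sup>2 - 2 * r * Re z + r\<^sup>2" using that r by (simp add: power_mono)
    also have "\<dots> = 2 * r * (r - Re z)" by (simp add: power2_eq_square algebra_simps)
    finally show ?thesis using r by (simp add: \<kappa>_def field_simps)
  qed
  define K where "K = M\<^sup>2 / (4 * \<epsilon>1) + M * (2 * M + 1) + M * (M + 1)\<^sup>2"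
  have K: "K > 0" unfolding K_def using M \<epsilon>1 by (intro add_pos_pos) auto
  \<comment> \<open>The peak is added to an old derivative of size at most M. Separating the two
    keeps half of the squared peak, hence half of the constant pi exp(-6), and loses M^2 over the
    disc, which is C0.\<close>
  define c0 where "c0 = pi * exp (-6) / 2"
  have c0: "c0 > 0" by (simp add: c0_def)
  define C0 where "C0 = M\<^sup>2 * (pi * r\<^sup>2)"
  \<comment> \<open>Everything now compares orders of growth in N, as M, K and \<kappa> are already
    fixed: the averaged energy has a lower bound of order N^7, the speed an upper bound of order
    N^5, and the other terms are constant or decay exponentially.\<close>
  have "\<forall>\<^sub>F N in at_top. N ^ 4 * exp (- N) < \<delta>" using \<delta> by real_asymp
  moreover have "\<forall>\<^sub>F N in at_top. N ^ 5 * exp (- \<kappa> * N) < 1" using \<kappa> by real_asymp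
  moreover have "\<forall>\<^sub>F N in at_top. 2 * pi * r * (2 * M + N ^ 5) < \<epsilon> * ((c0 * N ^ 8 - C0) / (r * N))"
    using \<epsilon> c0 r by real_asymp
  moreover have "\<forall>\<^sub>F N in at_top. K * pi * r * r < \<epsilon> / 2 * ((c0 * N ^ 8 - C0) / (r * N))"
    using \<epsilon> c0 r by real_asymp
  moreover have "\<forall>\<^sub>F N :: real in at_top. N > 2" by real_asymp
  ultimately have "\<forall>\<^sub>F N in at_top. N ^ 4 * exp (- N) < \<delta> \<and> N ^ 5 * exp (- \<kappa> * N) < 1 \<and>
      2 * pi * r * (2 * M + N ^ 5) < \<epsilon> * ((c0 * N ^ 8 - C0) / (r * N)) \<and>
      K * pi * r * r < \<epsilon> / 2 * ((c0 * N ^ 8 - C0) / (r * N)) \<and> N > 2"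
    by eventually_elim blast
  then obtain N where "N ^ 4 * exp (- N) < \<delta> \<and> N ^ 5 * exp (- \<kappa> * N) < 1 \<and>
      2 * pi * r * (2 * M + N ^ 5) < \<epsilon> * ((c0 * N ^ 8 - C0) / (r * N)) \<and>
      K * pi * r * r < \<epsilon> / 2 * ((c0 * N ^ 8 - C0) / (r * N)) \<and> N > 2"
    unfolding eventually_at_top_linorder by blast
  then have N: "N ^ 4 * exp (- N) < \<delta>" "N ^ 5 * exp (- \<kappa> * N) < 1"
      "2 * pi * r * (2 * M + N ^ 5) < \<epsilon> * ((c0 * N ^ 8 - C0) / (r * N))"
      "K * pi * r * r < \<epsilon> / 2 * ((c0 * N ^ 8 - C0) / (r * N))" "N > 2"
    by auto
  define h2 where "h2 = (\<lambda>z. g2 z + of_real (N ^ 4) * exp (of_real N * (z - of_real r)))"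
  define P where "P = (\<lambda>z. N ^ 4 * N * exp (N * (Re z - r)))"
  have h2: "h2 holomorphic_on UNIV" unfolding h2_def by (intro holomorphic_intros g)
  have dh2: "deriv h2 z = deriv g2 z + of_real (N ^ 4 * N) * exp (of_real N * (z - of_real r))" for z
    unfolding h2_def
    by (rule DERIV_imp_deriv) (auto intro!: derivative_eq_intros holomorphic_derivI[OF g(2)])
  have nexp: "cmod (of_real x * exp (of_real N * (z - of_real r))) = x * exp (N * (Re z - r))" if "x \<ge> 0" for x z
    using that by (simp add: norm_mult norm_exp_eq_Re)
  have P0: "P z > 0" for z using N(5) by (simp add: P_def)
  have nP: "cmod (of_real (N ^ 4 * N) * exp (of_real N * (z - of_real r))) = P z" for z
    unfolding P_def using N(5) by (intro nexp) auto
  have vP: "cmod (deriv h2 z) \<le> M + P z" "P z \<le> cmod (deriv h2 z) + M" if "z \<in> cball 0 r" for z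
    using norm_triangle_ineq[of "deriv g2 z" "of_real (N ^ 4 * N) * exp (of_real N * (z - of_real r))"]
      norm_diff_ineq[of "of_real (N ^ 4 * N) * exp (of_real N * (z - of_real r))" "deriv g2 z"] M(3)[OF that]
    unfolding dh2 nP by (auto simp: add.commute)
  have h2_close: "cmod (h2 z - g2 z) \<le> \<delta>" if "z \<in> cball 0 R0" for z
  proof -
    have "Re z - r \<le> - 1" using that complex_Re_le_cmod[of z] by (simp add: r_def)
    then have "N * (Re z - r) \<le> N * (-1)" using N by (intro mult_left_mono) auto
    then have "N ^ 4 * exp (N * (Re z - r)) \<le> N ^ 4 * exp (- N)" by (intro mult_left_mono) auto
    moreover have "cmod (h2 z - g2 z) = N ^ 4 * exp (N * (Re z - r))"
      unfolding h2_def using nexp[of "N ^ 4" z] by simp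
    ultimately show ?thesis using N(1) by linarith
  qed
  note ce = continuous_energy[OF h1 h2]
  have defect_le: "defect q h1 h2 z \<le> K + \<epsilon> / 2 * energy h1 h2 z" if z: "z \<in> cball 0 r" for z
  proof -
    have "cmod (h1 z - q) \<le> \<epsilon>1 \<or> cmod (deriv h2 z) \<le> M + 1"
    proof (cases "cmod (z - of_real r) < \<rho>")
      case True then show ?thesis using \<rho>(2) by force
    next
      case False
      then have "N * (Re z - r) \<le> N * (- \<kappa>)" using away[OF z] N by (intro mult_left_mono) auto
      then have "P z \<le> N ^ 4 * N * exp (- \<kappa> * N)"
        unfolding P_def using N(5) by (intro mult_left_mono) (auto simp: mult.commute)
      also have "\<dots> = N ^ 5 * exp (- \<kappa> * N)" by (simp add: eval_nat_numeral)
      finally have "P z \<le> 1" using N(2) by linarith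
      then show ?thesis using vP(1)[OF z] by linarith
    qed
    then show ?thesis
      using defect_pointwise_bound[of "cmod (deriv h1 z)" M "cmod (deriv h2 z)" "cmod (h1 z - q)" \<epsilon>1] M(2,4)[OF z] \<epsilon>1
      by (simp add: defect_def energy_def K_def \<epsilon>1_def)
  qed
  have sqrt_le: "sqrt (energy h1 h2 z) \<le> 2 * M + N ^ 5" if z: "z \<in> cball 0 r" for z
  proof -
    have "sqrt (energy h1 h2 z) \<le> cmod (deriv h1 z) + cmod (deriv h2 z)"
      unfolding energy_def by (rule sqrt_sum_squares_le_sum) auto
    moreover have "P z \<le> N ^ 5"
    proof -
      have "Re z \<le> r" using complex_Re_le_cmod[of z] z by simp
      then have "exp (N * (Re z - r)) \<le> 1" using N by (simp add: mult_nonneg_nonpos)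
      then have "P z \<le> N ^ 4 * N * 1" unfolding P_def using N by (intro mult_left_mono) auto
      then show ?thesis by (simp add: eval_nat_numeral)
    qed
    ultimately show ?thesis using M(2)[OF z] vP(1)[OF z] by linarith
  qed
  have energy_ge: "(P z)\<^sup>2 / 2 - M\<^sup>2 \<le> energy h1 h2 z" if z: "z \<in> cball 0 r" for z
  proof -
    have "(P z)\<^sup>2 \<le> (cmod (deriv h2 z) + M)\<^sup>2" using vP(2)[OF z] P0[of z] by (intro power_mono) auto
    also have "\<dots> \<le> 2 * (cmod (deriv h2 z))\<^sup>2 + 2 * M\<^sup>2"
      using zero_le_power2[of "cmod (deriv h2 z) - M"] by (simp add: power2_eq_square algebra_simps)
    finally show ?thesis
      using zero_le_power2[of "cmod (deriv h1 z)"] unfolding energy_def by linarith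
  qed
  have cP: "continuous_on UNIV P" unfolding P_def by (intro continuous_intros)
  define V where "V = c0 * N ^ 8 - C0"
  have V: "V > 0"
  proof -
    have "0 < K * pi * r * r" using K r by simp
    then have "0 < \<epsilon> / 2 * (V / (r * N))" using N(4) unfolding V_def by linarith
    then have "0 < V / (r * N)" by (rule zero_less_mult_pos) (use \<epsilon> in simp)
    moreover have "0 < r * N" using r N(5) by simp
    ultimately show ?thesis by (simp only: zero_less_divide_iff) linarith
  qed
  \<comment> \<open>With r > 1 this gives t \<ge> 1/N throughout the last window, so that the disc
    of radius 1/N fits into the disc of radius t.\<close>
  have N1: "1 / N < 1 / 2" using N(5) by (simp add: field_simps)
  have E_ge: "V \<le> disc_integral (energy h1 h2) t" if t: "r - 1 / N \<le> t" "t \<le> r" for t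
  proof -
    have t0: "t \<ge> 0" "1 / N \<le> t" using t r N1 by linarith+
    have "pi * exp (-6) * (N ^ 4)\<^sup>2 \<le> disc_integral (\<lambda>z. (P z)\<^sup>2) t"
      unfolding P_def by (rule disc_integral_exp_lower_bound) (use N t t0 in auto)
    moreover have "disc_integral (\<lambda>z. 1/2 * (P z)\<^sup>2 - M\<^sup>2) t = 1/2 * disc_integral (\<lambda>z. (P z)\<^sup>2) t - M\<^sup>2 * (pi * t\<^sup>2)"
      by (subst disc_integral_diff, intro continuous_intros cP, intro continuous_intros, simp only: disc_integral_cmul disc_integral_const[OF t0(1)])
    moreover have "disc_integral (\<lambda>z. 1/2 * (P z)\<^sup>2 - M\<^sup>2) t \<le> disc_integral (energy h1 h2) t"
      by (rule disc_integral_le) (use energy_ge t in \<open>force intro!: continuous_intros cP ce\<close>)+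
    moreover have "M\<^sup>2 * (pi * t\<^sup>2) \<le> C0"
      unfolding C0_def using t t0 by (intro mult_left_mono power_mono) auto
    ultimately show ?thesis unfolding V_def c0_def by (simp add: power_mult[symmetric])
  qed
  have N1r: "1 / N < r" using N1 r by linarith
  have LE_ge: "V / (r * N) \<le> log_average (disc_integral (energy h1 h2)) r"
    by (rule log_average_lower_bound[OF log_average_disc_integrable[OF ce(1)]])
      (use N(5) V N1r E_ge in \<open>auto intro!: disc_integral_nonneg ce energy_nonneg\<close>)
  \<comment> \<open>The lower bound for the averaged energy is thus one for the plain energy as
    well, and the same two inequalities for N serve all four conditions.\<close>
  have Vle: "V / (r * N) \<le> V"
  proof -
    have "1 * 1 \<le> r * N" using r N by (intro mult_mono) auto
    then show ?thesis using V by (simp add: divide_le_eq)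
  qed
  have E_r: "V \<le> disc_integral (energy h1 h2) r" using E_ge[of r] N by simp
  have C_le: "circ_integral (speed h1 h2) t \<le> 2 * pi * (2 * M + N ^ 5) * t" if t: "0 \<le> t" "t \<le> r" for t
  proof -
    have "circ_integral (speed h1 h2) t \<le> circ_integral (\<lambda>_. 2 * M + N ^ 5) t"
      by (rule circ_integral_le) (use t sqrt_le in \<open>auto intro!: ce\<close>)
    then show ?thesis by (simp add: circ_integral_const algebra_simps)
  qed
  have B_le: "disc_integral (defect q h1 h2) t \<le> K * pi * r * t + \<epsilon> / 2 * disc_integral (energy h1 h2) t" if t: "0 \<le> t" "t \<le> r" for t
  proof -
    have "disc_integral (defect q h1 h2) t \<le> disc_integral (\<lambda>z. K + \<epsilon> / 2 * energy h1 h2 z) t"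
      by (rule disc_integral_le) (use t defect_le in \<open>force intro!: continuous_intros ce\<close>)+
    also have "\<dots> = K * (pi * t\<^sup>2) + \<epsilon> / 2 * disc_integral (energy h1 h2) t"
      by (subst disc_integral_add, intro continuous_intros, intro continuous_intros ce,
          simp only: disc_integral_cmul disc_integral_const[OF t(1)])
    also have "K * (pi * t\<^sup>2) \<le> K * pi * r * t"
    proof -
      have "K * pi * (t * t) \<le> K * pi * (r * t)" using t K by (intro mult_left_mono mult_right_mono) auto
      then show ?thesis by (simp add: power2_eq_square mult.assoc)
    qed
    finally show ?thesis by simp
  qed
  have LC: "log_average (circ_integral (speed h1 h2)) r \<le> 2 * pi * (2 * M + N ^ 5) * r"
    by (subst log_average_linear[symmetric])
      (use r log_average_le[OF log_average_circ_integrable[OF ce(2)] linear_log_integrable C_le] in auto)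
  have LB: "log_average (disc_integral (defect q h1 h2)) r \<le> K * pi * r * r + \<epsilon> / 2 * log_average (disc_integral (energy h1 h2)) r"
  proof -
    have i: "(\<lambda>t. (\<epsilon> / 2 * disc_integral (energy h1 h2) t) /\<^sub>R t) integrable_on {0..r}"
      unfolding disc_integral_cmul[symmetric] by (intro log_average_disc_integrable continuous_intros ce)
    have "log_average (disc_integral (defect q h1 h2)) r \<le> log_average (\<lambda>t. K * pi * r * t + \<epsilon> / 2 * disc_integral (energy h1 h2) t) r"
      by (rule log_average_le[OF log_average_disc_integrable[OF ce(3)] _ B_le])
        (simp only: scaleR_add_right, intro integrable_add i linear_log_integrable)
    also have "\<dots> = K * pi * r * r + \<epsilon> / 2 * log_average (disc_integral (energy h1 h2)) r"
    proof -
      have "0 \<le> r" using r by simp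
      then show ?thesis
        by (subst log_average_add[OF linear_log_integrable i], subst log_average_linear)
          (simp_all only: log_average_cmul)
    qed
    finally show ?thesis .
  qed
  have mono: "\<epsilon> * (V / (r * N)) \<le> \<epsilon> * x" "\<epsilon> / 2 * (V / (r * N)) \<le> \<epsilon> / 2 * x" if "V / (r * N) \<le> x" for x
    using that \<epsilon> by (auto intro!: mult_left_mono simp del: times_divide_eq_right)
  have "concentrated h1 h2 q \<epsilon> r"
    unfolding concentrated_def
  proof (intro conjI)
    have r0: "0 \<le> r" using r by simp
    have E': "V / (r * N) \<le> disc_integral (energy h1 h2) r" using Vle E_r by linarith
    note N3 = N(3,4)[folded V_def]
    show "circ_integral (speed h1 h2) r < \<epsilon> * disc_integral (energy h1 h2) r"
      using C_le[OF r0 order_refl] N3(1) mono(1)[OF E'] by (simp only: mult.assoc mult.commute mult.left_commute)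
    show "disc_integral (defect q h1 h2) r < \<epsilon> * disc_integral (energy h1 h2) r"
      using B_le[OF r0 order_refl] N3(2) mono(2)[OF E'] by linarith
    show "log_average (circ_integral (speed h1 h2)) r < \<epsilon> * log_average (disc_integral (energy h1 h2)) r"
      using LC N3(1) mono(1)[OF LE_ge] by (simp only: mult.assoc mult.commute mult.left_commute)
    show "log_average (disc_integral (defect q h1 h2)) r < \<epsilon> * log_average (disc_integral (energy h1 h2)) r"
      using LB N3(2) mono(2)[OF LE_ge] by linarith
  qed
  then show ?thesis using that[OF h1 h2 r(2)] h1_close h2_close by blast
qed

section \<open>Construction of the entire curve\<close>

text \<open>Decoding pairs repeats every item of a countable list infinitely often: the code of (j,
  K) is at least K and names item j.\<close>

lemma dense_requirement_sequence:
  obtains \<rho> :: "nat \<Rightarrow> bool \<times> complex" where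
    "\<And>b p e K. e > 0 \<Longrightarrow> \<exists>k\<ge>K. fst (\<rho> k) = b \<and> cmod (snd (\<rho> k) - p) < e"
proof -
  obtain D :: "complex set" where D: "countable D" "\<And>X. open X \<Longrightarrow> X \<noteq> {} \<Longrightarrow> \<exists>d\<in>D. d \<in> X"
    using countable_dense_setE by blast
  have ne: "(UNIV :: bool set) \<times> D \<noteq> {}" using D(2)[of UNIV] by auto
  have cD: "countable ((UNIV :: bool set) \<times> D)" using D(1) by simp
  define \<rho> where "\<rho> = (\<lambda>k. from_nat_into ((UNIV :: bool set) \<times> D) (fst (prod_decode k)))"
  show ?thesis
  proof (rule that[of \<rho>])
    fix b p and e :: real and K :: nat assume "e > 0"
    then obtain d where d: "d \<in> D" "d \<in> ball p e" using D(2)[of "ball p e"] by auto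
    obtain j where j: "from_nat_into ((UNIV :: bool set) \<times> D) j = (b, d)"
      using from_nat_into_surj[OF cD, of "(b, d)"] d by auto
    have "\<rho> (prod_encode (j, K)) = (b, d)" by (simp add: \<rho>_def j)
    moreover have "prod_encode (j, K) \<ge> K" by (rule le_prod_encode_2)
    ultimately show "\<exists>k\<ge>K. fst (\<rho> k) = b \<and> cmod (snd (\<rho> k) - p) < e"
      using d by (intro exI[of _ "prod_encode (j, K)"]) (auto simp: dist_norm norm_minus_commute)
  qed
qed

text \<open>The flag tells in which factor the target point lies.\<close>

definition directed :: "bool \<times> complex \<Rightarrow> (complex \<Rightarrow> complex) \<Rightarrow> (complex \<Rightarrow> complex) \<Rightarrow> real \<Rightarrow> real \<Rightarrow> bool" where
  "directed q g1 g2 \<epsilon> R \<longleftrightarrow> (if fst q then concentrated g1 g2 (snd q) \<epsilon> R else concentrated g2 g1 (snd q) \<epsilon> R)"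

lemma directed_stable:
  assumes "g1 holomorphic_on UNIV" "g2 holomorphic_on UNIV" "R > 0" "\<epsilon> > 0" "directed q g1 g2 \<epsilon> R"
  obtains \<delta> where "\<delta> > 0" "\<And>f1 f2. \<lbrakk>f1 holomorphic_on UNIV; f2 holomorphic_on UNIV;
    \<And>z. z \<in> cball 0 (R + 1) \<Longrightarrow> cmod (f1 z - g1 z) \<le> \<delta> \<and> cmod (f2 z - g2 z) \<le> \<delta>\<rbrakk> \<Longrightarrow>
    directed q f1 f2 \<epsilon> R"
proof (cases "fst q")
  case True
  then have "concentrated g1 g2 (snd q) \<epsilon> R" using assms by (simp add: directed_def)
  from concentrated_stable[OF assms(1,2,3,4) this] obtain \<delta> where "\<delta> > 0" "\<And>f1 f2. \<lbrakk>f1 holomorphic_on UNIV; f2 holomorphic_on UNIV;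
    \<And>z. z \<in> cball 0 (R + 1) \<Longrightarrow> cmod (f1 z - g1 z) \<le> \<delta> \<and> cmod (f2 z - g2 z) \<le> \<delta>\<rbrakk> \<Longrightarrow>
    concentrated f1 f2 (snd q) \<epsilon> R" by blast
  with True that[of \<delta>] show ?thesis by (simp add: directed_def)
next
  case False
  then have "concentrated g2 g1 (snd q) \<epsilon> R" using assms by (simp add: directed_def)
  from concentrated_stable[OF assms(2,1,3,4) this] obtain \<delta> where "\<delta> > 0" "\<And>f1 f2. \<lbrakk>f1 holomorphic_on UNIV; f2 holomorphic_on UNIV;
    \<And>z. z \<in> cball 0 (R + 1) \<Longrightarrow> cmod (f1 z - g2 z) \<le> \<delta> \<and> cmod (f2 z - g1 z) \<le> \<delta>\<rbrakk> \<Longrightarrow>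
    concentrated f1 f2 (snd q) \<epsilon> R" by blast
  with False that[of \<delta>] show ?thesis by (simp add: directed_def)
qed

lemma directed_approximation:
  assumes "g1 holomorphic_on UNIV" "g2 holomorphic_on UNIV" "\<epsilon> > 0" "\<delta> > 0" "R0 > 0"
  obtains h1 h2 r where "h1 holomorphic_on UNIV" "h2 holomorphic_on UNIV" "r > R0"
    "\<And>z. z \<in> cball 0 R0 \<Longrightarrow> cmod (h1 z - g1 z) \<le> \<delta> \<and> cmod (h2 z - g2 z) \<le> \<delta>"
    "directed q h1 h2 \<epsilon> r"
proof (cases "fst q")
  case True
  obtain h1 h2 r where "h1 holomorphic_on UNIV" "h2 holomorphic_on UNIV" "r > R0"
    "\<And>z. z \<in> cball 0 R0 \<Longrightarrow> cmod (h1 z - g1 z) \<le> \<delta> \<and> cmod (h2 z - g2 z) \<le> \<delta>"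
    "concentrated h1 h2 (snd q) \<epsilon> r"
    using concentrated_approximation[OF assms, of "snd q"] by blast
  with True that[of h1 h2 r] show ?thesis by (simp add: directed_def)
next
  case False
  obtain h1 h2 r where "h1 holomorphic_on UNIV" "h2 holomorphic_on UNIV" "r > R0"
    "\<And>z. z \<in> cball 0 R0 \<Longrightarrow> cmod (h1 z - g2 z) \<le> \<delta> \<and> cmod (h2 z - g1 z) \<le> \<delta>"
    "concentrated h1 h2 (snd q) \<epsilon> r"
    using concentrated_approximation[OF assms(2,1,3-5), of "snd q"] by blast
  with False that[of h2 h1 r] show ?thesis by (simp add: directed_def)
qed

text \<open>The allowance for each step is a difference
  \<open>\<delta> k - \<delta> (Suc k)\<close>, so allowances telescope and the limit stays within
  \<open>\<delta> k\<close> of stage k. Halving gives uniform convergence on discs, and the growing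
  radii exhaust the plane.\<close>

lemma entire_limit:
  fixes f :: "nat \<Rightarrow> complex \<Rightarrow> complex" and r \<delta> :: "nat \<Rightarrow> real"
  assumes hol: "\<And>k. f k holomorphic_on UNIV"
    and step: "\<And>k z. z \<in> cball 0 (r k + 1) \<Longrightarrow> cmod (f (Suc k) z - f k z) \<le> \<delta> k - \<delta> (Suc k)"
    and \<delta>: "\<And>k. \<delta> k > 0" "\<And>k. \<delta> (Suc k) \<le> \<delta> k / 2" and r: "\<And>k. r k + 1 \<le> r (Suc k)" "r 0 > 0"
  obtains g where "g holomorphic_on UNIV" "\<And>k z. z \<in> cball 0 (r k + 1) \<Longrightarrow> cmod (g z - f k z) \<le> \<delta> k"
proof -
  have r_mono: "r k \<le> r m" if "k \<le> m" for k m
    using that by (rule lift_Suc_mono_le[rotated]) (use r(1) in \<open>smt (verit)\<close>)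
  have r_ge: "r k \<ge> real k" for k
  proof (induction k)
    case (Suc k) then show ?case using r(1)[of k] by simp
  qed (use r in simp)
  have \<delta>_small: "\<delta> k \<le> \<delta> 0 * (1/2) ^ k" for k
  proof (induction k)
    case (Suc k) then show ?case using \<delta>(2)[of k] by simp
  qed simp
  have tele: "cmod (f m z - f k z) \<le> \<delta> k - \<delta> m" if z: "z \<in> cball 0 (r k + 1)" and "k \<le> m" for k m z
    using \<open>k \<le> m\<close>
  proof (induction m rule: dec_induct)
    case (step m)
    have "z \<in> cball 0 (r m + 1)" using z r_mono[OF step(1)] by simp
    then have "cmod (f (Suc m) z - f m z) \<le> \<delta> m - \<delta> (Suc m)" by (rule assms(2))
    then show ?case using step.IH norm_triangle_ineq[of "f (Suc m) z - f m z" "f m z - f k z"] by simp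
  qed simp
  have \<delta>0: "\<delta> \<longlonglongrightarrow> 0"
  proof (rule tendsto_sandwich[of "\<lambda>_. 0" \<delta> sequentially "\<lambda>k. \<delta> 0 * (1/2) ^ k"])
    have "(\<lambda>k. \<delta> 0 * (1/2::real) ^ k) \<longlonglongrightarrow> \<delta> 0 * 0"
      by (intro tendsto_intros LIMSEQ_realpow_zero) auto
    then show "(\<lambda>k. \<delta> 0 * (1/2::real) ^ k) \<longlonglongrightarrow> 0" by simp
  qed (use \<delta>_small less_imp_le[OF \<delta>(1)] in auto)
  have conv: "convergent (\<lambda>k. f k z)" for z
  proof -
    obtain k0 :: nat where k0: "cmod z \<le> real k0" using real_arch_simple by blast
    have "Cauchy (\<lambda>k. f k z)"
    proof (rule metric_CauchyI)
      fix e :: real assume "e > 0"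
      then have "\<forall>\<^sub>F k in sequentially. \<delta> k < e / 2" using order_tendstoD(2)[OF \<delta>0, of "e/2"] by simp
      then obtain k1 where k1: "\<And>k. k \<ge> k1 \<Longrightarrow> \<delta> k < e / 2" unfolding eventually_sequentially by blast
      define k where "k = max k0 k1"
      have z: "z \<in> cball 0 (r k + 1)" using k0 r_ge[of k] by (simp add: k_def)
      have "dist (f m z) (f k z) < e / 2" if "m \<ge> k" for m
        using tele[OF z that] \<delta>(1)[of m] k1[of k] by (simp add: dist_norm k_def)
      then have "dist (f m z) (f n z) < e" if "m \<ge> k" "n \<ge> k" for m n
        using that dist_triangle_half_l by (metis dist_commute)
      then show "\<exists>M. \<forall>m\<ge>M. \<forall>n\<ge>M. dist (f m z) (f n z) < e" by blast
    qed
    then show ?thesis by (rule Cauchy_convergent)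
  qed
  define g where "g = (\<lambda>z. lim (\<lambda>k. f k z))"
  have lim: "(\<lambda>k. f k z) \<longlonglongrightarrow> g z" for z
    unfolding g_def using conv convergent_LIMSEQ_iff by blast
  have close: "cmod (g z - f k z) \<le> \<delta> k" if z: "z \<in> cball 0 (r k + 1)" for k z
  proof (rule Lim_norm_ubound)
    show "(\<lambda>m. f m z - f k z) \<longlonglongrightarrow> g z - f k z" by (intro tendsto_intros lim)
    have "cmod (f m z - f k z) \<le> \<delta> k" if "m \<ge> k" for m
      using tele[OF z that] \<delta>(1)[of m] by simp
    then show "\<forall>\<^sub>F m in sequentially. cmod (f m z - f k z) \<le> \<delta> k"
      unfolding eventually_sequentially by blast
  qed simp
  show ?thesis
  proof (rule that[OF _ close])
    show "g holomorphic_on UNIV"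
    proof (rule holomorphic_uniform_sequence[OF open_UNIV hol])
      fix x :: complex
      obtain k0 :: nat where k0: "cmod x \<le> real k0" using real_arch_simple by blast
      have "uniform_limit (cball x 1) f g sequentially"
      proof (rule uniform_limitI)
        fix e :: real assume "e > 0"
        then have "\<forall>\<^sub>F k in sequentially. \<delta> k < e" using order_tendstoD(2)[OF \<delta>0] by simp
        moreover have "\<forall>\<^sub>F k in sequentially. k \<ge> k0" by (rule eventually_ge_at_top)
        ultimately show "\<forall>\<^sub>F k in sequentially. \<forall>z\<in>cball x 1. dist (f k z) (g z) < e"
        proof eventually_elim
          case (elim k)
          show ?case
          proof
            fix z assume "z \<in> cball x 1"
            then have "cmod z \<le> cmod x + 1"
              using norm_triangle_ineq2[of z x] by (simp add: dist_norm norm_minus_commute)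
            then have "z \<in> cball 0 (r k + 1)" using k0 r_ge[of k] elim(2) by simp
            then show "dist (f k z) (g z) < e"
              using close elim(1) by (fastforce simp: dist_norm norm_minus_commute)
          qed
        qed
      qed
      then show "\<exists>d>0. cball x d \<subseteq> UNIV \<and> uniform_limit (cball x d) f g sequentially"
        by (intro exI[of _ 1]) auto
    qed
  qed
qed

text \<open>The stability tolerance is part of the state of the recursion: all later corrections
  together stay within it, so what a stage achieves holds for the limit.\<close>

lemma universal_entire_pair:
  fixes \<rho> :: "nat \<Rightarrow> bool \<times> complex"
  obtains g1 g2 r where "g1 holomorphic_on UNIV" "g2 holomorphic_on UNIV" "r 0 > 0"
    "\<And>k. r k + 1 \<le> r (Suc k)" "\<And>k. directed (\<rho> k) g1 g2 (1 / (real k + 1)) (r k)"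
proof -
  define ok :: "nat \<Rightarrow> (complex \<Rightarrow> complex) \<times> (complex \<Rightarrow> complex) \<times> real \<times> real \<Rightarrow> bool" where
    "ok = (\<lambda>k (h1, h2, r, \<delta>). h1 holomorphic_on UNIV \<and> h2 holomorphic_on UNIV \<and> r > 0 \<and> \<delta> > 0 \<and>
      (\<forall>f1 f2. f1 holomorphic_on UNIV \<longrightarrow> f2 holomorphic_on UNIV \<longrightarrow>
        (\<forall>z\<in>cball 0 (r + 1). cmod (f1 z - h1 z) \<le> \<delta> \<and> cmod (f2 z - h2 z) \<le> \<delta>) \<longrightarrow>
        directed (\<rho> k) f1 f2 (1 / (real k + 1)) r))"
  define nxt :: "(complex \<Rightarrow> complex) \<times> (complex \<Rightarrow> complex) \<times> real \<times> real \<Rightarrow>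
      (complex \<Rightarrow> complex) \<times> (complex \<Rightarrow> complex) \<times> real \<times> real \<Rightarrow> bool" where
    "nxt = (\<lambda>(h1, h2, r, \<delta>) (h1', h2', r', \<delta>'). r + 1 \<le> r' \<and> \<delta>' \<le> \<delta> / 2 \<and>
      (\<forall>z\<in>cball 0 (r + 1). cmod (h1' z - h1 z) \<le> \<delta> - \<delta>' \<and> cmod (h2' z - h2 z) \<le> \<delta> - \<delta>'))"
  have extend: "\<exists>y. ok k y \<and> nxt (h1, h2, r, \<delta>) y"
    if h: "h1 holomorphic_on UNIV" "h2 holomorphic_on UNIV" and r: "r > 0" and \<delta>: "\<delta> > 0" for h1 h2 r \<delta> k
  proof -
    have p: "1 / (real k + 1) > 0" "\<delta> / 2 > 0" "r + 1 > 0" using \<delta> r by auto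
    obtain f1 f2 r' where f: "f1 holomorphic_on UNIV" "f2 holomorphic_on UNIV" "r' > r + 1"
      "\<And>z. z \<in> cball 0 (r + 1) \<Longrightarrow> cmod (f1 z - h1 z) \<le> \<delta> / 2 \<and> cmod (f2 z - h2 z) \<le> \<delta> / 2"
      "directed (\<rho> k) f1 f2 (1 / (real k + 1)) r'"
      using directed_approximation[OF h p, of "\<rho> k"] by blast
    have r': "r' > 0" using f r by linarith
    obtain \<delta>' where \<delta>': "\<delta>' > 0" "\<And>k1 k2. \<lbrakk>k1 holomorphic_on UNIV; k2 holomorphic_on UNIV;
        \<And>z. z \<in> cball 0 (r' + 1) \<Longrightarrow> cmod (k1 z - f1 z) \<le> \<delta>' \<and> cmod (k2 z - f2 z) \<le> \<delta>'\<rbrakk> \<Longrightarrow>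
        directed (\<rho> k) k1 k2 (1 / (real k + 1)) r'"
      using directed_stable[OF f(1,2) r' p(1) f(5)] by blast
    \<comment> \<open>The bound \<open>\<delta>'\<close> keeps the new stage stable; the bound by
      half the old tolerance lets the present correction, of size \<open>\<delta> / 2\<close>, fit
      into the allowance \<open>\<delta> - d\<close>.\<close>
    define d where "d = min \<delta>' (\<delta> / 2)"
    have d: "d > 0" "d \<le> \<delta>'" "d \<le> \<delta> / 2" using \<delta>' \<delta> by (auto simp: d_def)
    have "ok k (f1, f2, r', d)"
      unfolding ok_def using f(1,2) r' d(1) \<delta>'(2) order_trans[OF _ d(2)] by blast
    moreover have "nxt (h1, h2, r, \<delta>) (f1, f2, r', d)"
      unfolding nxt_def using f(3,4) d(3) by fastforce
    ultimately show ?thesis by blast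
  qed
  \<comment> \<open>Stage 0 is an extension of the zero functions, with an auxiliary radius and
    tolerance 1.\<close>
  have "\<exists>x. ok 0 x"
    using extend[of "\<lambda>_. 0" "\<lambda>_. 0" 1 1 0] by (auto intro!: holomorphic_intros)
  moreover have "\<exists>y. ok (Suc k) y \<and> nxt x y" if "ok k x" for k x
    using that extend[of _ _ _ _ "Suc k"] by (cases x) (auto simp: ok_def)
  ultimately obtain x where x: "\<And>k. ok k (x k)" "\<And>k. nxt (x k) (x (Suc k))"
    using dependent_nat_choice[of ok "\<lambda>_. nxt"] by metis
  define h1 h2 r \<delta> where "h1 = (\<lambda>k. fst (x k))" and "h2 = (\<lambda>k. fst (snd (x k)))"
    and "r = (\<lambda>k. fst (snd (snd (x k))))" and "\<delta> = (\<lambda>k. snd (snd (snd (x k))))"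
  have xk: "x k = (h1 k, h2 k, r k, \<delta> k)" for k
    by (simp add: h1_def h2_def r_def \<delta>_def)
  have ok: "h1 k holomorphic_on UNIV" "h2 k holomorphic_on UNIV" "r k > 0" "\<delta> k > 0"
    "\<And>f1 f2. f1 holomorphic_on UNIV \<Longrightarrow> f2 holomorphic_on UNIV \<Longrightarrow>
        (\<forall>z\<in>cball 0 (r k + 1). cmod (f1 z - h1 k z) \<le> \<delta> k \<and> cmod (f2 z - h2 k z) \<le> \<delta> k) \<Longrightarrow>
        directed (\<rho> k) f1 f2 (1 / (real k + 1)) (r k)" for k
    using x(1)[of k] unfolding xk ok_def by auto
  have nxt: "r k + 1 \<le> r (Suc k)" "\<delta> (Suc k) \<le> \<delta> k / 2"
      "\<And>z. z \<in> cball 0 (r k + 1) \<Longrightarrow> cmod (h1 (Suc k) z - h1 k z) \<le> \<delta> k - \<delta> (Suc k)"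
      "\<And>z. z \<in> cball 0 (r k + 1) \<Longrightarrow> cmod (h2 (Suc k) z - h2 k z) \<le> \<delta> k - \<delta> (Suc k)" for k
    using x(2)[of k] unfolding xk nxt_def by auto
  obtain g1 where g1: "g1 holomorphic_on UNIV" "\<And>k z. z \<in> cball 0 (r k + 1) \<Longrightarrow> cmod (g1 z - h1 k z) \<le> \<delta> k"
    using entire_limit[of h1 r \<delta>, OF ok(1) nxt(3) ok(4) nxt(2,1) ok(3)] by blast
  obtain g2 where g2: "g2 holomorphic_on UNIV" "\<And>k z. z \<in> cball 0 (r k + 1) \<Longrightarrow> cmod (g2 z - h2 k z) \<le> \<delta> k"
    using entire_limit[of h2 r \<delta>, OF ok(2) nxt(4) ok(4) nxt(2,1) ok(3)] by blast
  show ?thesis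
    by (rule that[of g1 g2 r, OF g1(1) g2(1) ok(3) nxt(1)]) (intro ok(5) g1(1) g2(1) ballI conjI g1(2) g2(2))
qed

text \<open>Diagonal choice: entry l uses a target point within 1/(l + 1) of p at an index k \<ge>
  l, whose own tolerance is at most 1/(l + 1); together these errors are at most 2/(l + 1).\<close>

lemma concentrated_radii:
  fixes r :: "nat \<Rightarrow> real"
  assumes g: "g1 holomorphic_on UNIV" "g2 holomorphic_on UNIV" and r: "r 0 > 0" "\<And>k. r k + 1 \<le> r (Suc k)"
    and dense: "\<And>e K. e > 0 \<Longrightarrow> \<exists>k\<ge>K. \<exists>q. cmod (q - p) < e \<and> concentrated g1 g2 q (1 / (real k + 1)) (r k)"
  obtains s where "radii s" "\<And>\<epsilon>. \<epsilon> > 0 \<Longrightarrow> \<forall>\<^sub>F l in sequentially. concentrated g1 g2 p \<epsilon> (s l)"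
proof -
  have sm: "strict_mono r"
    by (rule strict_monoI_Suc) (use r(2) in \<open>smt (verit)\<close>)
  have r_pos: "r k > 0" for k using r(1) strict_mono_less_eq[OF sm, of 0 k] by simp
  have r_ge: "r k \<ge> real k" for k
  proof (induction k)
    case (Suc k) then show ?case using r(2)[of k] by simp
  qed (use r in simp)
  define Q where "Q = (\<lambda>l k. l \<le> k \<and> (\<exists>q. cmod (q - p) < 1 / (real l + 1) \<and> concentrated g1 g2 q (1 / (real k + 1)) (r k)))"
  have ex: "\<exists>k\<ge>K. Q l k" for l K
    using dense[of "1 / (real l + 1)" "max l K"] unfolding Q_def by auto
  have "\<exists>k. \<forall>l. Q l (k l) \<and> k l < k (Suc l)"
  proof (rule dependent_nat_choice)
    show "\<exists>k. Q 0 k" using ex by blast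
    show "\<exists>k'. Q (Suc l) k' \<and> k < k'" if "Q l k" for k l
      using ex[of "Suc k" "Suc l"] by (meson Suc_le_lessD)
  qed
  then obtain k where k: "\<And>l. Q l (k l)" "\<And>l. k l < k (Suc l)" by blast
  have smk: "strict_mono k" using k(2) by (rule strict_monoI_Suc)
  have conc: "concentrated g1 g2 p (2 / (real l + 1)) (r (k l))" for l
  proof -
    obtain q where q: "l \<le> k l" "cmod (q - p) < 1 / (real l + 1)" "concentrated g1 g2 q (1 / (real (k l) + 1)) (r (k l))"
      using k(1)[of l] unfolding Q_def by blast
    have "concentrated g1 g2 p (1 / (real (k l) + 1) + cmod (q - p)) (r (k l))"
      by (rule concentrated_change_point[OF g _ _ q(3)]) (use r_pos less_imp_le in auto)
    moreover have "1 / (real (k l) + 1) + cmod (q - p) \<le> 2 / (real l + 1)"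
    proof -
      have "1 / (real (k l) + 1) \<le> 1 / (real l + 1)" using q(1) by (intro divide_left_mono) auto
      moreover have "2 / (real l + 1) = 1 / (real l + 1) + 1 / (real l + 1)" by (simp add: add_divide_distrib[symmetric])
      ultimately show ?thesis using q(2) by linarith
    qed
    ultimately show ?thesis
      using concentrated_mono[OF g] r_pos less_imp_le by blast
  qed
  show ?thesis
  proof (rule that[of "r \<circ> k"])
    show "radii (r \<circ> k)"
      unfolding radii_def
    proof (intro conjI)
      show "(r \<circ> k) 0 > 0" using r_pos by simp
      show "strict_mono (r \<circ> k)" using sm smk by (rule strict_mono_o)
      have "real l \<le> (r \<circ> k) l" for l
        using r_ge[of "k l"] seq_suble[OF smk, of l] by (simp add: order_trans[OF _ r_ge])
      then show "filterlim (r \<circ> k) at_top sequentially"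
        by (intro filterlim_at_top_mono[OF filterlim_real_sequentially]) auto
    qed
    fix \<epsilon> :: real assume \<epsilon>: "\<epsilon> > 0"
    have "\<forall>\<^sub>F l in sequentially. 2 / (real l + 1) < \<epsilon>" using \<epsilon> by real_asymp
    then show "\<forall>\<^sub>F l in sequentially. concentrated g1 g2 p \<epsilon> ((r \<circ> k) l)"
    proof eventually_elim
      case (elim l)
      show ?case
        using concentrated_mono[OF g _ _ conc[of l], of \<epsilon>] elim r_pos[of "k l"] by simp
    qed
  qed
qed

text \<open>A constant pair has zero energy, and then both sides of the strict length inequality
  vanish.\<close>

lemma concentrated_nonconstant:
  assumes "concentrated g1 g2 p \<epsilon> R"
  shows "\<exists>z w. (g1 z, g2 z) \<noteq> (g1 w, g2 w)"
proof (rule ccontr)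
  assume "\<not> ?thesis"
  then have "g1 = (\<lambda>_. g1 0)" "g2 = (\<lambda>_. g2 0)" by (auto simp: fun_eq_iff)
  then have "deriv g1 z = 0" "deriv g2 z = 0" for z by (metis deriv_const)+
  then have "energy g1 g2 = (\<lambda>_. 0)" by (simp add: fun_eq_iff energy_def)
  then show False
    using assms by (simp add: concentrated_def circ_integral_def disc_integral_def)
qed

text \<open>The normalised integrals converge along the whole sequence, so every subsequence yields
  the same current.\<close>

lemma nev_current_unique:
  assumes "c > 0" and "\<And>\<eta>. TF \<eta> \<Longrightarrow> (\<lambda>l. nev_T \<eta> g1 g2 (r l) / nev_T omega11 g1 g2 (r l)) \<longlonglongrightarrow> of_real c * cur \<eta>"
    and "nev_current TF g1 g2 r \<Phi>"
  shows "\<exists>c>0. \<forall>\<eta>. TF \<eta> \<longrightarrow> \<Phi> \<eta> = of_real c * cur \<eta>"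
proof -
  obtain \<phi> :: "nat \<Rightarrow> nat" where \<phi>: "strict_mono \<phi>" "\<And>\<eta>. TF \<eta> \<Longrightarrow>
      (\<lambda>n. nev_T \<eta> g1 g2 (r (\<phi> n)) / nev_T omega11 g1 g2 (r (\<phi> n))) \<longlonglongrightarrow> \<Phi> \<eta>"
    using assms(3) unfolding nev_current_def by blast
  have "\<Phi> \<eta> = of_real c * cur \<eta>" if "TF \<eta>" for \<eta>
    using LIMSEQ_unique[OF \<phi>(2)[OF that]] LIMSEQ_subseq_LIMSEQ[OF assms(2)[OF that] \<phi>(1)] by (simp add: o_def)
  then show ?thesis using assms(1) by blast
qed

lemma ahl_current_unique:
  assumes "c > 0" and "\<And>\<eta>. TF \<eta> \<Longrightarrow> (\<lambda>l. disc_int \<eta> g1 g2 (r l) / of_real (area g1 g2 (r l))) \<longlonglongrightarrow> of_real c * cur \<eta>"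
    and "ahl_current TF g1 g2 r \<Phi>"
  shows "\<exists>c>0. \<forall>\<eta>. TF \<eta> \<longrightarrow> \<Phi> \<eta> = of_real c * cur \<eta>"
proof -
  obtain \<phi> :: "nat \<Rightarrow> nat" where \<phi>: "strict_mono \<phi>" "\<And>\<eta>. TF \<eta> \<Longrightarrow>
      (\<lambda>n. disc_int \<eta> g1 g2 (r (\<phi> n)) / of_real (area g1 g2 (r (\<phi> n)))) \<longlonglongrightarrow> \<Phi> \<eta>"
    using assms(3) unfolding ahl_current_def by blast
  have "\<Phi> \<eta> = of_real c * cur \<eta>" if "TF \<eta>" for \<eta>
    using LIMSEQ_unique[OF \<phi>(2)[OF that]] LIMSEQ_subseq_LIMSEQ[OF assms(2)[OF that] \<phi>(1)] by (simp add: o_def)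
  then show ?thesis using assms(1) by blast
qed

section \<open>Exchange of the two factors and final assembly\<close>

lemma disc_int_swap: "disc_int (swap_form \<eta>) g2 g1 = disc_int \<eta> g1 g2"
  by (auto simp: disc_int_def pb_swap)

lemma nev_T_swap: "nev_T (swap_form \<eta>) g2 g1 = nev_T \<eta> g1 g2"
  by (auto simp: nev_T_def disc_int_swap)

lemma omega11_swap:
  "disc_int omega11 g2 g1 = disc_int omega11 g1 g2" "nev_T omega11 g2 g1 = nev_T omega11 g1 g2"
  "area g2 g1 = area g1 g2"
  by (auto simp: disc_int_def nev_T_def area_def pb_omega11[abs_def] energy_swap[of g2 g1])

lemma produces_swap:
  "produces_nev g2 g1 r = produces_nev g1 g2 r" "produces_ahl g2 g1 r = produces_ahl g1 g2 r"
  by (simp_all add: produces_nev_def produces_ahl_def omega11_swap nev_L_log_average bdry_len_circ_integral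
      energy_swap[of g2 g1])

lemma radii_pos: "radii r \<Longrightarrow> r l > 0"
  unfolding radii_def using strict_mono_less_eq[of r 0 l] by (simp add: less_le_trans)

lemma vertical_currents:
  assumes L: "lattice_basis a1 b1" "lattice_basis a2 b2"
    and g: "g1 holomorphic_on UNIV" "g2 holomorphic_on UNIV" and r: "r 0 > 0" "\<And>k. r k + 1 \<le> r (Suc k)"
    and dense: "\<And>e K. e > 0 \<Longrightarrow> \<exists>k\<ge>K. \<exists>q. cmod (q - p) < e \<and> concentrated g1 g2 q (1 / (real k + 1)) (r k)"
  obtains s c where "radii s" "produces_nev g1 g2 s" "produces_ahl g1 g2 s" "c > 0"
    "\<And>\<eta>. torus_form a1 b1 a2 b2 \<eta> \<Longrightarrow>
      (\<lambda>l. disc_int \<eta> g1 g2 (s l) / of_real (area g1 g2 (s l))) \<longlonglongrightarrow> of_real c * vert_current a2 b2 p \<eta>"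
    "\<And>\<eta>. torus_form a1 b1 a2 b2 \<eta> \<Longrightarrow>
      (\<lambda>l. nev_T \<eta> g1 g2 (s l) / nev_T omega11 g1 g2 (s l)) \<longlonglongrightarrow> of_real c * vert_current a2 b2 p \<eta>"
proof -
  interpret two_lattices a1 b1 a2 b2
    by unfold_locales (rule L)+
  obtain s where s: "radii s" "\<And>\<epsilon>. \<epsilon> > 0 \<Longrightarrow> \<forall>\<^sub>F l in sequentially. concentrated g1 g2 p \<epsilon> (s l)"
    using concentrated_radii[OF g r dense] by blast
  have s0: "0 \<le> s l" for l using radii_pos[OF s(1)] less_imp_le by blast
  have prod: "produces_nev g1 g2 s" "produces_ahl g1 g2 s"
    by (rule concentrated_produces[OF g s0 s(2)]; assumption)+
  show ?thesis
  proof (rule concentrated_vertical[OF g s0 s(2)])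
    fix c :: real
    assume "c > 0" "\<And>\<eta>. torus_form a1 b1 a2 b2 \<eta> \<Longrightarrow>
      (\<lambda>l. disc_int \<eta> g1 g2 (s l) / of_real (area g1 g2 (s l))) \<longlonglongrightarrow> of_real c * vert_current a2 b2 p \<eta>"
    "\<And>\<eta>. torus_form a1 b1 a2 b2 \<eta> \<Longrightarrow>
      (\<lambda>l. nev_T \<eta> g1 g2 (s l) / nev_T omega11 g1 g2 (s l)) \<longlonglongrightarrow> of_real c * vert_current a2 b2 p \<eta>"
    then show thesis by (rule that[OF s(1) prod])
  qed
qed

theorem theoremB:
  fixes a1 b1 a2 b2 :: complex
  assumes "lattice_basis a1 b1" and "lattice_basis a2 b2"
  shows "\<exists>g1 g2 :: complex \<Rightarrow> complex.
     g1 holomorphic_on UNIV \<and> g2 holomorphic_on UNIV \<and>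
     (\<exists>z w. (g1 z, g2 z) \<noteq> (g1 w, g2 w)) \<and>
     (\<forall>p1. \<exists>r. radii r \<and> produces_nev g1 g2 r \<and> produces_ahl g1 g2 r \<and>
        (\<forall>\<Phi>. nev_current (test_form a1 b1 a2 b2) g1 g2 r \<Phi> \<longrightarrow>
           (\<exists>c>0. \<forall>\<eta>. test_form a1 b1 a2 b2 \<eta> \<longrightarrow> \<Phi> \<eta> = of_real c * vert_current a2 b2 p1 \<eta>)) \<and>
        (\<forall>\<Phi>. ahl_current (test_form a1 b1 a2 b2) g1 g2 r \<Phi> \<longrightarrow>
           (\<exists>c>0. \<forall>\<eta>. test_form a1 b1 a2 b2 \<eta> \<longrightarrow> \<Phi> \<eta> = of_real c * vert_current a2 b2 p1 \<eta>))) \<and>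
     (\<forall>p2. \<exists>r. radii r \<and> produces_nev g1 g2 r \<and> produces_ahl g1 g2 r \<and>
        (\<forall>\<Phi>. nev_current (test_form a1 b1 a2 b2) g1 g2 r \<Phi> \<longrightarrow>
           (\<exists>c>0. \<forall>\<eta>. test_form a1 b1 a2 b2 \<eta> \<longrightarrow> \<Phi> \<eta> = of_real c * horiz_current a1 b1 p2 \<eta>)) \<and>
        (\<forall>\<Phi>. ahl_current (test_form a1 b1 a2 b2) g1 g2 r \<Phi> \<longrightarrow>
           (\<exists>c>0. \<forall>\<eta>. test_form a1 b1 a2 b2 \<eta> \<longrightarrow> \<Phi> \<eta> = of_real c * horiz_current a1 b1 p2 \<eta>)))"
proof -
  let ?TF = "test_form a1 b1 a2 b2"
  obtain \<rho> :: "nat \<Rightarrow> bool \<times> complex" where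
    \<rho>: "\<And>b p e K. e > 0 \<Longrightarrow> \<exists>k\<ge>K. fst (\<rho> k) = b \<and> cmod (snd (\<rho> k) - p) < e"
    using dense_requirement_sequence by blast
  obtain g1 g2 R where g: "g1 holomorphic_on UNIV" "g2 holomorphic_on UNIV" and R: "R 0 > 0"
    "\<And>k. R k + 1 \<le> R (Suc k)" and dir: "\<And>k. directed (\<rho> k) g1 g2 (1 / (real k + 1)) (R k)"
    using universal_entire_pair[of \<rho>] by blast
  have dense1: "\<exists>k\<ge>K. \<exists>q. cmod (q - p) < e \<and> concentrated g1 g2 q (1 / (real k + 1)) (R k)" if "e > 0" for e K p
    using \<rho>[OF that, of K True p] dir unfolding directed_def by metis
  have dense2: "\<exists>k\<ge>K. \<exists>q. cmod (q - p) < e \<and> concentrated g2 g1 q (1 / (real k + 1)) (R k)" if "e > 0" for e K p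
    using \<rho>[OF that, of K False p] dir unfolding directed_def by metis
  have "\<exists>z w. (g1 z, g2 z) \<noteq> (g1 w, g2 w)"
    using dense1[of 1] concentrated_nonconstant by (metis zero_less_one)
  moreover have "\<exists>r. radii r \<and> produces_nev g1 g2 r \<and> produces_ahl g1 g2 r \<and>
        (\<forall>\<Phi>. nev_current ?TF g1 g2 r \<Phi> \<longrightarrow>
           (\<exists>c>0. \<forall>\<eta>. ?TF \<eta> \<longrightarrow> \<Phi> \<eta> = of_real c * vert_current a2 b2 p1 \<eta>)) \<and>
        (\<forall>\<Phi>. ahl_current ?TF g1 g2 r \<Phi> \<longrightarrow>
           (\<exists>c>0. \<forall>\<eta>. ?TF \<eta> \<longrightarrow> \<Phi> \<eta> = of_real c * vert_current a2 b2 p1 \<eta>))" for p1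
  proof -
    obtain s c where s: "radii s" "produces_nev g1 g2 s" "produces_ahl g1 g2 s" "c > 0"
      and lim: "\<And>\<eta>. torus_form a1 b1 a2 b2 \<eta> \<Longrightarrow>
        (\<lambda>l. disc_int \<eta> g1 g2 (s l) / of_real (area g1 g2 (s l))) \<longlonglongrightarrow> of_real c * vert_current a2 b2 p1 \<eta>"
      "\<And>\<eta>. torus_form a1 b1 a2 b2 \<eta> \<Longrightarrow>
        (\<lambda>l. nev_T \<eta> g1 g2 (s l) / nev_T omega11 g1 g2 (s l)) \<longlonglongrightarrow> of_real c * vert_current a2 b2 p1 \<eta>"
      using vertical_currents[OF assms g R dense1] by blast
    show ?thesis
      by (intro exI[of _ s] conjI s(1-3) allI impI
          nev_current_unique[OF s(4) lim(2)[OF test_form_imp_torus_form]]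
          ahl_current_unique[OF s(4) lim(1)[OF test_form_imp_torus_form]])
  qed
  moreover have "\<exists>r. radii r \<and> produces_nev g1 g2 r \<and> produces_ahl g1 g2 r \<and>
        (\<forall>\<Phi>. nev_current ?TF g1 g2 r \<Phi> \<longrightarrow>
           (\<exists>c>0. \<forall>\<eta>. ?TF \<eta> \<longrightarrow> \<Phi> \<eta> = of_real c * horiz_current a1 b1 p2 \<eta>)) \<and>
        (\<forall>\<Phi>. ahl_current ?TF g1 g2 r \<Phi> \<longrightarrow>
           (\<exists>c>0. \<forall>\<eta>. ?TF \<eta> \<longrightarrow> \<Phi> \<eta> = of_real c * horiz_current a1 b1 p2 \<eta>))" for p2
  proof -
    obtain s c where s: "radii s" "produces_nev g2 g1 s" "produces_ahl g2 g1 s" "c > 0"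
      and lim: "\<And>\<eta>. torus_form a2 b2 a1 b1 \<eta> \<Longrightarrow>
        (\<lambda>l. disc_int \<eta> g2 g1 (s l) / of_real (area g2 g1 (s l))) \<longlonglongrightarrow> of_real c * vert_current a1 b1 p2 \<eta>"
      "\<And>\<eta>. torus_form a2 b2 a1 b1 \<eta> \<Longrightarrow>
        (\<lambda>l. nev_T \<eta> g2 g1 (s l) / nev_T omega11 g2 g1 (s l)) \<longlonglongrightarrow> of_real c * vert_current a1 b1 p2 \<eta>"
      using vertical_currents[OF assms(2,1) g(2,1) R dense2] by blast
    \<comment> \<open>The limits were obtained for the curve with its components exchanged; applying
      them to \<open>swap_form \<eta>\<close> transports integrals, normalisations and currents back
      to the original order.\<close>
    have lim': "(\<lambda>l. disc_int \<eta> g1 g2 (s l) / of_real (area g1 g2 (s l))) \<longlonglongrightarrow> of_real c * horiz_current a1 b1 p2 \<eta>"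
      "(\<lambda>l. nev_T \<eta> g1 g2 (s l) / nev_T omega11 g1 g2 (s l)) \<longlonglongrightarrow> of_real c * horiz_current a1 b1 p2 \<eta>"
      if "?TF \<eta>" for \<eta>
      using lim[OF torus_form_swap[OF test_form_imp_torus_form[OF that]]]
      unfolding disc_int_swap nev_T_swap omega11_swap[of g2 g1] vert_current_swap by auto
    show ?thesis
      by (intro exI[of _ s] conjI s(1) s(2,3)[unfolded produces_swap[of g2 g1]] allI impI
          nev_current_unique[OF s(4) lim'(2)] ahl_current_unique[OF s(4) lim'(1)])
  qed
  ultimately show ?thesis using g by blast
qed

end
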